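(* As $n\to\infty$, \[n^{\frac{1}{2}n-\frac{1}{2}\frac{n}{\log{n}}-O(1)}\leq H_n(C_4) \leq n^{\frac{1}{2}n+o\left(\frac{n}{\log{n}} \right)}.\]
   Context: Two graphs on the same vertex set are called $G$-creating if the union of their edge sets contains $G$ as a (not necessarily induced) subgraph. $H_n(G)$ denotes the maximum number of Hamiltonian paths of the complete graph $K_n$ that are pairwise $G$-creating. $C_4$ is the cycle of length $4$. $\log$ denotes the natural logarithm. *)

theory Defs
  imports "HOL-Analysis.Analysis" "HOL-Library.Landau_Symbols"
begin

text \<open>Finite simple graphs: edges are two-element sets of vertices.\<close>

record 'a ugraph =
  verts :: "'a set"
  edges :: "'a set set"

text \<open>\<open>H\<close> contains \<open>G\<close> as a, not necessarily induced, subgraph up to isomorphism.\<close>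

definition contains_subgraph :: "'a ugraph \<Rightarrow> 'b ugraph \<Rightarrow> bool" where
  "contains_subgraph H G \<longleftrightarrow>
     (\<exists>f. inj_on f (verts G) \<and> f ` verts G \<subseteq> verts H \<and> (\<forall>e\<in>edges G. f ` e \<in> edges H))"

definition creating :: "'b ugraph \<Rightarrow> 'a ugraph \<Rightarrow> 'a ugraph \<Rightarrow> bool" where
  "creating G A B \<longleftrightarrow>
     verts A = verts B \<and>
     contains_subgraph \<lparr>verts = verts A, edges = edges A \<union> edges B\<rparr> G"

definition complete_graph :: "nat \<Rightarrow> nat ugraph" where
  "complete_graph n = \<lparr>verts = {..<n}, edges = {e. e \<subseteq> {..<n} \<and> card e = 2}\<rparr>"

text \<open>The intended range is \<open>k \<ge> 3\<close>; for smaller \<open>k\<close> this is not a cycle.\<close>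

definition cycle_graph :: "nat \<Rightarrow> nat ugraph" where
  "cycle_graph k = \<lparr>verts = {..<k}, edges = {{i, Suc i mod k} | i. i < k}\<rparr>"

text \<open>
  A Hamiltonian path is a subgraph, not a vertex sequence, so a sequence and its reversal
  give the same path.
\<close>

definition hamiltonian_paths :: "'a ugraph \<Rightarrow> 'a ugraph set" where
  "hamiltonian_paths K =
     {\<lparr>verts = verts K, edges = {{xs ! i, xs ! Suc i} | i. Suc i < length xs}\<rparr> | xs.
        distinct xs \<and> set xs = verts K \<and>
        (\<forall>i. Suc i < length xs \<longrightarrow> {xs ! i, xs ! Suc i} \<in> edges K)}"

definition creating_families :: "nat \<Rightarrow> 'b ugraph \<Rightarrow> nat ugraph set set" where
  "creating_families n G =
     {F. F \<subseteq> hamiltonian_paths (complete_graph n) \<and> pairwise (creating G) F}"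

text \<open>The number usually written \<open>H\<^sub>n(G)\<close>.\<close>

definition H_num :: "nat \<Rightarrow> 'b ugraph \<Rightarrow> nat" where
  "H_num n G = Max (card ` creating_families n G)"

text \<open>The maximum in \<open>H_num\<close> is over a finite nonempty set, and hence is attained.\<close>

lemma finite_hamiltonian_paths: "finite (hamiltonian_paths (complete_graph n))"
proof (rule finite_subset)
  let ?S = "(\<lambda>E. \<lparr>verts = {..<n}, edges = E\<rparr>) ` Pow (Pow {..<n})"
  show "finite ?S" by (intro finite_imageI) simp
  show "hamiltonian_paths (complete_graph n) \<subseteq> ?S"
  proof
    fix P assume "P \<in> hamiltonian_paths (complete_graph n)"
    then obtain xs :: "nat list" where
      xs: "set xs = {..<n}" and
      P: "P = \<lparr>verts = {..<n}, edges = {{xs ! i, xs ! Suc i} | i. Suc i < length xs}\<rparr>"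
      unfolding hamiltonian_paths_def complete_graph_def mem_Collect_eq ugraph.simps
      by (elim exE conjE) (rule that)
    have "{{xs ! i, xs ! Suc i} | i. Suc i < length xs} \<subseteq> Pow {..<n}"
    proof
      fix e assume "e \<in> {{xs ! i, xs ! Suc i} | i. Suc i < length xs}"
      then obtain i where i: "e = {xs ! i, xs ! Suc i}" "Suc i < length xs" by blast
      then have "xs ! i \<in> set xs" "xs ! Suc i \<in> set xs" by (auto intro!: nth_mem)
      then show "e \<in> Pow {..<n}" unfolding i xs by blast
    qed
    then show "P \<in> ?S" unfolding P by (intro imageI) (rule PowI)
  qed
qed

lemma finite_creating_families: "finite (creating_families n G)"
proof (rule finite_subset)
  show "creating_families n G \<subseteq> Pow (hamiltonian_paths (complete_graph n))"
    unfolding creating_families_def by blast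
qed (simp add: finite_hamiltonian_paths)

lemma creating_families_nonempty: "creating_families n G \<noteq> {}"
proof -
  have "{} \<in> creating_families n G" unfolding creating_families_def by simp
  then show ?thesis by blast
qed

lemma cycle_graph_4:
  "cycle_graph 4 = \<lparr>verts = {0, 1, 2, 3}, edges = {{0, 1}, {1, 2}, {2, 3}, {3, 0}}\<rparr>"
proof -
  have V: "{..<4::nat} = {0, 1, 2, 3}" by auto
  have m: "Suc 0 mod 4 = 1" "Suc 1 mod 4 = 2" "Suc 2 mod 4 = 3" "Suc 3 mod 4 = 0" by simp_all
  have "{{i, Suc i mod 4} | i. i < 4} = (\<lambda>i. {i, Suc i mod 4}) ` {..<4}" by blast
  then show ?thesis
    unfolding cycle_graph_def V image_insert image_empty m by (rule arg_cong)
qed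

end

theory Submission
  imports Defs "HOL-Complex_Analysis.Complex_Analysis" "HOL-Number_Theory.Number_Theory"
    "HOL-Combinatorics.Permutations" "HOL-Real_Asymp.Real_Asymp"
begin

text \<open>
  Lower bound. Build a path vertex by vertex: the vertices in odd positions are forced, and each is
  fixed before its predecessor in even position is chosen freely. If two paths first differ in the
  free vertex, the two choices close a four-cycle with their common neighbours. This gives
  \<open>(n - 2) (n - 4) \<cdots>\<close> paths.

  Upper bound. For a prime \<open>p\<close> slightly larger than the square root of \<open>n\<close>, the graph on the affine
  plane over \<open>F\<^sub>p\<close> given by \<open>y + v = x u\<close> has no four-cycle, and by a second moment computation almost
  every vertex has the expected number of neighbours in any set that is not too small. A greedy choice
  therefore finds as many nearly spanning paths as the heuristic \<open>p / p\<^sup>2\<close> per edge predicts. Two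
  Hamiltonian paths that agree on a short final segment, and whose remaining parts a common relabelling
  of the vertices maps into the plane graph, do not create a four-cycle; averaging over all
  relabellings bounds the size of a creating family.

  That such a prime exists within a factor \<open>1 + o(1)\<close> follows from the nonvanishing of \<open>\<zeta>\<close> on
  \<open>Re s = 1\<close>. The difference of \<open>-\<zeta>'/\<zeta>\<close> and \<open>\<zeta>\<close> is smooth on this line, and testing it against Fejer
  kernels compares \<open>\<Lambda>(n) / n\<close> with \<open>1 / n\<close> on every short multiplicative window.
\<close>

section \<open>The zeta function near the line \<open>Re s = 1\<close>\<close>

text \<open>The scale that governs everything is \<open>e^(o(n))\<close>: as
  \<open>n = e^(log n)\<close>, the upper bound asserts \<open>n^(n/2)\<close> up to such a factor,
  so each of about \<open>n\<close> steps may lose only a factor \<open>1 + o(1)\<close>. A prime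
  that is merely within a constant factor of the square root of \<open>n\<close>, as Bertrand's
  postulate provides, would cost \<open>C^n\<close>; hence the detour through
  \<open>\<zeta>\<close>. For the same reason the greedy path must keep a share
  \<open>1 - O(\<epsilon>)\<close> of the expected extensions at every step.

  About primes, existence in each window \<open>|ln p - y| < \<epsilon>\<close> with
  \<open>y\<close> large is what has to be shown, and for this any positive lower bound on the
  \<open>\<Lambda>\<close>-mass of the window will do.

  In the lower bound, \<open>(n - 2) (n - 4) ...\<close> is \<open>(n / e)^(n/2)\<close> up to a
  polynomial factor; its \<open>e^(-n/2)\<close> is the term \<open>n / (2 log n)\<close> in the
  exponent.\<close>

lemma norm_of_nat_powr: "norm (of_nat n powr s :: complex) = real n powr Re s"
  using norm_powr_real_powr[of "of_nat n" s] by simp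

lemma has_field_derivative_of_nat_powr:
  fixes c s :: complex
  assumes "n > 0"
  shows "((\<lambda>s. of_nat n powr (c - s)) has_field_derivative - of_real (ln n) * of_nat n powr (c - s)) (at s)"
proof -
  have "((\<lambda>s. (of_nat n :: complex) powr (c - s)) has_field_derivative
      (Ln (of_nat n) * of_nat n powr (c - s)) * (0 - 1)) (at s)"
    by (rule DERIV_chain2[OF has_field_derivative_powr_right])
       (use assms DERIV_diff[OF DERIV_const DERIV_ident, of c s UNIV] in simp_all)
  then show ?thesis using assms by (simp add: Ln_of_nat)
qed

section \<open>Continuation of \<open>(s - 1) \<zeta>(s)\<close> across the line
  \<open>Re s = 1\<close>\<close>

definition zeta_term :: "nat \<Rightarrow> complex \<Rightarrow> complex" where
  "zeta_term k s = (s - 1) * of_nat (Suc k) powr (-s)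
     + of_nat (Suc (Suc k)) powr (1 - s) - of_nat (Suc k) powr (1 - s)"

text \<open>With \<open>n = Suc k\<close>, \<open>zeta_term k s\<close> is \<open>s - 1\<close>
  times the difference between \<open>n powr (-s)\<close> and the integral of
  \<open>x powr (-s)\<close> over \<open>[n, n + 1]\<close>. That difference has the size of a
  derivative, which gains one power of \<open>n\<close>.\<close>

lemma norm_zeta_term_le:
  assumes "Re s > 0"
  shows "norm (zeta_term k s) \<le> norm (s - 1) * norm s * real (Suc k) powr (- Re s - 1)"
proof -
  define n where "n = Suc k"
  define S where "S = closed_segment (complex_of_real n) (of_real (n + 1))"
  have S: "\<exists>x. z = of_real x \<and> real n \<le> x \<and> x \<le> n + 1" if "z \<in> S" for z
    using that unfolding S_def closed_segment_of_real by (auto simp: closed_segment_eq_real_ivl)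
  have n: "n > 0" by (simp add: n_def)
  have ends: "of_nat n \<in> S" "of_nat n + 1 \<in> S"
    unfolding S_def using ends_in_segment[where ?'a = complex] by (metis of_nat_Suc of_real_of_nat_eq Suc_eq_plus1 add.commute)+
  have conv: "convex S" by (simp add: S_def)
  have bd1: "norm (z powr (-s) - of_nat n powr (-s)) \<le> norm s * real n powr (- Re s - 1) * 1"
    if z: "z \<in> S" for z
  proof -
    have "norm (z powr (-s) - of_nat n powr (-s))
        \<le> (norm s * real n powr (- Re s - 1)) * norm (z - of_nat n)"
    proof (rule field_differentiable_bound[OF conv _ _ z ends(1), where f' = "\<lambda>z. (-s) * z powr (-s - 1)"])
      fix z assume "z \<in> S"
      then obtain x where x: "z = of_real x" "real n \<le> x" "x \<le> n + 1" using S by blast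
      have "x > 0" using x n by linarith
      then show "((\<lambda>z. z powr (-s)) has_field_derivative (-s) * z powr (-s - 1)) (at z within S)"
        using x by (auto intro!: derivative_eq_intros simp: complex_nonpos_Reals_iff)
      have "norm (z powr (-s - 1)) = x powr (- Re s - 1)"
        using x \<open>x > 0\<close> by (simp add: norm_powr_real_powr)
      also have "\<dots> \<le> real n powr (- Re s - 1)"
        using x n assms by (intro powr_mono2') auto
      finally show "norm ((-s) * z powr (-s - 1)) \<le> norm s * real n powr (- Re s - 1)"
        by (simp add: norm_mult mult_left_mono)
    qed
    also have "norm (z - of_nat n) \<le> 1"
    proof -
      obtain x where x: "z = of_real x" "real n \<le> x" "x \<le> n + 1" using S[OF z] by blast
      have "z - of_nat n = of_real (x - n)" using x by simp
      then have "norm (z - of_nat n) = \<bar>x - n\<bar>" by (metis norm_of_real)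
      then show ?thesis using x by auto
    qed
    then have "(norm s * real n powr (- Re s - 1)) * norm (z - of_nat n)
         \<le> (norm s * real n powr (- Re s - 1)) * 1"
      by (intro mult_left_mono) auto
    finally show ?thesis by simp
  qed
  \<comment> \<open>The derivative of \<open>F\<close> is
    \<open>(1 - s) (z powr (-s) - n powr (-s))\<close>, small by the first mean value estimate, and
    the increment of \<open>F\<close> over \<open>[n, n + 1]\<close> is
    \<open>zeta_term k s\<close>; so a second mean value estimate finishes.\<close>
  define F where "F = (\<lambda>z. z powr (1 - s) + (s - 1) * of_nat n powr (-s) * z)"
  have "norm (F (of_nat n + 1) - F (of_nat n))
      \<le> norm (s - 1) * (norm s * real n powr (- Re s - 1)) * norm (of_nat n + 1 - of_nat n :: complex)"
  proof (rule field_differentiable_bound[OF conv _ _ ends(2) ends(1),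
          where f' = "\<lambda>z. (1 - s) * z powr (1 - s - 1) + (s - 1) * of_nat n powr (-s)"])
    fix z assume z: "z \<in> S"
    then obtain x where x: "z = of_real x" "real n \<le> x" "x \<le> n + 1" using S by blast
    have "x > 0" using x n by linarith
    then show "(F has_field_derivative (1 - s) * z powr (1 - s - 1) + (s - 1) * of_nat n powr (-s))
            (at z within S)"
      unfolding F_def using x by (auto intro!: derivative_eq_intros simp: complex_nonpos_Reals_iff)
    have "(1 - s) * z powr (1 - s - 1) + (s - 1) * of_nat n powr (-s)
        = (1 - s) * (z powr (- s) - of_nat n powr (-s))"
      by (simp add: algebra_simps)
    then show "norm ((1 - s) * z powr (1 - s - 1) + (s - 1) * of_nat n powr (-s))
       \<le> norm (s - 1) * (norm s * real n powr (- Re s - 1))"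
      using bd1[OF z] by (simp add: norm_mult norm_minus_commute mult_left_mono)
  qed
  moreover have "F (of_nat n + 1) - F (of_nat n) = zeta_term k s"
    by (simp add: F_def zeta_term_def n_def algebra_simps)
  ultimately show ?thesis by (simp add: n_def mult_ac)
qed

text \<open>\<open>zeta1 s\<close> is \<open>(s - 1) \<zeta>(s)\<close>, continued past the pole at \<open>1\<close>.\<close>

definition zeta1 :: "complex \<Rightarrow> complex" where
  "zeta1 s = 1 + (\<Sum>k. zeta_term k s)"

lemma open_Re_gt: "open {s::complex. Re s > c}"
  by (rule open_halfspace_Re_gt)

text \<open>Local domination makes the series holomorphic. The half-plane \<open>Re s > 1/2\<close>
  is an open neighbourhood of \<open>Re s \<ge> 1\<close> on which a multiple of the summable
  \<open>n powr (-3/2)\<close> dominates.\<close>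

lemma zeta_term_series_deriv:
  shows "\<exists>g g'. \<forall>s \<in> {s. Re s > 1/2}. ((\<lambda>k. zeta_term k s) sums g s) \<and> 
          ((\<lambda>k. deriv (zeta_term k) s) sums g' s) \<and> (g has_field_derivative g' s) (at s)"
proof (rule series_and_derivative_comparison_local[OF open_Re_gt])
  fix k and s :: complex assume "s \<in> {s. Re s > 1/2}"
  have D: "(\<lambda>s. of_nat (Suc m) powr (c - s)) field_differentiable (at s)" for c m
    unfolding field_differentiable_def by (rule exI, rule has_field_derivative_of_nat_powr) simp
  have "zeta_term k field_differentiable at s"
    unfolding zeta_term_def
    by (intro field_differentiable_diff field_differentiable_add field_differentiable_mult
        field_differentiable_ident field_differentiable_const D D[where c = 0, unfolded diff_0])
  then show "(zeta_term k has_field_derivative deriv (zeta_term k) s) (at s)"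
    by (rule field_differentiable_derivI)
next
  fix x :: complex
  define h where "h = (\<lambda>k. (norm x + 2) * (norm x + 1) * real (Suc k) powr (-(3/2)))"
  have "summable (\<lambda>k. real (Suc k) powr (-(3/2)))"
    using summable_Suc_iff[of "\<lambda>k. real k powr (-(3/2))"] by (simp add: summable_real_powr_iff)
  then have "summable h" unfolding h_def by (rule summable_mult)
  moreover have "norm (zeta_term k y) \<le> h k" if y: "y \<in> ball x 1 \<inter> {s. Re s > 1/2}" for y k
  proof -
    have "norm (x - y) < 1" using y by (simp add: dist_norm)
    then have a: "norm y \<le> norm x + 1" using norm_triangle_ineq4[of x "x - y"] by simp
    moreover have "norm (y - 1) \<le> norm y + 1" using norm_triangle_ineq4[of y 1] by simp
    ultimately have b: "norm (y - 1) \<le> norm x + 2" by simp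
    have c: "real (Suc k) powr (- Re y - 1) \<le> real (Suc k) powr (-(3/2))"
      using y by (intro powr_mono) auto
    have "norm (zeta_term k y) \<le> norm (y - 1) * norm y * real (Suc k) powr (- Re y - 1)"
      using y by (intro norm_zeta_term_le) auto
    also have "\<dots> \<le> h k" unfolding h_def using a b c by (intro mult_mono) auto
    finally show ?thesis .
  qed
  ultimately show "\<exists>d h. 0 < d \<and> summable h \<and>
      (\<forall>\<^sub>F k in sequentially. \<forall>y\<in>ball x d \<inter> {s. Re s > 1/2}. norm (zeta_term k y) \<le> h k)"
    by (intro exI[of _ 1] exI[of _ h]) auto
qed

lemma zeta_term_sums: "Re s > 1/2 \<Longrightarrow> (\<lambda>k. zeta_term k s) sums (zeta1 s - 1)"
  using zeta_term_series_deriv by (auto simp: zeta1_def sums_iff)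

lemma holomorphic_zeta1: "zeta1 holomorphic_on {s. Re s > 1/2}"
proof -
  obtain g g' where g: "\<And>s. Re s > 1/2 \<Longrightarrow> (\<lambda>k. zeta_term k s) sums g s \<and> (g has_field_derivative g' s) (at s)"
    using zeta_term_series_deriv by auto
  have "(\<lambda>s. 1 + g s) holomorphic_on {s. Re s > 1/2}"
  proof (intro holomorphic_on_add holomorphic_on_const, rule holomorphic_onI)
    fix s assume "s \<in> {s. Re s > 1/2}"
    then have "(g has_field_derivative g' s) (at s)" using g by simp
    then show "g field_differentiable at s within {s. Re s > 1/2}"
      unfolding field_differentiable_def by (intro exI) (rule has_field_derivative_at_within)
  qed
  then show ?thesis
    by (rule holomorphic_transform) (use g in \<open>auto simp: zeta1_def sums_iff\<close>)
qed

lemma zeta1_1: "zeta1 1 = 1"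
  by (simp add: zeta1_def zeta_term_def del: of_nat_Suc)

section \<open>Dirichlet series on \<open>Re s > 1\<close> and the logarithmic derivative of
  \<open>\<zeta>\<close>\<close>

definition dirichlet :: "(nat \<Rightarrow> real) \<Rightarrow> complex \<Rightarrow> complex" where
  "dirichlet a s = (\<Sum>n. of_real (a n) * of_nat n powr (-s))"

text \<open>Absolute convergence throughout \<open>Re s > 1\<close>. Since
  \<open>0 powr s = 0\<close>, the index \<open>0\<close> contributes nothing, and the sums may run
  over all of \<open>nat\<close>.\<close>

definition zeta_summable :: "(nat \<Rightarrow> real) \<Rightarrow> bool" where
  "zeta_summable a \<longleftrightarrow> (\<forall>\<sigma>>1. summable (\<lambda>n. \<bar>a n\<bar> * real n powr (-\<sigma>)))"

lemma norm_dirichlet_term: "norm (of_real (a n) * of_nat n powr (-s) :: complex) = \<bar>a n\<bar> * real n powr (- Re s)"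
  by (simp add: norm_mult norm_of_nat_powr)

lemma dirichlet_series_deriv:
  assumes "zeta_summable a"
  shows "\<exists>g g'. \<forall>s \<in> {s. Re s > 1}. ((\<lambda>n. of_real (a n) * of_nat n powr (-s)) sums g s) \<and> 
          ((\<lambda>n. - of_real (a n * ln n) * of_nat n powr (-s)) sums g' s) \<and> (g has_field_derivative g' s) (at s)"
proof (rule series_and_derivative_comparison_local[OF open_Re_gt])
  fix n and s :: complex assume "s \<in> {s. Re s > 1}"
  show "((\<lambda>s. of_real (a n) * of_nat n powr (-s)) has_field_derivative - of_real (a n * ln n) * of_nat n powr (-s)) (at s)"
  proof (cases "n = 0")
    case False
    then show ?thesis
      using DERIV_cmult[OF has_field_derivative_of_nat_powr[of n 0 s], of "of_real (a n)"]
      by (simp add: mult_ac)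
  qed auto
next
  fix x :: complex assume x: "x \<in> {s. Re s > 1}"
  \<comment> \<open>Halfway between \<open>1\<close> and \<open>Re x\<close>: on the ball of radius
    \<open>Re x - \<sigma>\<close> about \<open>x\<close> all real parts are at least
    \<open>\<sigma> > 1\<close>, so the series at \<open>\<sigma>\<close> dominates.\<close>
  define \<sigma> where "\<sigma> = (1 + Re x) / 2"
  have \<sigma>: "\<sigma> > 1" "Re x - \<sigma> > 0" using x by (auto simp: \<sigma>_def field_simps)
  have "norm (of_real (a n) * of_nat n powr (-y) :: complex) \<le> \<bar>a n\<bar> * real n powr (-\<sigma>)"
    if y: "y \<in> ball x (Re x - \<sigma>) \<inter> {s. Re s > 1}" for y n
  proof -
    have "norm (x - y) < Re x - \<sigma>" using y by (simp add: dist_norm)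
    then have "Re (x - y) < Re x - \<sigma>" using complex_Re_le_cmod[of "x - y"] by linarith
    then have "Re y \<ge> \<sigma>" by simp
    then have "real n powr (- Re y) \<le> real n powr (-\<sigma>)"
      by (cases "n = 0") (auto intro!: powr_mono)
    then show ?thesis unfolding norm_dirichlet_term by (intro mult_left_mono) auto
  qed
  moreover have "summable (\<lambda>n. \<bar>a n\<bar> * real n powr (-\<sigma>))"
    using assms \<sigma> by (auto simp: zeta_summable_def)
  ultimately show "\<exists>d h. 0 < d \<and> summable h \<and>
      (\<forall>\<^sub>F n in sequentially. \<forall>y\<in>ball x d \<inter> {s. Re s > 1}. norm (of_real (a n) * of_nat n powr (-y) :: complex) \<le> h n)"
    using \<sigma>(2) by (intro exI[of _ "Re x - \<sigma>"] exI[of _ "\<lambda>n. \<bar>a n\<bar> * real n powr (-\<sigma>)"]) auto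
qed

lemma dirichlet_sums:
  assumes "zeta_summable a" "Re s > 1"
  shows "(\<lambda>n. of_real (a n) * of_nat n powr (-s)) sums dirichlet a s"
  using dirichlet_series_deriv[OF assms(1)] assms(2) by (auto simp: dirichlet_def sums_iff)

lemma dirichlet_deriv:
  assumes "zeta_summable a" "Re s > 1"
  shows "(\<lambda>n. of_real (a n * ln n) * of_nat n powr (-s)) sums (- deriv (dirichlet a) s)"
    "dirichlet a field_differentiable (at s)"
proof -
  obtain g g' where g: "\<And>s. Re s > 1 \<Longrightarrow> (\<lambda>n. of_real (a n) * of_nat n powr (-s)) sums g s"
    "\<And>s. Re s > 1 \<Longrightarrow> (\<lambda>n. - of_real (a n * ln n) * of_nat n powr (-s)) sums g' s"
    "\<And>s. Re s > 1 \<Longrightarrow> (g has_field_derivative g' s) (at s)"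
    using dirichlet_series_deriv[OF assms(1)] by auto
  have D: "(dirichlet a has_field_derivative g' s) (at s)"
    by (rule has_field_derivative_transform_within_open[OF g(3)[OF assms(2)] open_Re_gt[of 1]])
       (use assms g(1) in \<open>auto simp: dirichlet_def sums_iff\<close>)
  then show "dirichlet a field_differentiable (at s)"
    unfolding field_differentiable_def by (rule exI)
  show "(\<lambda>n. of_real (a n * ln n) * of_nat n powr (-s)) sums (- deriv (dirichlet a) s)"
    unfolding DERIV_imp_deriv[OF D] by (rule sums_minus[OF g(2)[OF assms(2)], unfolded mult_minus_left minus_minus])
qed

lemma zeta_summable_one: "zeta_summable (\<lambda>_. 1)"
  by (simp add: zeta_summable_def summable_real_powr_iff)

lemma zeta_summable_mangoldt: "zeta_summable mangoldt"
  unfolding zeta_summable_def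
proof safe
  fix \<sigma> :: real assume \<sigma>: "\<sigma> > 1"
  \<comment> \<open>Half of the excess of \<open>\<sigma>\<close> over \<open>1\<close> pays for the
    logarithm through \<open>ln n \<le> n powr \<delta> / \<delta>\<close>; the other half keeps the
    series convergent.\<close>
  define \<delta> where "\<delta> = (\<sigma> - 1) / 2"
  have \<delta>: "\<delta> > 0" "\<sigma> - \<delta> > 1" using \<sigma> by (auto simp: \<delta>_def field_simps)
  have "summable (\<lambda>n. real n powr (-(\<sigma> - \<delta>)) / \<delta>)"
    using \<delta> by (intro summable_divide) (simp add: summable_real_powr_iff)
  then show "summable (\<lambda>n. \<bar>mangoldt n\<bar> * real n powr (-\<sigma>))"
  proof (rule summable_comparison_test')
    fix n :: nat assume "n \<ge> 0"
    show "norm (\<bar>mangoldt n\<bar> * real n powr (-\<sigma>)) \<le> real n powr (-(\<sigma> - \<delta>)) / \<delta>"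
    proof (cases "n = 0")
      case False
      have "mangoldt n \<le> ln (real n)" using False by (intro mangoldt_le) auto
      also have "\<dots> \<le> real n powr \<delta> / \<delta>" using False \<delta> by (intro ln_powr_bound) auto
      finally have "mangoldt n * real n powr (-\<sigma>) \<le> real n powr \<delta> / \<delta> * real n powr (-\<sigma>)"
        by (intro mult_right_mono) auto
      also have "\<dots> = real n powr (-(\<sigma> - \<delta>)) / \<delta>"
        by (simp flip: powr_add)
      finally show ?thesis by (simp add: mangoldt_nonneg abs_mult)
    qed auto
  qed
qed

text \<open>For \<open>Re s > 1\<close> the powers with exponent \<open>1 - s\<close> tend to
  \<open>0\<close> and telescope to \<open>-1\<close>, which cancels the leading \<open>1\<close> of
  \<open>zeta1\<close>.\<close>

lemma zeta1_eq:
  assumes "Re s > 1"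
  shows "zeta1 s = (s - 1) * dirichlet (\<lambda>_. 1) s"
proof -
  define p where "p = (\<lambda>n. of_nat n powr (1 - s))"
  have S: "(\<lambda>n. of_nat n powr (-s)) sums dirichlet (\<lambda>_. 1) s"
    using dirichlet_sums[OF zeta_summable_one assms] by simp
  then have "(\<lambda>n. of_nat (Suc n) powr (-s)) sums dirichlet (\<lambda>_. 1) s"
    by (subst sums_Suc_iff) simp
  then have 1: "(\<lambda>k. (s - 1) * of_nat (Suc k) powr (-s)) sums ((s - 1) * dirichlet (\<lambda>_. 1) s)"
    by (rule sums_mult)
  have "(\<lambda>n. norm (p n)) \<longlonglongrightarrow> 0"
    unfolding p_def norm_of_nat_powr using assms
    by (intro tendsto_neg_powr filterlim_real_sequentially) auto
  then have "p \<longlonglongrightarrow> 0" by (rule tendsto_norm_zero_cancel)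
  then have "(\<lambda>n. p (Suc n)) \<longlonglongrightarrow> 0" by (rule LIMSEQ_Suc)
  then have "(\<lambda>k. p (Suc (Suc k)) - p (Suc k)) sums (0 - p (Suc 0))"
    by (rule telescope_sums)
  from sums_add[OF 1 this] have "(\<lambda>k. zeta_term k s) sums ((s - 1) * dirichlet (\<lambda>_. 1) s - 1)"
    by (simp add: zeta_term_def[abs_def] p_def algebra_simps del: of_nat_Suc) (simp add: algebra_simps)
  moreover have "(\<lambda>k. zeta_term k s) sums (zeta1 s - 1)"
    using assms by (intro zeta_term_sums) auto
  ultimately show ?thesis using sums_unique2 by fastforce
qed

lemma has_sum_dirichlet:
  assumes "zeta_summable a" "Re s > 1"
  shows "((\<lambda>n. of_real (a n) * of_nat n powr (-s)) has_sum dirichlet a s) {0<..}"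
    "(\<lambda>n. norm (of_real (a n) * of_nat n powr (-s))) summable_on {0<..}"
proof -
  have 1: "summable (\<lambda>n. norm (of_real (a n) * of_nat n powr (-s)))"
    using assms unfolding norm_dirichlet_term zeta_summable_def by blast
  have "((\<lambda>n. of_real (a n) * of_nat n powr (-s)) has_sum dirichlet a s) UNIV"
    by (rule norm_summable_imp_has_sum[OF 1 dirichlet_sums[OF assms]])
  then show "((\<lambda>n. of_real (a n) * of_nat n powr (-s)) has_sum dirichlet a s) {0<..}"
    by (rule has_sum_cong_neutral[THEN iffD1, rotated -1]) auto
  have "(\<lambda>n. norm (of_real (a n) * of_nat n powr (-s))) summable_on UNIV"
    using 1 by (intro norm_summable_imp_summable_on) simp
  then show "(\<lambda>n. norm (of_real (a n) * of_nat n powr (-s))) summable_on {0<..}"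
    by (rule summable_on_subset_banach) auto
qed

text \<open>Absolute convergence permits regrouping the double sum over \<open>(d, m)\<close> by the
  product \<open>n = d m\<close>, and the sum of \<open>mangoldt\<close> over the divisors of
  \<open>n\<close> is \<open>ln n\<close>.\<close>

lemma dirichlet_mangoldt_mult:
  assumes "Re s > 1"
  shows "dirichlet mangoldt s * dirichlet (\<lambda>_. 1) s = - deriv (dirichlet (\<lambda>_. 1)) s"
proof -
  define f where "f = (\<lambda>(d,m). (of_real (mangoldt d) * of_nat d powr (-s)) * of_nat m powr (-s))"
  let ?P = "{0<..} :: nat set"
  let ?Z = "dirichlet (\<lambda>_. 1) s" and ?L = "dirichlet mangoldt s"
  note Z = has_sum_dirichlet[OF zeta_summable_one assms, simplified of_real_1 mult_1]
  note L = has_sum_dirichlet[OF zeta_summable_mangoldt assms]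
  have 1: "((\<lambda>m. f (d, m)) has_sum (of_real (mangoldt d) * of_nat d powr (-s)) * ?Z) ?P" for d
    unfolding f_def prod.case by (intro has_sum_cmult_right Z(1))
  have 2: "((\<lambda>d. of_real (mangoldt d) * of_nat d powr (-s) * ?Z) has_sum ?L * ?Z) ?P"
    by (intro has_sum_cmult_left L(1))
  have "(\<lambda>x. norm (f x)) summable_on Sigma ?P (\<lambda>_. ?P)"
    unfolding Infinite_Sum.abs_summable_on_Sigma_iff
  proof (intro conjI ballI)
    fix d :: nat assume "d \<in> ?P"
    show "(\<lambda>m. norm (f (d, m))) summable_on ?P"
      unfolding f_def prod.case norm_mult by (intro summable_on_cmult_right Z(2))
  next
    have "(\<lambda>d. norm (of_real (mangoldt d) * of_nat d powr (-s)) * infsum (\<lambda>m. norm (of_nat m powr (-s))) ?P) summable_on ?P"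
      by (intro summable_on_cmult_left L(2))
    then show "(\<lambda>d. norm (infsum (\<lambda>m. norm (f (d, m))) ?P)) summable_on ?P"
      by (simp add: f_def norm_mult infsum_cmult_right' infsum_nonneg abs_mult)
  qed
  then have "f summable_on Sigma ?P (\<lambda>_. ?P)" by (rule abs_summable_summable)
  from has_sum_SigmaI[OF 1 2 this] have S: "(f has_sum ?L * ?Z) (?P \<times> ?P)" .
  have "((\<lambda>(n,d). f (d, n div d)) has_sum ?L * ?Z) (Sigma ?P (\<lambda>n. {d. d dvd n}))
      \<longleftrightarrow> (f has_sum ?L * ?Z) (?P \<times> ?P)"
    by (rule has_sum_reindex_bij_witness[of _ "\<lambda>(d,m). (d * m, d)" "\<lambda>(n,d). (d, n div d)"])
       (auto elim!: dvdE)
  with S have "((\<lambda>(n,d). f (d, n div d)) has_sum ?L * ?Z) (Sigma ?P (\<lambda>n. {d. d dvd n}))" by simp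
  moreover have "((\<lambda>d. (case (n, d) of (n, d) \<Rightarrow> f (d, n div d))) has_sum of_real (ln n) * of_nat n powr (-s)) {d. d dvd n}"
    if n: "n \<in> ?P" for n
  proof -
    have "f (d, n div d) = of_real (mangoldt d) * of_nat n powr (-s)" if d: "d \<in> {d. d dvd n}" for d
    proof -
      have "of_nat n powr (-s) = (of_real (real d) * of_real (real (n div d)) :: complex) powr (-s)"
        using d by (simp flip: of_nat_mult)
      also have "\<dots> = of_nat d powr (-s) * of_nat (n div d) powr (-s)"
        by (subst powr_times_real) auto
      finally show ?thesis by (simp add: f_def)
    qed
    then have "sum (\<lambda>d. f (d, n div d)) {d. d dvd n} = (\<Sum>d | d dvd n. of_real (mangoldt d)) * of_nat n powr (-s)"
      by (simp add: sum_distrib_right)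
    also have "\<dots> = of_real (ln n) * of_nat n powr (-s)"
      using mangoldt_sum[of n, where ?'a = complex] n by simp
    finally have E: "sum (\<lambda>d. f (d, n div d)) {d. d dvd n} = of_real (ln n) * of_nat n powr (-s)" .
    have "finite {d. d dvd n}" using n by auto
    from has_sum_finite[OF this, of "\<lambda>d. f (d, n div d)"] show ?thesis unfolding E by simp
  qed
  ultimately have "((\<lambda>n. of_real (ln n) * of_nat n powr (-s)) has_sum ?L * ?Z) ?P"
    by (rule has_sum_SigmaD)
  then have "((\<lambda>n. of_real (ln n) * of_nat n powr (-s)) has_sum ?L * ?Z) UNIV"
    by (rule has_sum_cong_neutral[THEN iffD1, rotated -1]) auto
  then have "(\<lambda>n. of_real (ln n) * of_nat n powr (-s)) sums (?L * ?Z)" by (rule has_sum_imp_sums)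
  moreover have "(\<lambda>n. of_real (ln n) * of_nat n powr (-s)) sums (- deriv (dirichlet (\<lambda>_. 1)) s)"
    using dirichlet_deriv(1)[OF zeta_summable_one assms] by simp
  ultimately show ?thesis by (rule sums_unique2)
qed

text \<open>The logarithmic derivative with denominators cleared, because the nonvanishing of
  \<open>zeta1\<close> for \<open>Re s > 1\<close> is itself deduced from this identity.\<close>

lemma deriv_zeta1:
  assumes "Re s > 1"
  shows "(s - 1) * deriv zeta1 s = zeta1 s - (s - 1) * dirichlet mangoldt s * zeta1 s"
proof -
  let ?Z = "dirichlet (\<lambda>_. 1)"
  have "(?Z has_field_derivative deriv ?Z s) (at s)"
    by (rule field_differentiable_derivI[OF dirichlet_deriv(2)[OF zeta_summable_one assms]])
  then have "((\<lambda>s. (s - 1) * ?Z s) has_field_derivative (?Z s + (s - 1) * deriv ?Z s)) (at s)"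
    by (auto intro!: derivative_eq_intros)
  then have "(zeta1 has_field_derivative (?Z s + (s - 1) * deriv ?Z s)) (at s)"
    by (rule has_field_derivative_transform_within_open[OF _ open_Re_gt[of 1]])
       (use assms zeta1_eq in auto)
  then have "deriv zeta1 s = ?Z s + (s - 1) * deriv ?Z s" by (rule DERIV_imp_deriv)
  also have "deriv ?Z s = - dirichlet mangoldt s * ?Z s"
    using dirichlet_mangoldt_mult[OF assms] by (simp add: minus_equation_iff)
  finally have "deriv zeta1 s = ?Z s + (s - 1) * (- dirichlet mangoldt s * ?Z s)" .
  from this show ?thesis by (simp only: zeta1_eq[OF assms]) (simp add: ring_distribs mult_ac)
qed

section \<open>Orders of zeros and nonvanishing on \<open>Re s \<ge> 1\<close>\<close>

lemma mult_logderiv_limit: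
  assumes f: "f holomorphic_on S" and S: "open S" "connected S" "\<xi> \<in> S" and nz: "w \<in> S" "f w \<noteq> 0"
  shows "\<exists>n::nat. ((\<lambda>z. (z - \<xi>) * deriv f z / f z) \<longlongrightarrow> of_nat n) (at \<xi>) \<and> (f \<xi> = 0 \<longleftrightarrow> n \<ge> 1)"
proof (cases "f \<xi> = 0")
  case False
  have "f holomorphic_on S" "deriv f holomorphic_on S" using f S by (auto intro: holomorphic_deriv)
  then have c: "isCont f \<xi>" "isCont (deriv f) \<xi>"
    using S holomorphic_on_imp_continuous_on continuous_on_eq_continuous_at by blast+
  have "((\<lambda>z. (z - \<xi>) * deriv f z / f z) \<longlongrightarrow> (\<xi> - \<xi>) * deriv f \<xi> / f \<xi>) (at \<xi>)"
    using c False by (intro tendsto_intros) (auto simp: isCont_def)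
  then show ?thesis using False by (intro exI[of _ 0]) auto
next
  case True
  have "\<not> f constant_on S" using True nz S(3) unfolding constant_on_def by metis
  \<comment> \<open>With \<open>f z = (z - \<xi>)^n g z\<close> and \<open>g\<close> free of zeros,
    the quotient is \<open>n + (z - \<xi>) g' / g\<close>, which tends to \<open>n\<close>.\<close>
  from holomorphic_factor_zero_nonconstant[OF f S(1,2,3) True this]
  obtain g r n where n: "0 < n" "0 < r" "ball \<xi> r \<subseteq> S" "g holomorphic_on ball \<xi> r"
    "\<And>w. w \<in> ball \<xi> r \<Longrightarrow> f w = (w - \<xi>)^n * g w" "\<And>w. w \<in> ball \<xi> r \<Longrightarrow> g w \<noteq> 0" by metis
  have "deriv g holomorphic_on ball \<xi> r" using n(4) by (auto intro: holomorphic_deriv)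
  then have c: "isCont g \<xi>" "isCont (deriv g) \<xi>"
    using n(2,4) holomorphic_on_imp_continuous_on continuous_on_eq_continuous_at[OF open_ball] centre_in_ball by blast+
  have "((\<lambda>z. of_nat n + (z - \<xi>) * deriv g z / g z) \<longlongrightarrow> of_nat n + (\<xi> - \<xi>) * deriv g \<xi> / g \<xi>) (at \<xi>)"
    using c n by (intro tendsto_intros) (auto simp: isCont_def)
  then have "((\<lambda>z. of_nat n + (z - \<xi>) * deriv g z / g z) \<longlongrightarrow> of_nat n) (at \<xi>)" by simp
  moreover have "eventually (\<lambda>z. of_nat n + (z - \<xi>) * deriv g z / g z = (z - \<xi>) * deriv f z / f z) (at \<xi>)"
    unfolding eventually_at
  proof (intro exI[of _ r] conjI ballI impI)
    fix z assume z: "z \<noteq> \<xi> \<and> dist z \<xi> < r"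
    then have zb: "z \<in> ball \<xi> r" by (simp add: dist_commute)
    have "g field_differentiable at z"
      using n(4) zb holomorphic_on_imp_differentiable_at open_ball by blast
    then have "((\<lambda>w. (w - \<xi>)^n * g w) has_field_derivative
         (of_nat n * (z - \<xi>) ^ (n - 1) * g z + (z - \<xi>)^n * deriv g z)) (at z)"
      by (auto intro!: derivative_eq_intros field_differentiable_derivI)
    then have "(f has_field_derivative (of_nat n * (z - \<xi>) ^ (n - 1) * g z + (z - \<xi>)^n * deriv g z)) (at z)"
      by (rule has_field_derivative_transform_within_open[OF _ open_ball zb]) (use n(5) in auto)
    then have D: "deriv f z = of_nat n * (z - \<xi>) ^ (n - 1) * g z + (z - \<xi>)^n * deriv g z"
      by (rule DERIV_imp_deriv)
    define u where "u = z - \<xi>"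
    have "u ^ n = u * u ^ (n - 1)" using n(1) by (cases n) auto
    moreover have "u \<noteq> 0" using z by (auto simp: u_def)
    ultimately show "of_nat n + (z - \<xi>) * deriv g z / g z = (z - \<xi>) * deriv f z / f z"
      using n(5,6)[OF zb] unfolding D u_def[symmetric] by (simp add: field_simps)
  qed (use n in auto)
  ultimately have "((\<lambda>z. (z - \<xi>) * deriv f z / f z) \<longlongrightarrow> of_nat n) (at \<xi>)"
    using tendsto_cong by fast
  then show ?thesis using n(1) True by (intro exI[of _ n]) auto
qed

lemma zeta1_logderiv_limit:
  assumes "Re \<xi> > 1/2"
  shows "\<exists>n::nat. ((\<lambda>z. (z - \<xi>) * deriv zeta1 z / zeta1 z) \<longlongrightarrow> of_nat n) (at \<xi>) \<and> (zeta1 \<xi> = 0 \<longleftrightarrow> n \<ge> 1)"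
proof (rule mult_logderiv_limit[OF holomorphic_zeta1 open_Re_gt])
  show "connected {s. Re s > 1/2}" by (intro convex_connected convex_halfspace_Re_gt)
  show "zeta1 1 \<noteq> 0" by (simp add: zeta1_1)
qed (use assms in auto)

lemma isCont_dirichlet:
  assumes "zeta_summable a" "Re s > 1"
  shows "isCont (dirichlet a) s"
  using dirichlet_deriv(2)[OF assms] by (rule field_differentiable_imp_continuous_at)

text \<open>At a zero the logarithmic derivative would have a pole with residue at least
  \<open>1\<close>. But wherever \<open>zeta1\<close> does not vanish it equals
  \<open>1 / (z - 1) - dirichlet mangoldt z\<close>, which is continuous for
  \<open>Re z > 1\<close>, so the residue is \<open>0\<close>.\<close>

lemma zeta1_nonzero_gt_1:
  assumes "Re s > 1"
  shows "zeta1 s \<noteq> 0"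
proof
  assume "zeta1 s = 0"
  moreover have "Re s > 1/2" using assms by simp
  ultimately obtain n :: nat where n: "((\<lambda>z. (z - s) * deriv zeta1 z / zeta1 z) \<longlongrightarrow> of_nat n) (at s)" "n \<ge> 1"
    using zeta1_logderiv_limit[of s] by blast
  define q where "q = (\<lambda>z. 1 / (z - 1) - dirichlet mangoldt z)"
  have s1: "s \<noteq> 1" using assms by auto
  have "((\<lambda>z. norm ((z - s) * q z)) \<longlongrightarrow> norm ((s - s) * q s)) (at s)"
    unfolding q_def using isCont_dirichlet[OF zeta_summable_mangoldt assms] s1
    by (intro tendsto_intros) (auto simp: isCont_def)
  then have q: "((\<lambda>z. norm ((z - s) * q z)) \<longlongrightarrow> 0) (at s)" by simp
  have "((\<lambda>z. (z - s) * deriv zeta1 z / zeta1 z) \<longlongrightarrow> 0) (at s)"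
  proof (rule Lim_null_comparison[OF _ q])
    have "eventually (\<lambda>z. Re z > 1) (at s)"
      using eventually_at_in_open'[OF open_Re_gt[of 1], of s] assms by simp
    then show "eventually (\<lambda>z. norm ((z - s) * deriv zeta1 z / zeta1 z) \<le> norm ((z - s) * q z)) (at s)"
    proof eventually_elim
      case (elim z)
      show ?case
      \<comment> \<open>Where \<open>zeta1 z = 0\<close>, the quotient is \<open>0\<close> by the
        convention on division and the estimate is trivial.\<close>
      proof (cases "zeta1 z = 0")
        case False
        have "z \<noteq> 1" using elim by auto
        have "(z - 1) * q z = 1 - (z - 1) * dirichlet mangoldt z"
          using \<open>z \<noteq> 1\<close> by (simp add: q_def right_diff_distrib)
        then have "(z - 1) * (q z * zeta1 z) = (1 - (z - 1) * dirichlet mangoldt z) * zeta1 z"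
          by (simp only: mult.assoc[symmetric])
        then have "(z - 1) * deriv zeta1 z = (z - 1) * (q z * zeta1 z)"
          using deriv_zeta1[OF elim] by (simp only: left_diff_distrib mult_1)
        then have "deriv zeta1 z = q z * zeta1 z" using \<open>z \<noteq> 1\<close> by simp
        then show ?thesis using False by simp
      qed auto
    qed
  qed
  with n(1) have "of_nat n = (0::complex)" by (rule tendsto_unique[OF at_neq_bot])
  then show False using n(2) by simp
qed

lemma dirichlet_mangoldt_eq:
  assumes "Re s > 1"
  shows "dirichlet mangoldt s = 1 / (s - 1) - deriv zeta1 s / zeta1 s"
proof -
  have *: "L = 1 / u - d / z" if "u * d = z - u * L * z" "z \<noteq> 0" "u \<noteq> 0" for u d z L :: complex
    using that by (simp add: divide_simps mult_ac)
  show ?thesis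
    by (rule *[OF deriv_zeta1[OF assms] zeta1_nonzero_gt_1[OF assms]]) (use assms in auto)
qed

lemma Re_of_nat_powr:
  "Re (of_nat n powr - Complex \<sigma> t) = real n powr (-\<sigma>) * cos (t * ln n)"
proof (cases "n = 0")
  case False
  then show ?thesis by (simp add: powr_def Re_exp mult.commute)
qed auto

text \<open>Termwise this is
  \<open>3 + 4 cos \<theta> + cos 2\<theta> = 2 (1 + cos \<theta>)^2\<close> with
  \<open>\<theta> = t ln n\<close>, and the coefficients are nonnegative.\<close>

lemma mangoldt_341:
  assumes "\<sigma> > 1"
  shows "Re (3 * dirichlet mangoldt (Complex \<sigma> 0) + 4 * dirichlet mangoldt (Complex \<sigma> t)
     + dirichlet mangoldt (Complex \<sigma> (2 * t))) \<ge> 0"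
proof -
  have S: "(\<lambda>n. mangoldt n * (real n powr (-\<sigma>) * cos (u * ln n))) sums Re (dirichlet mangoldt (Complex \<sigma> u))" for u
    using sums_Re[OF dirichlet_sums[OF zeta_summable_mangoldt, of "Complex \<sigma> u"]] assms
    by (simp only: scaleR_conv_of_real[symmetric] scaleR_complex.sel Re_of_nat_powr complex.sel) 
  have A: "(\<lambda>n. 3 * (mangoldt n * (real n powr (-\<sigma>) * cos (0 * ln n))) + 4 * (mangoldt n * (real n powr (-\<sigma>) * cos (t * ln n)))
      + mangoldt n * (real n powr (-\<sigma>) * cos ((2 * t) * ln n))) sums
     (3 * Re (dirichlet mangoldt (Complex \<sigma> 0)) + 4 * Re (dirichlet mangoldt (Complex \<sigma> t))
     + Re (dirichlet mangoldt (Complex \<sigma> (2 * t))))"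
    by (intro sums_add sums_mult S)
  have B: "3 * (mangoldt n * (real n powr (-\<sigma>) * cos (0 * ln n))) + 4 * (mangoldt n * (real n powr (-\<sigma>) * cos (t * ln n)))
      + mangoldt n * (real n powr (-\<sigma>) * cos ((2 * t) * ln n)) \<ge> 0" for n
  proof -
    define c where "c = cos (t * ln (real n))"
    have E: "cos ((2 * t) * ln n) = 2 * c\<^sup>2 - 1" using cos_double_cos[of "t * ln n"] by (simp add: c_def mult_ac)
    have "3 * (mangoldt n * (real n powr (-\<sigma>) * cos (0 * ln n))) + 4 * (mangoldt n * (real n powr (-\<sigma>) * cos (t * ln n)))
      + mangoldt n * (real n powr (-\<sigma>) * cos ((2 * t) * ln n)) = mangoldt n * real n powr (-\<sigma>) * (2 * (1 + c)\<^sup>2)"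
      unfolding E c_def[symmetric] by (simp add: algebra_simps power2_eq_square)
    also have "\<dots> \<ge> 0" by (intro mult_nonneg_nonneg mangoldt_nonneg) auto
    finally show ?thesis .
  qed
  have "0 \<le> 3 * Re (dirichlet mangoldt (Complex \<sigma> 0)) + 4 * Re (dirichlet mangoldt (Complex \<sigma> t))
     + Re (dirichlet mangoldt (Complex \<sigma> (2 * t)))"
    by (rule sums_le[OF B sums_zero A])
  then show ?thesis by simp
qed

text \<open>As \<open>d\<close> decreases to \<open>0\<close>, \<open>d\<close> times the
  \<open>\<Lambda>\<close>-series at \<open>1 + d + i u\<close> tends to minus the order
  \<open>N u\<close> of the zero of \<open>zeta1\<close>, plus \<open>1\<close> for the pole if
  \<open>u = 0\<close>. The preceding inequality gives
  \<open>3 N(0) + 4 N(t) + N(2t) \<le> 3\<close>, which excludes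
  \<open>N(t) \<ge> 1\<close>.\<close>

lemma zeta1_nonzero_line:
  shows "zeta1 (Complex 1 t) \<noteq> 0"
proof (cases "t = 0")
  case True
  then have "Complex 1 t = 1" by (simp add: complex_eq_iff)
  then show ?thesis by (simp add: zeta1_1)
next
  case t: False
  show ?thesis
  proof
    assume Z: "zeta1 (Complex 1 t) = 0"
    have "\<exists>n::nat. ((\<lambda>z. (z - Complex 1 u) * deriv zeta1 z / zeta1 z) \<longlongrightarrow> of_nat n) (at (Complex 1 u)) \<and> (zeta1 (Complex 1 u) = 0 \<longleftrightarrow> n \<ge> 1)" for u
      by (rule zeta1_logderiv_limit) auto
    then obtain N :: "real \<Rightarrow> nat" where N: "\<And>u. ((\<lambda>z. (z - Complex 1 u) * deriv zeta1 z / zeta1 z) \<longlongrightarrow> of_nat (N u)) (at (Complex 1 u))"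
       "\<And>u. zeta1 (Complex 1 u) = 0 \<longleftrightarrow> N u \<ge> 1" by metis
    have lim: "((\<lambda>d. of_real d * dirichlet mangoldt (Complex (1 + d) u)) \<longlongrightarrow> (if u = 0 then 1 else 0) - of_nat (N u)) (at_right 0)" for u
    proof -
      have "filterlim (\<lambda>d. Complex (1 + d) u) (at (Complex 1 u)) (at_right 0)"
        unfolding filterlim_at
      proof
        show "\<forall>\<^sub>F x in at_right 0. Complex (1 + x) u \<in> UNIV \<and> Complex (1 + x) u \<noteq> Complex 1 u"
          by (simp add: eventually_at_filter)
        have "((\<lambda>d. Complex (1 + d) u) \<longlongrightarrow> Complex (1 + 0) u) (at_right 0)"
          by (intro tendsto_intros)
        then show "((\<lambda>d. Complex (1 + d) u) \<longlongrightarrow> Complex 1 u) (at_right 0)" by simp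
      qed
      from filterlim_compose[OF N(1) this]
      have 1: "((\<lambda>d. (Complex (1 + d) u - Complex 1 u) * deriv zeta1 (Complex (1 + d) u) / zeta1 (Complex (1 + d) u)) \<longlongrightarrow> of_nat (N u)) (at_right 0)" .
      have 2: "((\<lambda>d. of_real d / Complex d u) \<longlongrightarrow> (if u = 0 then 1 else 0)) (at_right 0)"
      proof (cases "u = 0")
        case True
        have "((\<lambda>d. of_real d / Complex d u) \<longlongrightarrow> 1) (at_right 0)"
          by (rule tendsto_eventually) (auto simp: eventually_at_filter True complex_of_real_def[symmetric])
        then show ?thesis using True by simp
      next
        case False
        have "((\<lambda>d. of_real d / Complex d u) \<longlongrightarrow> of_real 0 / Complex 0 u) (at_right 0)"
          by (intro tendsto_intros) (use False in \<open>auto simp: complex_eq_iff\<close>)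
        then show ?thesis using False by simp
      qed
      from tendsto_diff[OF 2 1] show ?thesis
      proof (rule Lim_transform_eventually)
        show "\<forall>\<^sub>F d in at_right 0. of_real d / Complex d u - (Complex (1 + d) u - Complex 1 u) * deriv zeta1 (Complex (1 + d) u) / zeta1 (Complex (1 + d) u)
           = of_real d * dirichlet mangoldt (Complex (1 + d) u)"
          unfolding eventually_at_filter
        proof (intro always_eventually allI impI)
          fix d :: real assume "d \<in> {0<..}"
          then have "Re (Complex (1 + d) u) > 1" by simp
          moreover have "Complex (1 + d) u - 1 = Complex d u" "Complex (1 + d) u - Complex 1 u = of_real d"
            by (simp_all add: complex_eq_iff)
          ultimately show "of_real d / Complex d u - (Complex (1 + d) u - Complex 1 u) * deriv zeta1 (Complex (1 + d) u) / zeta1 (Complex (1 + d) u)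
           = of_real d * dirichlet mangoldt (Complex (1 + d) u)"
            by (simp add: dirichlet_mangoldt_eq right_diff_distrib)
        qed
      qed
    qed
    have "((\<lambda>d. Re (3 * (of_real d * dirichlet mangoldt (Complex (1 + d) 0)) + 4 * (of_real d * dirichlet mangoldt (Complex (1 + d) t))
       + of_real d * dirichlet mangoldt (Complex (1 + d) (2 * t)))) \<longlongrightarrow>
       Re (3 * ((if (0::real) = 0 then 1 else 0) - of_nat (N 0)) + 4 * ((if t = 0 then 1 else 0) - of_nat (N t)) + ((if 2 * t = 0 then 1 else 0) - of_nat (N (2 * t))))) (at_right 0)"
      by (intro tendsto_intros lim)
    moreover have "\<forall>\<^sub>F d in at_right 0. 0 \<le> Re (3 * (of_real d * dirichlet mangoldt (Complex (1 + d) 0)) + 4 * (of_real d * dirichlet mangoldt (Complex (1 + d) t))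
       + of_real d * dirichlet mangoldt (Complex (1 + d) (2 * t)))"
      unfolding eventually_at_filter
    proof (intro always_eventually allI impI)
      fix d :: real assume d: "d \<in> {0<..}"
      have "0 \<le> d * Re (3 * dirichlet mangoldt (Complex (1 + d) 0) + 4 * dirichlet mangoldt (Complex (1 + d) t)
         + dirichlet mangoldt (Complex (1 + d) (2 * t)))"
        using d by (intro mult_nonneg_nonneg mangoldt_341) auto
      then show "0 \<le> Re (3 * (of_real d * dirichlet mangoldt (Complex (1 + d) 0)) + 4 * (of_real d * dirichlet mangoldt (Complex (1 + d) t))
       + of_real d * dirichlet mangoldt (Complex (1 + d) (2 * t)))"
        by (simp add: algebra_simps)
    qed
    ultimately have "0 \<le> Re (3 * ((if (0::real) = 0 then 1 else 0) - of_nat (N 0)) + 4 * ((if t = 0 then 1 else 0) - of_nat (N t)) + ((if 2 * t = 0 then 1 else 0) - of_nat (N (2 * t))))"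
      by (intro tendsto_lowerbound[of _ _ "at_right (0::real)"]) auto
    then have "0 \<le> 3 - 3 * real (N 0) - 4 * real (N t) - real (N (2 * t))" using t by simp
    moreover have "N t \<ge> 1" using N(2) Z by blast
    ultimately show False by linarith
  qed
qed

lemma zeta1_nonzero: "Re s \<ge> 1 \<Longrightarrow> zeta1 s \<noteq> 0"
proof (cases "Re s = 1")
  case True
  then have "s = Complex 1 (Im s)" by (simp add: complex_eq_iff)
  then show ?thesis using zeta1_nonzero_line[of "Im s"] by simp
qed (use zeta1_nonzero_gt_1 in auto)

text \<open>The pole of \<open>-\<zeta>'/\<zeta>\<close> at \<open>1\<close> is cancelled by that of \<open>\<zeta>\<close>.\<close>

lemma mangoldt_minus_one_extension:
  obtains H \<Omega> where "open \<Omega>" "{s. Re s \<ge> 1} \<subseteq> \<Omega>" "H holomorphic_on \<Omega>"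
    "\<And>s. Re s > 1 \<Longrightarrow> H s = dirichlet mangoldt s - dirichlet (\<lambda>_. 1) s"
proof -
  define \<Omega> where "\<Omega> = {s. Re s > 1/2} \<inter> zeta1 -` (-{0})"
  \<comment> \<open>Both Dirichlet series have the polar part \<open>1 / (s - 1)\<close>.
    \<open>Q\<close> is the rest of \<open>\<zeta>\<close>, namely
    \<open>(zeta1 s - 1) / (s - 1)\<close> with its removable singularity filled in; the rest of the
    \<open>\<Lambda>\<close>-series is \<open>- zeta1' / zeta1\<close>.\<close>
  define Q where "Q = (\<lambda>z. if z = 1 then deriv zeta1 1 else (zeta1 z - zeta1 1) / (z - 1))"
  have "open \<Omega>" unfolding \<Omega>_def
    by (rule continuous_open_preimage[OF holomorphic_on_imp_continuous_on[OF holomorphic_zeta1] open_Re_gt]) auto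
  moreover have "{s. Re s \<ge> 1} \<subseteq> \<Omega>" using zeta1_nonzero by (auto simp: \<Omega>_def)
  moreover have "(\<lambda>s. - (deriv zeta1 s / zeta1 s) - Q s) holomorphic_on \<Omega>"
  proof -
    have h: "zeta1 holomorphic_on \<Omega>" "deriv zeta1 holomorphic_on \<Omega>"
      using holomorphic_on_subset[OF holomorphic_zeta1] holomorphic_deriv[OF holomorphic_zeta1 open_Re_gt]
        holomorphic_on_subset by (auto simp: \<Omega>_def)
    have "Q holomorphic_on \<Omega>" unfolding Q_def by (rule pole_lemma_open[OF h(1) \<open>open \<Omega>\<close>])
    then show ?thesis using h
      by (intro holomorphic_on_diff holomorphic_on_minus holomorphic_on_divide) (auto simp: \<Omega>_def)
  qed
  moreover have "- (deriv zeta1 s / zeta1 s) - Q s = dirichlet mangoldt s - dirichlet (\<lambda>_. 1) s" if "Re s > 1" for s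
  proof -
    have "s \<noteq> 1" using that by auto
    then show ?thesis
      using that by (simp add: dirichlet_mangoldt_eq Q_def zeta1_eq zeta1_1 diff_divide_distrib)
  qed
  ultimately show thesis using that by blast
qed

section \<open>Primes in short intervals\<close>

definition fejer :: "real \<Rightarrow> real \<Rightarrow> real" where
  "fejer T u = (if u = 0 then T / 2 else (1 - cos (T * u)) / (T * u\<^sup>2))"

text \<open>The kernel is the cosine transform of a triangle on \<open>[0, T]\<close>. The bounded
  support confines the analysis to a compact segment of the line \<open>Re s = 1\<close>, while
  nonnegativity of the kernel allows parts of a sum to be dropped.\<close>

lemma fejer_has_integral:
  assumes "T > 0"
  shows "((\<lambda>t. (1 - t / T) * cos (t * u)) has_integral fejer T u) {0..T}"
proof (cases "u = 0")
  case True
  have "((\<lambda>t. 1 - t / T) has_integral ((T - T\<^sup>2 / (2 * T)) - (0 - 0\<^sup>2 / (2 * T)))) {0..T}"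
    by (rule fundamental_theorem_of_calculus)
       (use assms in \<open>auto intro!: derivative_eq_intros simp flip: has_real_derivative_iff_has_vector_derivative\<close>)
  then show ?thesis using True assms by (simp add: fejer_def power2_eq_square)
next
  case False
  define G where "G = (\<lambda>t. (1 - t / T) * sin (t * u) / u - cos (t * u) / (T * u\<^sup>2))"
  have "((\<lambda>t. (1 - t / T) * cos (t * u)) has_integral (G T - G 0)) {0..T}"
  proof (rule fundamental_theorem_of_calculus)
    fix t assume "t \<in> {0..T}"
    show "(G has_vector_derivative (1 - t / T) * cos (t * u)) (at t within {0..T})"
      unfolding has_real_derivative_iff_has_vector_derivative[symmetric] G_def
      by (rule derivative_eq_intros refl | use assms False in \<open>simp add: field_simps power2_eq_square\<close>)+
  qed (use assms in auto)
  moreover have "G T - G 0 = fejer T u"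
    using assms False by (simp add: G_def fejer_def diff_divide_distrib)
  ultimately show ?thesis by simp
qed

lemma one_minus_cos: "1 - cos x = 2 * (sin (x / 2))\<^sup>2" for x :: real
  using cos_double_sin[of "x / 2"] by simp

lemma fejer_nonneg: "T > 0 \<Longrightarrow> fejer T u \<ge> 0"
  by (simp add: fejer_def)

lemma fejer_le_tail: "T > 0 \<Longrightarrow> u \<noteq> 0 \<Longrightarrow> fejer T u \<le> 2 / (T * u\<^sup>2)"
  using cos_ge_minus_one[of "T * u"] by (simp add: fejer_def divide_right_mono)

lemma fejer_le: 
  assumes "T > 0"
  shows "fejer T u \<le> T / 2"
proof (cases "u = 0")
  case False
  have "(sin (T * u / 2))\<^sup>2 \<le> (T * u / 2)\<^sup>2"
    using abs_sin_x_le_abs_x[of "T * u / 2"] by (rule abs_le_square_iff[THEN iffD1])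
  then have "1 - cos (T * u) \<le> T / 2 * (T * u\<^sup>2)"
    unfolding one_minus_cos by (simp add: power2_eq_square mult_ac)
  then show ?thesis using assms False by (simp add: fejer_def pos_divide_le_eq)
qed (auto simp: fejer_def)

lemma fejer_ge:
  assumes "T > 0" "\<bar>u\<bar> \<le> 1 / T"
  shows "fejer T u \<ge> T / 4"
proof (cases "u = 0")
  case False
  define x where "x = T * u"
  have x: "\<bar>x\<bar> \<le> 1" using assms by (simp add: x_def abs_mult field_simps)
  have "\<bar>sin (x/2) - x / 2\<bar> \<le> \<bar>x / 2\<bar> ^ 3 / 6"
    using Maclaurin_sin_bound[of "x / 2" 3] by (simp add: numeral_3_eq_3 sin_coeff_def fact_numeral lessThan_Suc)
  also have "\<bar>x / 2\<bar> ^ 3 / 6 = \<bar>x\<bar> * (\<bar>x\<bar> * \<bar>x\<bar>) / 48" by (simp add: power3_eq_cube)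
  also have "\<dots> \<le> \<bar>x\<bar> * 1 / 48" using x by (intro divide_right_mono mult_left_mono mult_le_one) auto
  \<comment> \<open>From \<open>1/2 - 1/48 \<ge> 3/8\<close>; squaring and doubling then leaves
    \<open>9/32 \<ge> 1/4\<close>.\<close>
  finally have "\<bar>sin (x / 2)\<bar> \<ge> 3 / 8 * \<bar>x\<bar>" by (auto simp: abs_if split: if_splits)
  then have "(3 / 8 * \<bar>x\<bar>)\<^sup>2 \<le> (sin (x / 2))\<^sup>2"
    by (metis abs_ge_zero abs_le_square_iff abs_mult abs_idempotent abs_numeral abs_divide)
  moreover have "(3 / 8 * \<bar>x\<bar>)\<^sup>2 = 9 / 64 * x\<^sup>2" by (simp add: power2_eq_square)
  ultimately have "1 - cos x \<ge> x\<^sup>2 / 4" unfolding one_minus_cos using zero_le_power2[of x] by linarith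
  then have "1 - cos (T * u) \<ge> T / 4 * (T * u\<^sup>2)" by (simp add: x_def power2_eq_square mult_ac)
  then show ?thesis using assms False by (simp add: fejer_def pos_le_divide_eq)
qed (use assms in \<open>auto simp: fejer_def\<close>)

section \<open>Dirichlet series tested against Fejer kernels\<close>

lemma dirichlet_fejer:
  assumes a: "zeta_summable a" and \<sigma>: "\<sigma> > 1" and T: "T > 0"
  shows "(\<lambda>n. a n * real n powr (-\<sigma>) * fejer T (y - ln n)) sums
    integral {0..T} (\<lambda>t. (1 - t / T) * Re (dirichlet a (Complex \<sigma> t) * cis (y * t)))"
    (is "?f sums _")
proof -
  define b where "b = (\<lambda>n. a n * real n powr (-\<sigma>))"
  define R where "R = (\<lambda>t. (1 - t / T) * Re (dirichlet a (Complex \<sigma> t) * cis (y * t)))"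
  define g where "g = (\<lambda>n t. (1 - t / T) * (b n * cos (t * (y - ln n))))"
  have sb: "summable (\<lambda>n. \<bar>b n\<bar>)" using a \<sigma> by (simp add: b_def zeta_summable_def abs_mult)
  have gR: "(\<lambda>n. g n t) sums R t" for t
  proof -
    have "(\<lambda>n. of_real (a n) * of_nat n powr (- Complex \<sigma> t) * cis (y * t)) sums (dirichlet a (Complex \<sigma> t) * cis (y * t))"
      using \<sigma> by (intro sums_mult2 dirichlet_sums a) auto
    then have "(\<lambda>n. (1 - t / T) * Re (of_real (a n) * of_nat n powr (- Complex \<sigma> t) * cis (y * t))) sums R t"
      unfolding R_def by (intro sums_mult sums_Re)
    moreover have "Re (of_real (a n) * of_nat n powr (- Complex \<sigma> t) * cis (y * t)) = b n * cos (t * (y - ln n))" for n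
    proof (cases "n = 0")
      case False
      have "of_nat n powr (- Complex \<sigma> t) = of_real (real n powr (-\<sigma>)) * cis (- t * ln n)"
        using False by (simp add: powr_def exp_eq_polar complex_eq_iff)
      then have "of_real (a n) * of_nat n powr (- Complex \<sigma> t) * cis (y * t) = of_real (b n) * (cis (- t * ln n) * cis (y * t))"
        by (simp add: b_def mult_ac)
      also have "cis (- t * ln n) * cis (y * t) = cis (t * (y - ln n))"
        by (simp add: cis_mult algebra_simps)
      finally show ?thesis by simp
    qed (simp add: b_def)
    ultimately show ?thesis by (simp only: g_def)
  qed
  have "uniform_limit {0..T} (\<lambda>N t. \<Sum>n<N. g n t) (\<lambda>t. \<Sum>n. g n t) sequentially"
  proof (rule Weierstrass_m_test[OF _ sb])
    fix n t assume t: "t \<in> {0..T}"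
    then have "\<bar>1 - t / T\<bar> \<le> 1" using T by (auto simp: abs_le_iff field_simps)
    then have "\<bar>1 - t / T\<bar> * (\<bar>b n\<bar> * \<bar>cos (t * (y - ln n))\<bar>) \<le> 1 * (\<bar>b n\<bar> * 1)"
      by (intro mult_mono) auto
    then show "norm (g n t) \<le> \<bar>b n\<bar>" by (simp add: g_def abs_mult)
  qed
  then have U: "uniform_limit {0..T} (\<lambda>N t. \<Sum>n<N. g n t) R sequentially"
    using gR by (simp add: sums_iff)
  have C: "continuous_on {0..T} (\<lambda>t. \<Sum>n<N. g n t)" for N
    unfolding g_def by (intro continuous_intros) (use T in auto)
  obtain I J where IJ: "\<And>N. ((\<lambda>t. \<Sum>n<N. g n t) has_integral I N) {0..T}"
    "(R has_integral J) {0..T}" "I \<longlonglongrightarrow> J"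
    using uniform_limit_integral[OF U C sequentially_bot] by metis
  have "((\<lambda>t. \<Sum>n<N. g n t) has_integral (\<Sum>n<N. ?f n)) {0..T}" for N
  proof (intro has_integral_sum)
    fix n
    have "((\<lambda>t. b n * ((1 - t / T) * cos (t * (y - ln n)))) has_integral (b n * fejer T (y - ln n))) {0..T}"
      by (intro has_integral_mult_right fejer_has_integral T)
    then show "(g n has_integral ?f n) {0..T}" by (simp add: g_def[abs_def] b_def mult_ac)
  qed auto
  then have "I N = (\<Sum>n<N. ?f n)" for N using IJ(1) has_integral_unique by blast
  then have "I = (\<lambda>N. \<Sum>n<N. ?f n)" by (rule ext)
  moreover have "integral {0..T} R = J" using IJ(2) by (rule integral_unique)
  ultimately show ?thesis using IJ(3) by (simp add: sums_def R_def)
qed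

text \<open>Riemann-Lebesgue with a rate: integrating by parts against \<open>cis (y * t)\<close>
  gains a factor \<open>1 / y\<close>.\<close>

lemma oscillating_integral_le:
  fixes G :: "real \<Rightarrow> complex"
  assumes T: "T > 0" and D: "\<And>t. t \<in> {0..T} \<Longrightarrow> (G has_vector_derivative G' t) (at t within {0..T})"
    and c: "continuous_on {0..T} G'"
  obtains C where "C \<ge> 0" "\<And>y. norm (integral {0..T} (\<lambda>t. G t * cis (y * t))) \<le> C"
    "\<And>y. y > 0 \<Longrightarrow> norm (integral {0..T} (\<lambda>t. G t * cis (y * t))) \<le> C / y"
proof -
  have cG: "continuous_on {0..T} G" unfolding continuous_on_eq_continuous_within
    by (rule ballI, rule has_vector_derivative_continuous, rule D)
  have bd: "\<exists>M. \<forall>t\<in>{0..T}. norm (f t) \<le> M" if "continuous_on {0..T} f" for f :: "real \<Rightarrow> complex"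
    using compact_imp_bounded[OF compact_continuous_image[OF that compact_Icc]]
    unfolding bounded_iff ball_simps .
  obtain M where M: "\<And>t. t \<in> {0..T} \<Longrightarrow> norm (G t) \<le> M"
    using bd[OF cG] by blast
  obtain M' where M': "\<And>t. t \<in> {0..T} \<Longrightarrow> norm (G' t) \<le> M'"
    using bd[OF c] by blast
  have pos: "M \<ge> 0" "M' \<ge> 0" using order_trans[OF norm_ge_zero M[of 0]] order_trans[OF norm_ge_zero M'[of 0]] T by auto
  have ccis: "continuous_on {0..T} (\<lambda>t. cis (y * t))" for y by (intro continuous_intros)
  have 1: "norm (integral {0..T} (\<lambda>t. G t * cis (y * t))) \<le> M * T" for y
  proof -
    have "norm (integral {0..T} (\<lambda>t. G t * cis (y * t))) \<le> M * (T - 0)"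
      using T M by (intro integral_bound continuous_intros cG) (auto simp: norm_mult)
    then show ?thesis by simp
  qed
  have 2: "norm (integral {0..T} (\<lambda>t. G t * cis (y * t))) \<le> (2 * M + M' * T) / y" if y: "y > 0" for y
  proof -
    define F where "F = (\<lambda>t. G t * cis (y * t))"
    have "(F has_vector_derivative G' t * cis (y * t) + (\<i> * of_real y) * (G t * cis (y * t))) (at t within {0..T})"
      if "t \<in> {0..T}" for t
    proof -
      have "((\<lambda>t. cis (y * t)) has_vector_derivative y *\<^sub>R (\<i> * cis (y * t))) (at t within {0..T})"
      proof -
        have "((\<lambda>z. exp (\<i> * (of_real y * z))) has_field_derivative y *\<^sub>R (\<i> * exp (\<i> * (of_real y * of_real t)))) (at (of_real t))"
          by (auto intro!: derivative_eq_intros simp: scaleR_conv_of_real)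
        from has_vector_derivative_real_field[OF this] show ?thesis by (simp add: cis_conv_exp)
      qed
      from has_vector_derivative_mult[OF D[OF that] this] show ?thesis
        unfolding F_def by (simp add: scaleR_conv_of_real algebra_simps)
    qed
    then have "((\<lambda>t. G' t * cis (y * t) + (\<i> * of_real y) * (G t * cis (y * t))) has_integral (F T - F 0)) {0..T}"
      using T by (intro fundamental_theorem_of_calculus) auto
    moreover have "(\<lambda>t. G' t * cis (y * t)) integrable_on {0..T}" "(\<lambda>t. G t * cis (y * t)) integrable_on {0..T}"
      by (intro integrable_continuous_interval continuous_intros c cG)+
    then have "((\<lambda>t. G' t * cis (y * t) + (\<i> * of_real y) * (G t * cis (y * t))) has_integral
        (integral {0..T} (\<lambda>t. G' t * cis (y * t)) + (\<i> * of_real y) * integral {0..T} (\<lambda>t. G t * cis (y * t)))) {0..T}"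
      by (intro has_integral_add has_integral_mult_right integrable_integral)
    ultimately have "F T - F 0 = integral {0..T} (\<lambda>t. G' t * cis (y * t)) + (\<i> * of_real y) * integral {0..T} (\<lambda>t. G t * cis (y * t))"
      by (rule has_integral_unique)
    then have "(\<i> * of_real y) * integral {0..T} (\<lambda>t. G t * cis (y * t)) = F T - F 0 - integral {0..T} (\<lambda>t. G' t * cis (y * t))"
      by simp
    then have "y * norm (integral {0..T} (\<lambda>t. G t * cis (y * t))) = norm (F T - F 0 - integral {0..T} (\<lambda>t. G' t * cis (y * t)))"
      using y by (metis abs_of_pos norm_ii norm_mult norm_of_real mult_1)
    also have "\<dots> \<le> norm (F T) + norm (F 0) + norm (integral {0..T} (\<lambda>t. G' t * cis (y * t)))"
      using norm_triangle_ineq4[of "F T - F 0" "integral {0..T} (\<lambda>t. G' t * cis (y * t))"] norm_triangle_ineq4[of "F T" "F 0"]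
      by linarith
    also have "norm (integral {0..T} (\<lambda>t. G' t * cis (y * t))) \<le> M' * (T - 0)"
      using T M' by (intro integral_bound continuous_intros c) (auto simp: norm_mult)
    also have "norm (F T) + norm (F 0) \<le> 2 * M" using M[of 0] M[of T] T by (simp add: F_def norm_mult)
    finally show ?thesis using y by (simp add: pos_le_divide_eq mult.commute)
  qed
  show thesis
  proof (rule that[of "M * T + (2 * M + M' * T)"])
    show "norm (integral {0..T} (\<lambda>t. G t * cis (y * t))) \<le> M * T + (2 * M + M' * T)" for y
      using 1[of y] pos T by (auto intro: order_trans)
    show "norm (integral {0..T} (\<lambda>t. G t * cis (y * t))) \<le> (M * T + (2 * M + M' * T)) / y" if "y > 0" for y
      using that pos T by (intro order_trans[OF 2] divide_right_mono) auto
  qed (use pos T in auto)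
qed

text \<open>The Dirichlet series are controlled only for \<open>\<sigma> > 1\<close>, but the
  difference of the two smoothed sums is an integral of \<open>H\<close>, which continues to
  \<open>\<sigma> = 1\<close>. The limit \<open>J y\<close> is an oscillating integral of a smooth
  function along the line, hence bounded in \<open>y\<close> and decaying.\<close>

lemma mangoldt_fejer:
  assumes T: "T > 0"
  obtains J C where "\<And>y. \<bar>J y\<bar> \<le> C" "(J \<longlongrightarrow> 0) at_top"
    "\<And>y. ((\<lambda>\<sigma>. (\<Sum>n. mangoldt n * real n powr (-\<sigma>) * fejer T (y - ln n))
        - (\<Sum>n. real n powr (-\<sigma>) * fejer T (y - ln n))) \<longlongrightarrow> J y) (at_right 1)"
proof -
  obtain H \<Omega> where \<Omega>: "open \<Omega>" "{s. Re s \<ge> 1} \<subseteq> \<Omega>" and H: "H holomorphic_on \<Omega>"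
    and HD: "\<And>s. Re s > 1 \<Longrightarrow> H s = dirichlet mangoldt s - dirichlet (\<lambda>_. 1) s"
    using mangoldt_minus_one_extension by metis
  \<comment> \<open>Written with the continuation \<open>H\<close> instead of the two series, so
    that \<open>\<sigma> = 1\<close> is admissible; continuity in \<open>\<sigma>\<close> then
    identifies the limit as \<open>J y 1\<close>.\<close>
  define J where "J = (\<lambda>y \<sigma>. integral {0..T} (\<lambda>t. (1 - t / T) * Re (H (Complex \<sigma> t) * cis (y * t))))"
  have inOm: "Complex \<sigma> t \<in> \<Omega>" if "\<sigma> \<ge> 1" for \<sigma> t using \<Omega>(2) that by auto
  have cH: "continuous_on \<Omega> H" using H by (rule holomorphic_on_imp_continuous_on)
  have 1: "((\<lambda>\<sigma>. (\<Sum>n. mangoldt n * real n powr (-\<sigma>) * fejer T (y - ln n))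
        - (\<Sum>n. real n powr (-\<sigma>) * fejer T (y - ln n))) \<longlongrightarrow> J y 1) (at_right 1)" for y
  proof -
    have "continuous_on {1..2} (J y)"
      unfolding J_def box_real[symmetric]
      by (rule integral_continuous_on_param)
         (use T inOm in \<open>auto intro!: continuous_intros continuous_on_compose2[OF cH] simp: case_prod_unfold\<close>)
    then have "(J y \<longlongrightarrow> J y 1) (at 1 within {1..2})" by (simp add: continuous_on_def)
    then have "(J y \<longlongrightarrow> J y 1) (at_right 1)"
      by (simp add: at_within_Icc_at_right)
    then show ?thesis
    proof (rule Lim_transform_eventually)
      show "\<forall>\<^sub>F \<sigma> in at_right 1. J y \<sigma> = (\<Sum>n. mangoldt n * real n powr (-\<sigma>) * fejer T (y - ln n))
        - (\<Sum>n. real n powr (-\<sigma>) * fejer T (y - ln n))"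
        unfolding eventually_at_filter
      proof (intro always_eventually allI impI)
        fix \<sigma> :: real assume "\<sigma> \<in> {1<..}"
        then have \<sigma>: "\<sigma> > 1" by simp
        have int: "(\<lambda>t. (1 - t / T) * Re (dirichlet a (Complex \<sigma> t) * cis (y * t))) integrable_on {0..T}" if "zeta_summable a" for a
          by (intro integrable_continuous_interval continuous_intros continuous_at_imp_continuous_on ballI
                isCont_o2[OF _ isCont_dirichlet[OF that]])
             (use T \<sigma> in \<open>auto intro!: continuous_intros simp: isCont_def intro: tendsto_Complex\<close>)
        have "J y \<sigma> = integral {0..T} (\<lambda>t. (1 - t / T) * Re (dirichlet mangoldt (Complex \<sigma> t) * cis (y * t))
           - (1 - t / T) * Re (dirichlet (\<lambda>_. 1) (Complex \<sigma> t) * cis (y * t)))"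
          unfolding J_def using \<sigma> by (simp add: HD algebra_simps)
        also have "\<dots> = integral {0..T} (\<lambda>t. (1 - t / T) * Re (dirichlet mangoldt (Complex \<sigma> t) * cis (y * t)))
           - integral {0..T} (\<lambda>t. (1 - t / T) * Re (dirichlet (\<lambda>_. 1) (Complex \<sigma> t) * cis (y * t)))"
          by (intro integral_diff int zeta_summable_mangoldt zeta_summable_one)
        also have "\<dots> = (\<Sum>n. mangoldt n * real n powr (-\<sigma>) * fejer T (y - ln n))
        - (\<Sum>n. real n powr (-\<sigma>) * fejer T (y - ln n))"
          using dirichlet_fejer[OF zeta_summable_mangoldt \<sigma> T, of y] dirichlet_fejer[OF zeta_summable_one \<sigma> T, of y]
          by (simp add: sums_iff)
        finally show "J y \<sigma> = \<dots>" .
      qed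
    qed
  qed
  define G where "G = (\<lambda>t. of_real (1 - t / T) * H (Complex 1 t))"
  define G' where "G' = (\<lambda>t. of_real (1 - t / T) * (\<i> * deriv H (Complex 1 t)) - H (Complex 1 t) / of_real T)"
  have C1: "continuous_on {0..T} (\<lambda>t. f (Complex 1 t))" if "f holomorphic_on \<Omega>" for f :: "complex \<Rightarrow> complex"
    by (intro continuous_on_compose2[OF holomorphic_on_imp_continuous_on[OF that]] continuous_intros) (use inOm in auto)
  have "(G has_vector_derivative G' t) (at t within {0..T})" for t
  proof -
    have "(H has_field_derivative deriv H (Complex 1 t)) (at (Complex 1 t))"
      using H \<Omega>(1) inOm by (intro holomorphic_derivI) auto
    moreover have "((\<lambda>t. Complex 1 t) has_vector_derivative \<i>) (at t within {0..T})"
      unfolding Complex_eq by (auto intro!: derivative_eq_intros)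
    ultimately have "(H \<circ> (\<lambda>t. Complex 1 t) has_vector_derivative \<i> * deriv H (Complex 1 t)) (at t within {0..T})"
      by (intro field_vector_diff_chain_within) (auto intro: has_field_derivative_at_within)
    moreover have "((\<lambda>t. complex_of_real (1 - t / T)) has_vector_derivative - (1 / of_real T)) (at t within {0..T})"
      using T by (auto intro!: derivative_eq_intros simp: field_simps)
    ultimately have "((\<lambda>t. complex_of_real (1 - t / T) * (H \<circ> (\<lambda>t. Complex 1 t)) t) has_vector_derivative
         complex_of_real (1 - t / T) * (\<i> * deriv H (Complex 1 t)) + - (1 / of_real T) * (H \<circ> (\<lambda>t. Complex 1 t)) t) (at t within {0..T})"
      by (intro has_vector_derivative_mult)
    then show ?thesis by (simp add: G_def G'_def o_def)
  qed
  moreover have "continuous_on {0..T} G'"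
    unfolding G'_def using T H \<Omega>(1) by (intro continuous_intros C1 holomorphic_deriv) auto
  ultimately obtain C where C: "C \<ge> 0" "\<And>y. norm (integral {0..T} (\<lambda>t. G t * cis (y * t))) \<le> C"
    "\<And>y. y > 0 \<Longrightarrow> norm (integral {0..T} (\<lambda>t. G t * cis (y * t))) \<le> C / y"
    using oscillating_integral_le[OF T, of G G'] by blast
  have "continuous_on {0..T} G" unfolding G_def using T H by (intro continuous_intros C1) auto
  then have int: "(\<lambda>t. G t * cis (y * t)) integrable_on {0..T}" for y
    by (intro integrable_continuous_interval continuous_intros)
  have J: "J y 1 = Re (integral {0..T} (\<lambda>t. G t * cis (y * t)))" for y
    using integral_linear[OF int bounded_linear_Re, of y]
    by (simp add: J_def G_def o_def mult.assoc)
  show thesis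
  proof (rule that[OF _ _ 1])
    show "\<bar>J y 1\<bar> \<le> C" for y unfolding J using abs_Re_le_cmod C(2) order_trans by blast
    show "((\<lambda>y. J y 1) \<longlongrightarrow> 0) at_top"
    proof (rule Lim_null_comparison)
      show "\<forall>\<^sub>F y in at_top. norm (J y 1) \<le> C / y"
        using eventually_gt_at_top[of "0::real"]
      proof eventually_elim
        case (elim y)
        then show ?case unfolding J using abs_Re_le_cmod C(3) order_trans by (metis real_norm_def)
      qed
      show "((\<lambda>y. C / y) \<longlongrightarrow> 0) at_top" by real_asymp
    qed
  qed
qed

section \<open>The mass of \<open>mangoldt n / n\<close> in windows of \<open>ln n\<close>\<close>

lemma block_tail_bound:
  fixes a :: "nat \<Rightarrow> real"
  assumes a: "\<And>n. a n \<ge> 0"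
    and M: "\<And>z B. finite B \<Longrightarrow> B \<subseteq> {n. n > 0 \<and> \<bar>ln n - z\<bar> \<le> 1} \<Longrightarrow> sum a B \<le> M"
    and \<epsilon>: "0 < \<epsilon>" "\<epsilon> \<le> 1"
    and A: "finite A" "A \<subseteq> {n. n > 0 \<and> \<epsilon> \<le> \<bar>ln n - y\<bar>}"
  shows "(\<Sum>n\<in>A. a n / (ln n - y)\<^sup>2) \<le> 6 * M / \<epsilon>\<^sup>2"
proof -
  \<comment> \<open>Shells by the integer part of the distance of \<open>ln n\<close> from
    \<open>y\<close>. Two windows of radius \<open>1\<close>, one on either side of
    \<open>y\<close>, cover a shell, so its mass is at most \<open>2 * M\<close>.\<close>
  define m where "m = (\<lambda>n::nat. nat \<lfloor>\<bar>ln n - y\<bar>\<rfloor>)"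
  \<comment> \<open>In the innermost shell the distance is only known to be at least
    \<open>\<epsilon>\<close>. The weights add up to at most
    \<open>1 / \<epsilon>^2 + 2 \<le> 3 / \<epsilon>^2\<close>, and \<open>3 * 2 M\<close> is the
    constant \<open>6 * M\<close>.\<close>
  define w where "w = (\<lambda>k::nat. if k = 0 then 1 / \<epsilon>\<^sup>2 else 1 / (real k)\<^sup>2)"
  have M0: "M \<ge> 0" using M[of "{}" 0] by simp
  have w0: "w k \<ge> 0" for k by (simp add: w_def)
  have block: "sum a {n\<in>A. m n = k} \<le> 2 * M" for k
  proof -
    define B C where "B = {n\<in>A. \<bar>ln n - (y + k + 1/2)\<bar> \<le> 1}" and "C = {n\<in>A. \<bar>ln n - (y - k - 1/2)\<bar> \<le> 1}"
    have sub: "{n\<in>A. m n = k} \<subseteq> B \<union> C"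
    proof
      fix n assume n: "n \<in> {n\<in>A. m n = k}"
      then have "real k \<le> \<bar>ln n - y\<bar>" "\<bar>ln n - y\<bar> < real k + 1"
        by (simp_all add: m_def) linarith+
      then have "\<bar>ln n - (y + k + 1/2)\<bar> \<le> 1 \<or> \<bar>ln n - (y - k - 1/2)\<bar> \<le> 1" by linarith
      then show "n \<in> B \<union> C" using n by (auto simp: B_def C_def)
    qed
    have fin: "finite B" "finite C" using A by (auto simp: B_def C_def)
    have "sum a {n\<in>A. m n = k} \<le> sum a (B \<union> C)" using sub fin a by (intro sum_mono2) auto
    also have "\<dots> \<le> sum a B + sum a C"
      using sum.union_inter[OF fin, of a] sum_nonneg[of "B \<inter> C" a] a by simp
    also have "sum a B \<le> M" by (rule M[OF fin(1)]) (use A in \<open>auto simp: B_def\<close>)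
    also have "sum a C \<le> M" by (rule M[OF fin(2)]) (use A in \<open>auto simp: C_def\<close>)
    finally show ?thesis by simp
  qed
  have wsum: "(\<Sum>k<Suc (Suc K). w k) \<le> 1 / \<epsilon>\<^sup>2 + 2 - 1 / (real K + 1)" for K
  proof (induction K)
    case (Suc K)
    have "1 / (real K + 2)\<^sup>2 \<le> 1 / ((real K + 1) * (real K + 2))"
      by (intro divide_left_mono) (auto simp: power2_eq_square)
    also have "\<dots> = 1 / (real K + 1) - 1 / (real K + 2)" by (simp add: field_simps)
    finally show ?case using Suc by (simp add: w_def add_ac)
  qed (simp add: w_def)
  have "(\<Sum>n\<in>A. a n / (ln n - y)\<^sup>2) \<le> (\<Sum>n\<in>A. w (m n) * a n)"
  proof (rule sum_mono)
    fix n assume n: "n \<in> A"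
    define u where "u = \<bar>ln n - y\<bar>"
    have u: "u \<ge> \<epsilon>" using n A by (auto simp: u_def)
    have "1 / u\<^sup>2 \<le> w (m n)"
    proof (cases "m n = 0")
      case True
      have "1 / u\<^sup>2 \<le> 1 / \<epsilon>\<^sup>2" using u \<epsilon> by (intro divide_left_mono power_mono mult_pos_pos) auto
      then show ?thesis using True by (simp add: w_def)
    next
      case False
      have "real (m n) \<le> u" by (simp add: m_def u_def)
      then have "1 / u\<^sup>2 \<le> 1 / (real (m n))\<^sup>2" using False u \<epsilon> by (intro divide_left_mono power_mono mult_pos_pos) auto
      then show ?thesis using False by (simp add: w_def)
    qed
    from mult_right_mono[OF this a[of n]] show "a n / (ln n - y)\<^sup>2 \<le> w (m n) * a n" by (simp add: u_def)
  qed
  also have "\<dots> = (\<Sum>k\<in>m ` A. \<Sum>n\<in>{n\<in>A. m n = k}. w (m n) * a n)"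
    by (rule sum.image_gen[OF A(1)])
  also have "\<dots> = (\<Sum>k\<in>m ` A. w k * sum a {n\<in>A. m n = k})"
    by (intro sum.cong refl) (auto simp: sum_distrib_left)
  also have "\<dots> \<le> (\<Sum>k\<in>m ` A. w k * (2 * M))"
    by (intro sum_mono mult_left_mono block w0)
  also have "\<dots> = (\<Sum>k\<in>m ` A. w k) * (2 * M)" by (simp add: sum_distrib_right)
  also have "\<dots> \<le> (1 / \<epsilon>\<^sup>2 + 2) * (2 * M)"
  proof (intro mult_right_mono)
    obtain K where K: "\<And>k. k \<in> m ` A \<Longrightarrow> k < K" using finite_nat_bounded[of "m ` A"] A(1) by auto
    have "(\<Sum>k\<in>m ` A. w k) \<le> (\<Sum>k<Suc (Suc K). w k)"
      using w0 K by (intro sum_mono2) (auto simp: less_Suc_eq)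
    also have "\<dots> \<le> 1 / \<epsilon>\<^sup>2 + 2 - 1 / (real K + 1)" by (rule wsum)
    also have "\<dots> \<le> 1 / \<epsilon>\<^sup>2 + 2" by simp
    finally show "(\<Sum>k\<in>m ` A. w k) \<le> 1 / \<epsilon>\<^sup>2 + 2" .
  qed (use M0 in auto)
  also have "\<dots> \<le> (1 / \<epsilon>\<^sup>2 + 2 * (1 / \<epsilon>\<^sup>2)) * (2 * M)"
    using \<epsilon> M0 by (intro mult_right_mono add_left_mono) (auto simp: power_le_one le_divide_eq)
  finally show ?thesis by simp
qed

lemma inverse_block_bound:
  assumes "finite A" "A \<subseteq> {n. n > 0 \<and> \<bar>ln n - y\<bar> \<le> 1}"
  shows "(\<Sum>n\<in>A. 1 / real n) \<le> exp 2"
proof -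
  have n: "real n \<le> exp (y + 1)" "1 / real n \<le> exp (1 - y)" if "n \<in> A" for n
  proof -
    have "n > 0" and l: "ln n \<le> y + 1" "y - 1 \<le> ln n" using assms that by (auto simp: abs_le_iff)
    have "exp (ln n) \<le> exp (y + 1)" "exp (y - 1) \<le> exp (ln n)" using l by simp_all
    then have *: "real n \<le> exp (y + 1)" "exp (y - 1) \<le> real n" using \<open>n > 0\<close> by simp_all
    show "real n \<le> exp (y + 1)" by fact
    have "1 / real n \<le> 1 / exp (y - 1)" using * \<open>n > 0\<close> by (intro divide_left_mono) auto
    also have "\<dots> = exp (1 - y)" by (simp add: exp_minus[symmetric] divide_inverse)
    finally show "1 / real n \<le> exp (1 - y)" .
  qed
  have "A \<subseteq> {1..nat \<lfloor>exp (y + 1)\<rfloor>}" using n(1) assms by (force simp: le_nat_floor)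
  then have "card A \<le> nat \<lfloor>exp (y + 1)\<rfloor>" using card_mono[of "{1..nat \<lfloor>exp (y + 1)\<rfloor>}" A] by simp
  then have c: "real (card A) \<le> exp (y + 1)" by (simp add: le_nat_iff le_floor_iff)
  have "(\<Sum>n\<in>A. 1 / real n) \<le> real (card A) * exp (1 - y)"
    using n(2) by (rule sum_bounded_above)
  also have "\<dots> \<le> exp (y + 1) * exp (1 - y)" using c by (intro mult_right_mono) auto
  also have "\<dots> = exp 2" by (simp flip: exp_add)
  finally show ?thesis .
qed

lemma powr_minus_le_inverse:
  assumes "\<sigma> \<ge> 1"
  shows "real n powr (-\<sigma>) \<le> 1 / real n"
proof (cases "n = 0")
  case False
  then have "real n powr (-\<sigma>) \<le> real n powr (-1)" using assms by (intro powr_mono) auto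
  then show ?thesis using False by (simp add: powr_minus_divide)
qed auto

lemma inverse_fejer_bound:
  obtains B where "\<And>y A. finite A \<Longrightarrow> (\<Sum>n\<in>A. 1 / real n * fejer 1 (y - ln n)) \<le> B"
proof (rule that[of "exp 2 + 12 * exp 2"])
  fix y and A :: "nat set" assume A: "finite A"
  define A1 A2 where "A1 = {n\<in>A. n > 0 \<and> \<bar>ln n - y\<bar> \<le> 1}" and "A2 = {n\<in>A. n > 0 \<and> 1 < \<bar>ln n - y\<bar>}"
  have "(\<Sum>n\<in>A. 1 / real n * fejer 1 (y - ln n)) = (\<Sum>n\<in>A1 \<union> A2. 1 / real n * fejer 1 (y - ln n))"
    by (rule sum.mono_neutral_cong_right) (use A in \<open>auto simp: A1_def A2_def\<close>)
  also have "\<dots> = (\<Sum>n\<in>A1. 1 / real n * fejer 1 (y - ln n)) + (\<Sum>n\<in>A2. 1 / real n * fejer 1 (y - ln n))"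
    by (rule sum.union_disjoint) (use A in \<open>auto simp: A1_def A2_def\<close>)
  also have "(\<Sum>n\<in>A1. 1 / real n * fejer 1 (y - ln n)) \<le> (\<Sum>n\<in>A1. 1 / real n * 1)"
    using fejer_le[of 1] by (intro sum_mono mult_left_mono order_trans[OF fejer_le]) auto
  also have "(\<Sum>n\<in>A1. 1 / real n * 1) \<le> exp 2"
    using inverse_block_bound[of A1 y] A by (auto simp: A1_def)
  also have "(\<Sum>n\<in>A2. 1 / real n * fejer 1 (y - ln n)) \<le> (\<Sum>n\<in>A2. 2 * ((1 / real n) / (ln n - y)\<^sup>2))"
  proof (rule sum_mono)
    fix n assume "n \<in> A2"
    then have "fejer 1 (y - ln n) \<le> 2 / (1 * (y - ln n)\<^sup>2)" by (intro fejer_le_tail) (auto simp: A2_def)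
    then have "1 / real n * fejer 1 (y - ln n) \<le> 1 / real n * (2 / (1 * (y - ln n)\<^sup>2))"
      by (intro mult_left_mono) auto
    then show "1 / real n * fejer 1 (y - ln n) \<le> 2 * ((1 / real n) / (ln n - y)\<^sup>2)"
      by (simp add: power2_commute)
  qed
  also have "\<dots> = 2 * (\<Sum>n\<in>A2. (1 / real n) / (ln n - y)\<^sup>2)" by (rule sum_distrib_left[symmetric])
  also have "(\<Sum>n\<in>A2. (1 / real n) / (ln n - y)\<^sup>2) \<le> 6 * exp 2 / 1\<^sup>2"
    by (rule block_tail_bound) (use A inverse_block_bound in \<open>auto simp: A2_def\<close>)
  finally show "(\<Sum>n\<in>A. 1 / real n * fejer 1 (y - ln n)) \<le> exp 2 + 12 * exp 2" by simp
qed

lemma tendsto_powr_minus_at_right_1: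
  "((\<lambda>\<sigma>. real n powr (-\<sigma>)) \<longlongrightarrow> 1 / real n) (at_right 1)"
proof (cases "n = 0")
  case False
  have "((\<lambda>\<sigma>. real n powr (-\<sigma>)) \<longlongrightarrow> real n powr (-1)) (at_right 1)"
    using False by (intro tendsto_intros) auto
  then show ?thesis using False by (simp add: powr_minus_divide)
qed auto

lemma summable_fejer:
  assumes "zeta_summable a" "\<sigma> > 1" "T > 0"
  shows "summable (\<lambda>n. a n * real n powr (-\<sigma>) * fejer T (y - ln n))"
  using dirichlet_fejer[OF assms, of y] by (auto simp: sums_iff)

text \<open>A Chebyshev-type bound, used later to control the tails of sharper kernels. The kernel
  with \<open>T = 1\<close> is at least \<open>1/4\<close> on the window, and the smoothed sum of
  \<open>mangoldt n / n\<close> exceeds that of \<open>1 / n\<close>, itself at most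
  \<open>B\<close>, by no more than the bounded \<open>J y\<close>.\<close>

lemma mangoldt_block_bound:
  obtains M where "M \<ge> 0" 
    "\<And>y A. finite A \<Longrightarrow> A \<subseteq> {n. n > 0 \<and> \<bar>ln n - y\<bar> \<le> 1} \<Longrightarrow> (\<Sum>n\<in>A. mangoldt n / real n) \<le> M"
proof -
  obtain J C where J: "\<And>y. \<bar>J y\<bar> \<le> C" "(J \<longlongrightarrow> 0) at_top"
      "\<And>y. ((\<lambda>\<sigma>. (\<Sum>n. mangoldt n * real n powr (-\<sigma>) * fejer 1 (y - ln n))
        - (\<Sum>n. real n powr (-\<sigma>) * fejer 1 (y - ln n))) \<longlongrightarrow> J y) (at_right 1)"
    by (rule mangoldt_fejer[OF zero_less_one]) (rule that)
  obtain B where B: "\<And>y A. finite A \<Longrightarrow> (\<Sum>n\<in>A. 1 / real n * fejer 1 (y - ln n)) \<le> B"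
    by (rule inverse_fejer_bound) (rule that)
  have *: "(\<Sum>n\<in>A. mangoldt n / real n) \<le> 4 * (C + B)"
    if A: "finite A" "A \<subseteq> {n. n > 0 \<and> \<bar>ln n - y\<bar> \<le> 1}" for y A
  proof -
    let ?S = "\<lambda>\<sigma>. \<Sum>n. mangoldt n * real n powr (-\<sigma>) * fejer 1 (y - ln n)"
    let ?B = "\<lambda>\<sigma>. \<Sum>n. real n powr (-\<sigma>) * fejer 1 (y - ln n)"
    define S S1 where "S = (\<Sum>n\<in>A. mangoldt n / real n)" and "S1 = (\<Sum>n\<in>A. mangoldt n * (1 / real n) * (1/4))"
    define S2 where "S2 = (\<Sum>n\<in>A. mangoldt n * (1 / real n) * fejer 1 (y - ln n))"
    \<comment> \<open>Over the finite set \<open>A\<close> the limit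
      \<open>\<sigma> \<rightarrow> 1\<close> is taken term by term; for \<open>\<sigma> > 1\<close>
      the sum over \<open>A\<close> is at most the full series, whose terms are nonnegative.\<close>
    have "S2 \<le> J y + B" unfolding S2_def
    proof (rule tendsto_le[of "at_right (1::real)"])
      show "((\<lambda>\<sigma>. \<Sum>n\<in>A. mangoldt n * real n powr (-\<sigma>) * fejer 1 (y - ln n)) \<longlongrightarrow>
         (\<Sum>n\<in>A. mangoldt n * (1 / real n) * fejer 1 (y - ln n))) (at_right 1)"
        by (intro tendsto_sum tendsto_mult tendsto_const tendsto_powr_minus_at_right_1)
      show "((\<lambda>\<sigma>. (?S \<sigma> - ?B \<sigma>) + B) \<longlongrightarrow> J y + B) (at_right 1)"
        by (intro tendsto_add J tendsto_const)
      show "\<forall>\<^sub>F \<sigma> in at_right 1. (\<Sum>n\<in>A. mangoldt n * real n powr (-\<sigma>) * fejer 1 (y - ln n)) \<le> (?S \<sigma> - ?B \<sigma>) + B"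
        unfolding eventually_at_filter
      proof (intro always_eventually allI impI)
        fix \<sigma> :: real assume "\<sigma> \<in> {1<..}"
        then have \<sigma>: "\<sigma> > 1" by simp
        have "(\<Sum>n\<in>A. mangoldt n * real n powr (-\<sigma>) * fejer 1 (y - ln n)) \<le> ?S \<sigma>"
          by (intro sum_le_suminf summable_fejer zeta_summable_mangoldt \<sigma> A)
             (auto intro!: mult_nonneg_nonneg mangoldt_nonneg fejer_nonneg)
        moreover have "?B \<sigma> \<le> B"
        proof (rule suminf_le_const)
          show "summable (\<lambda>n. real n powr (-\<sigma>) * fejer 1 (y - ln n))"
            using summable_fejer[OF zeta_summable_one \<sigma>, of 1 y] by simp
          fix N
          have "(\<Sum>n<N. real n powr (-\<sigma>) * fejer 1 (y - ln n)) \<le> (\<Sum>n<N. 1 / real n * fejer 1 (y - ln n))"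
            using \<sigma> by (intro sum_mono mult_right_mono powr_minus_le_inverse fejer_nonneg) auto
          also have "\<dots> \<le> B" by (intro B) auto
          finally show "(\<Sum>n<N. real n powr (-\<sigma>) * fejer 1 (y - ln n)) \<le> B" .
        qed
        ultimately show "(\<Sum>n\<in>A. mangoldt n * real n powr (-\<sigma>) * fejer 1 (y - ln n)) \<le> (?S \<sigma> - ?B \<sigma>) + B" by simp
      qed
    qed auto
    also have "\<dots> \<le> C + B" using J(1)[of y] by (simp add: abs_le_iff)
    finally have "S2 \<le> C + B" .
    moreover have "S1 \<le> S2" unfolding S1_def S2_def
    proof (intro sum_mono mult_left_mono)
      fix n assume "n \<in> A"
      then show "1 / 4 \<le> fejer 1 (y - ln n)" using fejer_ge[of 1 "y - ln n"] A by (auto simp: abs_minus_commute)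
    qed (auto intro!: divide_nonneg_nonneg mangoldt_nonneg)
    moreover have "S1 = S / 4" unfolding S1_def S_def by (simp add: sum_divide_distrib)
    ultimately have "S \<le> 4 * (C + B)" by simp
    then show ?thesis unfolding S_def .
  qed
  from *[of "{}" 0] have "4 * (C + B) \<ge> 0" by simp
  from that[OF this *] show thesis .
qed

text \<open>As \<open>T\<close> grows, the kernel mass outside the window is of order
  \<open>M / (T \<epsilon>^2)\<close>, whereas the main term supplied by the integers stays above a
  constant once \<open>y\<close> is large. A fixed large \<open>T\<close> therefore leaves positive
  \<open>\<Lambda>\<close>-mass inside the window.\<close>

lemma mangoldt_window:
  assumes \<epsilon>: "0 < \<epsilon>" "\<epsilon> \<le> 1"
  obtains c where "c > 0" "\<forall>\<^sub>F y in at_top. (\<Sum>n | n > 0 \<and> \<bar>ln (real n) - y\<bar> < \<epsilon>. mangoldt n / real n) \<ge> c"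
proof -
  obtain M where M: "M \<ge> 0" 
    "\<And>y A. finite A \<Longrightarrow> A \<subseteq> {n. n > 0 \<and> \<bar>ln n - y\<bar> \<le> 1} \<Longrightarrow> (\<Sum>n\<in>A. mangoldt n / real n) \<le> M"
    by (rule mangoldt_block_bound) (rule that)
  \<comment> \<open>As \<open>1152 = 12 * 96\<close>, the tail
    \<open>12 * M / (T * \<epsilon>^2)\<close> is at most \<open>1/96\<close>; the summand
    \<open>1\<close> ensures \<open>T \<ge> 1\<close>.\<close>
  define T where "T = 1 + 1152 * M / \<epsilon>\<^sup>2"
  have T: "T \<ge> 1" using M \<epsilon> by (simp add: T_def)
  have out: "12 * M / (T * \<epsilon>\<^sup>2) \<le> 1 / 96"
  proof -
    have "1152 * M \<le> T * \<epsilon>\<^sup>2" using \<epsilon> by (simp add: T_def field_simps)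
    then show ?thesis using T \<epsilon> by (simp add: pos_divide_le_eq)
  qed
  obtain J C where J: "\<And>y. \<bar>J y\<bar> \<le> C" "(J \<longlongrightarrow> 0) at_top" "\<And>y. ((\<lambda>\<sigma>. (\<Sum>n. mangoldt n * real n powr (-\<sigma>) * fejer T (y - ln n))
        - (\<Sum>n. real n powr (-\<sigma>) * fejer T (y - ln n))) \<longlongrightarrow> J y) (at_right 1)"
    by (rule mangoldt_fejer[OF less_le_trans[OF zero_less_one T]]) (rule that)
  define W where "W = (\<lambda>y. {n::nat. n > 0 \<and> \<bar>ln (real n) - y\<bar> < \<epsilon>})"
  \<comment> \<open>Integers whose logarithm lies in \<open>[y, y + 1 / T]\<close>, where the kernel
    is at least \<open>T / 4\<close>. There are about \<open>exp y / T\<close> of them, so the two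
    powers of \<open>T\<close> cancel in their contribution.\<close>
  define W' where "W' = (\<lambda>y. {nat \<lceil>exp y\<rceil>..nat \<lfloor>exp (y + 1 / T)\<rfloor>})"
  have finW: "finite (W y)" for y
  proof (rule finite_subset)
    show "W y \<subseteq> {..nat \<lfloor>exp (y + \<epsilon>)\<rfloor>}"
    proof
      fix n assume n: "n \<in> W y"
      then have "n > 0" "ln n \<le> y + \<epsilon>" by (auto simp: W_def)
      then have "real n \<le> exp (y + \<epsilon>)" by (metis exp_le_cancel_iff exp_ln of_nat_0_less_iff)
      then show "n \<in> {..nat \<lfloor>exp (y + \<epsilon>)\<rfloor>}" by (simp add: le_nat_floor)
    qed
  qed auto
  have main: "(\<Sum>n\<in>W' y. 1 / real n * fejer T (y - ln n)) + J y
      \<le> (\<Sum>n\<in>W y. mangoldt n * (1 / real n) * fejer T (y - ln n)) + 12 * M / (T * \<epsilon>\<^sup>2)" for y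
  proof (rule tendsto_le[of "at_right (1::real)"])
    let ?S = "\<lambda>\<sigma>. \<Sum>n. mangoldt n * real n powr (-\<sigma>) * fejer T (y - ln n)"
    let ?B = "\<lambda>\<sigma>. \<Sum>n. real n powr (-\<sigma>) * fejer T (y - ln n)"
    show "((\<lambda>\<sigma>. (\<Sum>n\<in>W y. mangoldt n * real n powr (-\<sigma>) * fejer T (y - ln n)) + 12 * M / (T * \<epsilon>\<^sup>2)) \<longlongrightarrow>
       (\<Sum>n\<in>W y. mangoldt n * (1 / real n) * fejer T (y - ln n)) + 12 * M / (T * \<epsilon>\<^sup>2)) (at_right 1)"
      by (intro tendsto_sum tendsto_mult tendsto_add tendsto_const tendsto_powr_minus_at_right_1)
    show "((\<lambda>\<sigma>. (\<Sum>n\<in>W' y. real n powr (-\<sigma>) * fejer T (y - ln n)) + (?S \<sigma> - ?B \<sigma>)) \<longlongrightarrow>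
       (\<Sum>n\<in>W' y. 1 / real n * fejer T (y - ln n)) + J y) (at_right 1)"
      by (intro tendsto_sum tendsto_mult tendsto_add tendsto_const tendsto_powr_minus_at_right_1 J)
    show "\<forall>\<^sub>F \<sigma> in at_right 1. (\<Sum>n\<in>W' y. real n powr (-\<sigma>) * fejer T (y - ln n)) + (?S \<sigma> - ?B \<sigma>)
       \<le> (\<Sum>n\<in>W y. mangoldt n * real n powr (-\<sigma>) * fejer T (y - ln n)) + 12 * M / (T * \<epsilon>\<^sup>2)"
      unfolding eventually_at_filter
    proof (intro always_eventually allI impI)
      fix \<sigma> :: real assume "\<sigma> \<in> {1<..}"
      then have \<sigma>: "\<sigma> > 1" by simp
      have T0: "T > 0" using T by simp
      define f where "f = (\<lambda>n. mangoldt n * real n powr (-\<sigma>) * fejer T (y - ln n))"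
      have f0: "f n \<ge> 0" for n
        unfolding f_def using T0 by (intro mult_nonneg_nonneg mangoldt_nonneg fejer_nonneg) auto
      have "(\<Sum>n\<in>W' y. real n powr (-\<sigma>) * fejer T (y - ln n)) \<le> ?B \<sigma>"
        using summable_fejer[OF zeta_summable_one \<sigma> T0, of y] T0
        by (intro sum_le_suminf) (auto simp: W'_def intro!: mult_nonneg_nonneg fejer_nonneg)
      moreover have "?S \<sigma> \<le> sum f (W y) + 12 * M / (T * \<epsilon>\<^sup>2)"
        unfolding f_def[symmetric]
      proof (rule suminf_le_const)
        show "summable f" unfolding f_def by (rule summable_fejer[OF zeta_summable_mangoldt \<sigma> T0])
        fix N
        define D where "D = {..<N} - W y - {0}"
        have "sum f {..<N} \<le> sum f (W y \<union> D)"
        proof -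
          have "sum f {..<N} = sum f ({..<N} - {0})"
            by (rule sum.mono_neutral_right) (auto simp: f_def)
          also have "\<dots> \<le> sum f (W y \<union> D)" using finW f0 by (intro sum_mono2) (auto simp: D_def)
          finally show ?thesis .
        qed
        also have "\<dots> = sum f (W y) + sum f D" by (rule sum.union_disjoint) (use finW in \<open>auto simp: D_def\<close>)
        also have "sum f D \<le> (\<Sum>n\<in>D. 2 / T * ((mangoldt n / real n) / (ln n - y)\<^sup>2))"
        proof (rule sum_mono)
          fix n assume n: "n \<in> D"
          then have "ln n \<noteq> y" using \<epsilon> by (auto simp: D_def W_def)
          then have "fejer T (y - ln n) \<le> 2 / (T * (y - ln n)\<^sup>2)" using T0 by (intro fejer_le_tail) auto
          then have "mangoldt n * real n powr (-\<sigma>) * fejer T (y - ln n) \<le> mangoldt n * (1 / real n) * (2 / (T * (y - ln n)\<^sup>2))"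
            using \<sigma> T0
            by (intro mult_mono[OF mult_left_mono[OF powr_minus_le_inverse]] mult_nonneg_nonneg mangoldt_nonneg fejer_nonneg) simp_all
          then show "f n \<le> 2 / T * ((mangoldt n / real n) / (ln n - y)\<^sup>2)"
            by (simp add: f_def power2_commute mult_ac)
        qed
        also have "\<dots> = 2 / T * (\<Sum>n\<in>D. (mangoldt n / real n) / (ln n - y)\<^sup>2)" by (rule sum_distrib_left[symmetric])
        also have "\<dots> \<le> 2 / T * (6 * M / \<epsilon>\<^sup>2)"
        proof (rule mult_left_mono)
          show "(\<Sum>n\<in>D. (mangoldt n / real n) / (ln n - y)\<^sup>2) \<le> 6 * M / \<epsilon>\<^sup>2"
          proof (rule block_tail_bound[OF _ M(2) \<epsilon>])
            show "0 \<le> mangoldt n / real n" for n by (intro divide_nonneg_nonneg mangoldt_nonneg) simp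
            show "finite D" by (simp add: D_def)
            show "D \<subseteq> {n. 0 < n \<and> \<epsilon> \<le> \<bar>ln (real n) - y\<bar>}" by (auto simp: D_def W_def)
          qed
        qed (use T0 in simp)
        finally show "sum f {..<N} \<le> sum f (W y) + 12 * M / (T * \<epsilon>\<^sup>2)" by simp
      qed
      ultimately show "(\<Sum>n\<in>W' y. real n powr (-\<sigma>) * fejer T (y - ln n)) + (?S \<sigma> - ?B \<sigma>)
         \<le> (\<Sum>n\<in>W y. mangoldt n * real n powr (-\<sigma>) * fejer T (y - ln n)) + 12 * M / (T * \<epsilon>\<^sup>2)"
        by (simp add: f_def)
    qed
  qed auto
  have W'_lower: "(\<Sum>n\<in>W' y. 1 / real n * fejer T (y - ln n)) \<ge> (1 - T / exp y) / 12" if y: "y \<ge> 0" for y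
  proof -
    have n: "real n \<ge> exp y" "real n \<le> exp (y + 1 / T)" if "n \<in> W' y" for n
    proof -
      have "nat \<lceil>exp y\<rceil> \<le> n" "n \<le> nat \<lfloor>exp (y + 1 / T)\<rfloor>" using that by (simp_all only: W'_def atLeastAtMost_iff)
      then have "real (nat \<lceil>exp y\<rceil>) \<le> real n" "real n \<le> real (nat \<lfloor>exp (y + 1 / T)\<rfloor>)" by (simp_all only: of_nat_le_iff)
      moreover have "exp y \<le> real (nat \<lceil>exp y\<rceil>)" by (rule of_nat_ceiling)
      moreover have "real (nat \<lfloor>exp (y + 1 / T)\<rfloor>) \<le> exp (y + 1 / T)" by (rule of_nat_floor) simp
      ultimately show "real n \<ge> exp y" "real n \<le> exp (y + 1 / T)" by (blast intro: order_trans)+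
    qed
    have tm: "1 / real n * fejer T (y - ln n) \<ge> (exp (-y) / 3) * (T / 4)" if "n \<in> W' y" for n
    proof -
      have n0: "real n > 0" using n(1)[OF that] exp_gt_zero[of y] by linarith
      have "ln n \<ge> y" using n(1)[OF that] n0 by (simp add: ln_ge_iff)
      moreover have "ln n \<le> y + 1 / T" 
        using ln_le_cancel_iff[OF n0 exp_gt_zero, THEN iffD2, OF n(2)[OF that]] by (simp only: ln_exp)
      ultimately have "\<bar>y - ln n\<bar> \<le> 1 / T" by simp
      then have 1: "fejer T (y - ln n) \<ge> T / 4" using T by (intro fejer_ge) auto
      have "exp (y + 1 / T) \<le> exp (y + 1)" using T by simp
      with n(2)[OF that] have "real n \<le> exp (y + 1)" by (rule order_trans)
      also have "\<dots> \<le> exp y * 3" unfolding exp_add by (rule mult_left_mono[OF exp_le]) simp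
      finally have "real n \<le> exp y * 3" .
      then have "1 / (exp y * 3) \<le> 1 / real n" using n0 by (rule frac_le[OF zero_le_one order_refl, rotated])
      moreover have "exp (-y) / 3 = 1 / (exp y * 3)" by (simp add: exp_minus field_simps)
      ultimately have 2: "exp (-y) / 3 \<le> 1 / real n" by (simp only:)
      show ?thesis by (rule mult_mono[OF 2 1]) (use T in simp_all)
    qed
    have "exp y / T - 1 \<le> real (card (W' y))"
    proof -
      have "exp y * (1 / T) \<le> exp y * (exp (1 / T) - 1)"
      proof (rule mult_left_mono)
        show "1 / T \<le> exp (1 / T) - 1" using exp_ge_add_one_self[of "1 / T"] by linarith
      qed simp
      then have "exp y / T \<le> exp (y + 1 / T) - exp y" by (simp add: exp_add algebra_simps)
      moreover have "real (card (W' y)) \<ge> exp (y + 1 / T) - exp y - 1"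
      proof -
        have "nat \<lceil>exp y\<rceil> < exp y + 1" using exp_gt_zero[of y] by (simp) linarith
        moreover have "nat \<lfloor>exp (y + 1 / T)\<rfloor> > exp (y + 1 / T) - 1" using exp_gt_zero[of "y + 1 / T"] by simp
        moreover have "real (card (W' y)) \<ge> real (nat \<lfloor>exp (y + 1 / T)\<rfloor>) + 1 - real (nat \<lceil>exp y\<rceil>)"
        proof -
          have "Suc (nat \<lfloor>exp (y + 1 / T)\<rfloor>) \<le> card (W' y) + nat \<lceil>exp y\<rceil>" by (simp add: W'_def)
          then have "real (Suc (nat \<lfloor>exp (y + 1 / T)\<rfloor>)) \<le> real (card (W' y) + nat \<lceil>exp y\<rceil>)" by (simp only: of_nat_le_iff)
          then show ?thesis by simp
        qed
        ultimately show ?thesis by linarith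
      qed
      ultimately show ?thesis by linarith
    qed
    then have "(exp y / T - 1) * ((exp (-y) / 3) * (T / 4)) \<le> real (card (W' y)) * ((exp (-y) / 3) * (T / 4))"
      using T by (intro mult_right_mono) auto
    also have "\<dots> \<le> (\<Sum>n\<in>W' y. 1 / real n * fejer T (y - ln n))"
      using tm by (rule sum_bounded_below)
    also have "(exp y / T - 1) * ((exp (-y) / 3) * (T / 4)) = (1 - T / exp y) / 12"
    proof -
      have "(e / T - 1) * ((inverse e / 3) * (T / 4)) = (1 - T / e) / 12" if "e > 0" for e :: real
        using that T by (simp add: field_simps)
      from this[OF exp_gt_zero] show ?thesis by (simp only: exp_minus)
    qed
    finally show ?thesis .
  qed
  have "\<forall>\<^sub>F y in at_top. \<bar>J y\<bar> < 1 / 96"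
    by (rule order_tendstoD(2)[OF tendsto_rabs_zero[OF J(2)]]) simp
  moreover have "((\<lambda>y::real. 1 / exp y) \<longlongrightarrow> 0) at_top" by real_asymp
  then have "((\<lambda>y. T * (1 / exp y)) \<longlongrightarrow> T * 0) at_top" by (rule tendsto_mult_left)
  then have "\<forall>\<^sub>F y in at_top. T * (1 / exp y) < 1 / 2" by (rule order_tendstoD(2)) simp
  then have "\<forall>\<^sub>F y in at_top. T / exp y < 1 / 2" by simp
  ultimately have "\<forall>\<^sub>F y in at_top. (\<Sum>n\<in>W y. mangoldt n / real n) \<ge> 1 / (24 * T)"
    using eventually_ge_at_top[of 0]
  proof eventually_elim
    case (elim y)
    \<comment> \<open>The integers contribute at least \<open>1/24\<close>; subtracting
      \<open>1/96\<close> for \<open>J y\<close> and \<open>1/96\<close> for the tail leaves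
      \<open>1/48\<close>. Dividing by the maximum \<open>T / 2\<close> of the kernel gives
      \<open>1 / (24 * T)\<close>.\<close>
    have lin: "1 / 48 \<le> b" if "a + j \<le> b + q" "(1 - r) / 12 \<le> a" "\<bar>j\<bar> < 1 / 96" "r < 1/2" "q \<le> 1/96" for a b j q r :: real
    proof -
      have "- (1 / 96) < j" using that(3) by linarith
      then show ?thesis using that by argo
    qed
    have "1 / 48 \<le> (\<Sum>n\<in>W y. mangoldt n * (1 / real n) * fejer T (y - ln n))"
      by (rule lin[OF main[of y] W'_lower[OF elim(3)] elim(1,2) out])
    also have "\<dots> \<le> (\<Sum>n\<in>W y. mangoldt n * (1 / real n) * (T / 2))"
      using T by (intro sum_mono mult_left_mono fejer_le mult_nonneg_nonneg mangoldt_nonneg) auto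
    also have "\<dots> = (\<Sum>n\<in>W y. mangoldt n / real n) * (T / 2)" by (simp add: sum_distrib_right)
    finally have "1 / 48 \<le> (\<Sum>n\<in>W y. mangoldt n / real n) * (T / 2)" .
    moreover have "1 / (24 * T) \<le> s" if "1 / 48 \<le> s * (T / 2)" for s
      using that T by (simp add: pos_divide_le_eq mult_ac)
    ultimately show ?case by blast
  qed
  from that[OF _ this[unfolded W_def]] T show thesis by simp
qed

section \<open>From prime powers to primes\<close>

lemma card_prime_powers_le:
  assumes "X \<ge> 1"
  shows "real (card {n. primepow n \<and> \<not> prime n \<and> real n \<le> X}) \<le> sqrt X * log 2 X"
    "finite {n. primepow n \<and> \<not> prime n \<and> real n \<le> X}"
proof -
  let ?P = "{n. primepow n \<and> \<not> prime n \<and> real n \<le> X}"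
  let ?Q = "{1..nat \<lfloor>sqrt X\<rfloor>} \<times> {1..nat \<lfloor>log 2 X\<rfloor>}"
  have sub: "?P \<subseteq> (\<lambda>(p,k). p ^ k) ` ?Q"
  proof
    fix n assume "n \<in> ?P"
    then have n: "primepow n" "\<not> prime n" "real n \<le> X" by auto
    then obtain p k where pk: "prime p" "k > 0" "n = p ^ k" by (auto simp: primepow_def)
    then have "k \<noteq> 1" using n by auto
    then have k: "k \<ge> 2" using pk by simp
    have p: "p \<ge> 2" using pk(1) by (rule prime_ge_2_nat)
    have "p ^ 2 \<le> n" using pk(3) k p by (auto intro: power_increasing)
    then have "real (p ^ 2) \<le> X" using n(3) by (meson of_nat_le_iff order_trans)
    then have "(real p)\<^sup>2 \<le> X" by simp
    then have "real p \<le> sqrt X" by (rule real_le_rsqrt)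
    moreover have "2 ^ k \<le> n" using pk(3) p by (auto intro: power_mono)
    then have "real (2 ^ k) \<le> X" using n(3) by (meson of_nat_le_iff order_trans)
    then have "2 ^ k \<le> X" by simp
    then have "real k \<le> log 2 X" using assms by (intro le_log_of_power) auto
    ultimately have "(p, k) \<in> ?Q" using p k by (auto simp: le_nat_floor)
    then show "n \<in> (\<lambda>(p,k). p ^ k) ` ?Q" using pk(3) by force
  qed
  show "finite ?P" by (rule finite_subset[OF sub]) auto
  have "card ?P \<le> card ?Q" using surj_card_le[OF _ sub] by simp
  then have "real (card ?P) \<le> real (nat \<lfloor>sqrt X\<rfloor>) * real (nat \<lfloor>log 2 X\<rfloor>)" by (simp flip: of_nat_mult)
  also have "\<dots> \<le> sqrt X * log 2 X" using assms by (intro mult_mono) auto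
  finally show "real (card ?P) \<le> sqrt X * log 2 X" .
qed

text \<open>Proper prime powers are too sparse to carry the mass of a window: up to \<open>X\<close>
  there are at most \<open>sqrt X * log 2 X\<close> of them, each of weight
  \<open>O(ln X / X)\<close> in the window, so their total tends to \<open>0\<close>.\<close>

lemma prime_near_exp:
  assumes "\<epsilon> > 0"
  shows "\<forall>\<^sub>F y in at_top. \<exists>p::nat. prime p \<and> \<bar>ln p - y\<bar> < \<epsilon>"
proof -
  define e where "e = min \<epsilon> 1"
  have e: "e > 0" "e \<le> 1" "e \<le> \<epsilon>" using assms by (auto simp: e_def)
  obtain c where c: "c > 0" "\<forall>\<^sub>F y in at_top. (\<Sum>n | n > 0 \<and> \<bar>ln (real n) - y\<bar> < e. mangoldt n / real n) \<ge> c"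
    using mangoldt_window[OF e(1,2)] by blast
  \<comment> \<open>The number of proper prime powers up to \<open>exp (y + 1)\<close>, times the
    largest possible weight \<open>mangoldt n / n\<close> in the window.\<close>
  define b :: "real \<Rightarrow> real" where "b = (\<lambda>y. (exp ((y + 1) / 2) * ((y + 1) / ln 2)) * ((y + 1) * exp (1 - y)))"
  have "(b \<longlongrightarrow> 0) at_top" unfolding b_def by real_asymp
  then have "\<forall>\<^sub>F y in at_top. b y < c" using c(1) by (rule order_tendstoD)
  with c(2) eventually_ge_at_top[of 0] show ?thesis
  proof eventually_elim
    case (elim y)
    show ?case
    proof (rule ccontr)
      assume no: "\<not> (\<exists>p::nat. prime p \<and> \<bar>ln p - y\<bar> < \<epsilon>)"
      define X where "X = exp (y + 1)"
      let ?P = "{n. primepow n \<and> \<not> prime n \<and> real n \<le> X}"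
      have X: "X \<ge> 1" using elim by (simp add: X_def)
      have W: "real n \<le> X" "1 / real n \<le> exp (1 - y)" if "n > 0" "\<bar>ln (real n) - y\<bar> < e" for n
      proof -
        have l: "ln n \<le> y + 1" "y - 1 \<le> ln n" using e that by (auto simp: abs_less_iff)
        have "exp (ln n) \<le> exp (y + 1)" "exp (y - 1) \<le> exp (ln n)" using l by simp_all
        then have *: "real n \<le> exp (y + 1)" "exp (y - 1) \<le> real n" using \<open>n > 0\<close> by simp_all
        show "real n \<le> X" using * by (simp add: X_def)
        have "1 / real n \<le> 1 / exp (y - 1)" using * \<open>n > 0\<close> by (intro divide_left_mono) auto
        also have "\<dots> = exp (1 - y)" by (simp add: exp_minus[symmetric] divide_inverse)
        finally show "1 / real n \<le> exp (1 - y)" .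
      qed
      define V where "V = {n\<in>?P. n > 0 \<and> \<bar>ln (real n) - y\<bar> < e}"
      have finV: "finite V" by (rule finite_subset[OF _ card_prime_powers_le(2)[OF X]]) (auto simp: V_def)
      have finW: "finite {n. n > 0 \<and> \<bar>ln (real n) - y\<bar> < e}"
        by (rule finite_subset[of _ "{..nat \<lfloor>X\<rfloor>}"]) (use W(1) in \<open>auto simp: le_nat_floor\<close>)
      have "(\<Sum>n | n > 0 \<and> \<bar>ln (real n) - y\<bar> < e. mangoldt n / real n) = (\<Sum>n\<in>V. mangoldt n / real n)"
      proof (rule sum.mono_neutral_right[OF finW])
        show "\<forall>n\<in>{n. n > 0 \<and> \<bar>ln (real n) - y\<bar> < e} - V. mangoldt n / real n = 0"
        proof
          fix n assume n: "n \<in> {n. n > 0 \<and> \<bar>ln (real n) - y\<bar> < e} - V"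
          then have "real n \<le> X" "\<bar>ln (real n) - y\<bar> < \<epsilon>" using W(1) e by auto
          then have "\<not> prime n" using no by blast
          then have "\<not> primepow n" using n \<open>real n \<le> X\<close> by (auto simp: V_def)
          then show "mangoldt n / real n = 0" by (simp add: mangoldt_def)
        qed
      qed (auto simp: V_def)
      also have "\<dots> \<le> real (card V) * ((y + 1) * exp (1 - y))"
      proof (rule sum_bounded_above)
        fix n assume n: "n \<in> V"
        have "mangoldt n \<le> ln n" using n by (intro mangoldt_le) (auto simp: V_def)
        also have "\<dots> \<le> y + 1" using n e by (auto simp: V_def abs_less_iff)
        finally have "mangoldt n * (1 / real n) \<le> (y + 1) * exp (1 - y)"
          using W(2)[of n] n elim by (intro mult_mono) (auto simp: V_def)
        then show "mangoldt n / real n \<le> (y + 1) * exp (1 - y)" by simp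
      qed
      also have "real (card V) \<le> sqrt X * log 2 X"
      proof -
        have "card V \<le> card ?P" by (rule card_mono[OF card_prime_powers_le(2)[OF X]]) (auto simp: V_def)
        then have "real (card V) \<le> real (card ?P)" by simp
        then show ?thesis using card_prime_powers_le(1)[OF X] by (rule order_trans)
      qed
      also have "sqrt X * log 2 X = exp ((y + 1) / 2) * ((y + 1) / ln 2)"
      proof -
        have "sqrt X = exp ((y + 1) / 2)"
          unfolding X_def by (rule real_sqrt_unique) (auto simp: power2_eq_square simp flip: exp_add)
        then show ?thesis by (simp add: log_def X_def)
      qed
      finally have "(\<Sum>n | n > 0 \<and> \<bar>ln (real n) - y\<bar> < e. mangoldt n / real n) \<le> b y"
        using elim by (simp add: b_def mult_right_mono)
      then show False using elim by linarith
    qed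
  qed
qed

section \<open>Hamiltonian paths that pairwise create a four-cycle\<close>

definition path_edges :: "'a list \<Rightarrow> 'a set set" where
  "path_edges xs = {{xs ! i, xs ! Suc i} | i. Suc i < length xs}"

definition path_graph :: "'a list \<Rightarrow> 'a ugraph" where
  "path_graph xs = \<lparr>verts = set xs, edges = path_edges xs\<rparr>"

lemma path_edges_simps [simp]:
  "path_edges [] = {}" "path_edges [x] = {}"
  "path_edges (x # y # zs) = insert {x, y} (path_edges (y # zs))"
proof -
  show "path_edges (x # y # zs) = insert {x, y} (path_edges (y # zs))"
  proof (intro equalityI subsetI)
    fix e assume "e \<in> path_edges (x # y # zs)"
    then obtain i where "e = {(x # y # zs) ! i, (x # y # zs) ! Suc i}" "Suc i < length (x # y # zs)"
      by (auto simp: path_edges_def)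
    then show "e \<in> insert {x, y} (path_edges (y # zs))"
      by (cases i) (auto simp: path_edges_def)
  next
    fix e assume "e \<in> insert {x, y} (path_edges (y # zs))"
    then consider "e = {x, y}" | i where "e = {(y # zs) ! i, (y # zs) ! Suc i}" "Suc i < length (y # zs)"
      by (auto simp: path_edges_def)
    then show "e \<in> path_edges (x # y # zs)"
    proof cases
      case 1
      then show ?thesis unfolding path_edges_def by (intro CollectI exI[of _ 0]) auto
    next
      case (2 i)
      then show ?thesis unfolding path_edges_def by (intro CollectI exI[of _ "Suc i"]) auto
    qed
  qed
qed (auto simp: path_edges_def)

lemma path_edges_subset: "e \<in> path_edges xs \<Longrightarrow> e \<subseteq> set xs"
  by (auto simp: path_edges_def)

lemma hamiltonian_paths_complete:
  "hamiltonian_paths (complete_graph n) = path_graph ` {xs. distinct xs \<and> set xs = {..<n}}"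
proof (intro equalityI subsetI)
  fix P assume "P \<in> hamiltonian_paths (complete_graph n)"
  then show "P \<in> path_graph ` {xs. distinct xs \<and> set xs = {..<n}}"
    by (auto simp: hamiltonian_paths_def complete_graph_def path_graph_def path_edges_def)
next
  fix P assume "P \<in> path_graph ` {xs. distinct xs \<and> set xs = {..<n}}"
  then obtain xs where xs: "distinct xs" "set xs = {..<n}" and P: "P = path_graph xs" by auto
  have "{xs ! i, xs ! Suc i} \<subseteq> {..<n} \<and> card {xs ! i, xs ! Suc i} = 2" if "Suc i < length xs" for i
    using that xs nth_mem[of i xs] nth_mem[of "Suc i" xs] by (auto simp: nth_eq_iff_index_eq card_insert_if)
  then show "P \<in> hamiltonian_paths (complete_graph n)"
    using xs unfolding hamiltonian_paths_def complete_graph_def P path_graph_def path_edges_def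
    by (auto simp: ugraph.simps)
qed

lemma contains_cycle_4_iff:
  "contains_subgraph H (cycle_graph 4) \<longleftrightarrow>
     (\<exists>a b c d. distinct [a, b, c, d] \<and> {a, b, c, d} \<subseteq> verts H \<and>
        {a, b} \<in> edges H \<and> {b, c} \<in> edges H \<and> {c, d} \<in> edges H \<and> {d, a} \<in> edges H)"
proof
  assume "contains_subgraph H (cycle_graph 4)"
  then obtain f where f: "inj_on f {0::nat, 1, 2, 3}" "f ` {0, 1, 2, 3} \<subseteq> verts H"
    "\<forall>e\<in>{{0, 1}, {1, 2}, {2, 3}, {3, 0}}. f ` e \<in> edges H"
    by (auto simp: contains_subgraph_def cycle_graph_4)
  then show "\<exists>a b c d. distinct [a, b, c, d] \<and> {a, b, c, d} \<subseteq> verts H \<and>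
        {a, b} \<in> edges H \<and> {b, c} \<in> edges H \<and> {c, d} \<in> edges H \<and> {d, a} \<in> edges H"
    by (intro exI[of _ "f 0"] exI[of _ "f 1"] exI[of _ "f 2"] exI[of _ "f 3"]) (auto simp: inj_on_def)
next
  assume "\<exists>a b c d. distinct [a, b, c, d] \<and> {a, b, c, d} \<subseteq> verts H \<and>
        {a, b} \<in> edges H \<and> {b, c} \<in> edges H \<and> {c, d} \<in> edges H \<and> {d, a} \<in> edges H"
  then obtain a b c d where *: "distinct [a, b, c, d]" "{a, b, c, d} \<subseteq> verts H"
        "{a, b} \<in> edges H" "{b, c} \<in> edges H" "{c, d} \<in> edges H" "{d, a} \<in> edges H" by blast
  define f where "f = (\<lambda>i::nat. if i = 0 then a else if i = 1 then b else if i = 2 then c else d)"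
  have "f ` {0, 1} = {a, b}" "f ` {1, 2} = {b, c}" "f ` {2, 3} = {c, d}" "f ` {3, 0} = {d, a}"
    "f ` {0, 1, 2, 3} = {a, b, c, d}"
    by (auto simp: f_def)
  moreover have "inj_on f {0, 1, 2, 3}" using *(1) by (auto simp: f_def inj_on_def)
  ultimately show "contains_subgraph H (cycle_graph 4)"
    unfolding contains_subgraph_def cycle_graph_4 ugraph.simps
    by (intro exI[of _ f]) (use * in simp)
qed

text \<open>The segments \<open>p b q\<close> and \<open>p b' q\<close> close a four-cycle. The last
  clause makes the edge sets differ, so that distinct lists of a family give distinct graphs
  although a list and its reversal have the same graph.\<close>

definition C4_apart :: "'a list \<Rightarrow> 'a list \<Rightarrow> bool" where
  "C4_apart xs ys \<longleftrightarrow> (\<exists>p b q b'. distinct [p, b, q, b'] \<and> {p, b} \<in> path_edges xs \<and> {b, q} \<in> path_edges xs \<and>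
     {p, b'} \<in> path_edges ys \<and> {b', q} \<in> path_edges ys \<and> {p, b} \<notin> path_edges ys)"

text \<open>Both new edges contain \<open>b\<close>, which is absent from the old lists, so the old
  witness keeps its distinguishing edge.\<close>

lemma C4_apart_Cons:
  assumes "C4_apart (c # xs) (c # ys)" "a \<notin> set (c # xs)" "b \<notin> set (c # xs)"
  shows "C4_apart (a # b # c # xs) (a # b # c # ys)"
proof -
  obtain p r q r' where *: "distinct [p, r, q, r']" "{p, r} \<in> path_edges (c # xs)" "{r, q} \<in> path_edges (c # xs)"
     "{p, r'} \<in> path_edges (c # ys)" "{r', q} \<in> path_edges (c # ys)" "{p, r} \<notin> path_edges (c # ys)"
    using assms(1) unfolding C4_apart_def by blast
  have "{p, r} \<subseteq> set (c # xs)" using *(2) by (rule path_edges_subset)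
  then have "b \<notin> {p, r}" using assms(3) by (meson subsetD)
  then have "{p, r} \<noteq> {a, b}" "{p, r} \<noteq> {b, c}" by (metis insertCI)+
  then show ?thesis unfolding C4_apart_def path_edges_simps
    by (intro exI[of _ p] exI[of _ r] exI[of _ q] exI[of _ r'] conjI insertI2 *) (simp only: insert_iff * not_False_eq_True simp_thms)
qed

lemma C4_apart_creating:
  assumes "C4_apart xs ys" "set xs = set ys"
  shows "creating (cycle_graph 4) (path_graph xs) (path_graph ys)" "path_graph xs \<noteq> path_graph ys"
proof -
  obtain p r q r' where *: "distinct [p, r, q, r']" "{p, r} \<in> path_edges xs" "{r, q} \<in> path_edges xs"
     "{p, r'} \<in> path_edges ys" "{r', q} \<in> path_edges ys" "{p, r} \<notin> path_edges ys"
    using assms(1) unfolding C4_apart_def by blast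
  have e: "{r', p} \<in> path_edges ys" "{q, r'} \<in> path_edges ys"
    using *(4,5) by (simp_all only: insert_commute[of r' p] insert_commute[of q r'])
  have "{p, r, q, r'} \<subseteq> set xs"
    using assms(2) path_edges_subset[OF *(2)] path_edges_subset[OF *(3)] path_edges_subset[OF *(4)] by auto
  then show "creating (cycle_graph 4) (path_graph xs) (path_graph ys)"
    unfolding creating_def contains_cycle_4_iff path_graph_def
    using *(1-3) e assms(2)
    by (intro conjI exI[of _ p] exI[of _ r] exI[of _ q] exI[of _ r']) simp_all
  show "path_graph xs \<noteq> path_graph ys" using * by (auto simp: path_graph_def)
qed

text \<open>The double factorial \<open>(m - 1)!!\<close>: of \<open>m\<close> vertices still to be
  placed, one is reserved and each of the other \<open>m - 1\<close> may precede it.\<close>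

fun skip_fact :: "nat \<Rightarrow> nat" where
  "skip_fact 0 = 1"
| "skip_fact (Suc 0) = 1"
| "skip_fact (Suc (Suc m)) = Suc m * skip_fact m"

text \<open>Every second vertex is reserved before its predecessor is chosen, so that two different
  choices of that predecessor close a four-cycle.\<close>

lemma C4_apart_family:
  assumes "finite U" "a \<notin> U" "card U = m"
  shows "\<exists>S. finite S \<and> card S = skip_fact m \<and>
    (\<forall>xs\<in>S. distinct xs \<and> set xs = insert a U \<and> (\<exists>zs. xs = a # zs)) \<and>
    (\<forall>xs\<in>S. \<forall>ys\<in>S. xs \<noteq> ys \<longrightarrow> C4_apart xs ys)"
  using assms
proof (induction m arbitrary: a U rule: skip_fact.induct)
  case 1
  then show ?case by (intro exI[of _ "{[a]}"]) auto
next
  case 2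
  then obtain c where "U = {c}" by (auto simp: card_1_singleton_iff)
  then show ?case using 2 by (intro exI[of _ "{[a, c]}"]) auto
next
  case (3 m)
  then have "U \<noteq> {}" by auto
  \<comment> \<open>The reserved vertex is fixed before and independently of \<open>b\<close>: two
    choices \<open>b\<close> and \<open>b'\<close> then close the cycle
    \<open>a b c b'\<close>.\<close>
  then obtain c where c: "c \<in> U" by blast
  have "\<exists>S. finite S \<and> card S = skip_fact m \<and>
    (\<forall>xs\<in>S. distinct xs \<and> set xs = insert c (U - {b, c}) \<and> (\<exists>zs. xs = c # zs)) \<and>
    (\<forall>xs\<in>S. \<forall>ys\<in>S. xs \<noteq> ys \<longrightarrow> C4_apart xs ys)" if b: "b \<in> U - {c}" for b
    by (rule "3.IH") (use 3 b c in \<open>auto simp: card_Diff_subset\<close>)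
  then have "\<forall>b\<in>U - {c}. \<exists>S. finite S \<and> card S = skip_fact m \<and>
    (\<forall>xs\<in>S. distinct xs \<and> set xs = insert c (U - {b, c}) \<and> (\<exists>zs. xs = c # zs)) \<and>
    (\<forall>xs\<in>S. \<forall>ys\<in>S. xs \<noteq> ys \<longrightarrow> C4_apart xs ys)" by (rule ballI)
  from bchoice[OF this] obtain S where S: "\<forall>b\<in>U - {c}. finite (S b) \<and> card (S b) = skip_fact m \<and>
    (\<forall>xs\<in>S b. distinct xs \<and> set xs = insert c (U - {b, c}) \<and> (\<exists>zs. xs = c # zs)) \<and>
    (\<forall>xs\<in>S b. \<forall>ys\<in>S b. xs \<noteq> ys \<longrightarrow> C4_apart xs ys)" by (rule exE)
  have S1: "finite (S b)" "card (S b) = skip_fact m" if "b \<in> U - {c}" for b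
    by (rule conjunct1[OF bspec[OF S that]], rule conjunct1[OF conjunct2[OF bspec[OF S that]]])
  have S2: "distinct xs \<and> set xs = insert c (U - {b, c}) \<and> (\<exists>zs. xs = c # zs)" if "b \<in> U - {c}" "xs \<in> S b" for b xs
    by (rule bspec[OF conjunct1[OF conjunct2[OF conjunct2[OF bspec[OF S that(1)]]]] that(2)])
  have S3: "C4_apart xs ys" if "b \<in> U - {c}" "xs \<in> S b" "ys \<in> S b" "xs \<noteq> ys" for b xs ys
    using conjunct2[OF conjunct2[OF conjunct2[OF bspec[OF S that(1)]]]] that(2-4) by simp
  define T where "T = (\<lambda>(b, xs). a # b # xs) ` Sigma (U - {c}) S"
  have inj: "inj_on (\<lambda>(b, xs). a # b # xs) (Sigma (U - {c}) S)" by (auto simp: inj_on_def)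
  have finT: "finite T" unfolding T_def using S1 3 by (intro finite_imageI finite_SigmaI) auto
  have "card T = card (Sigma (U - {c}) S)" unfolding T_def by (rule card_image[OF inj])
  also have "\<dots> = (\<Sum>b\<in>U - {c}. card (S b))" using S1 3 by (intro card_SigmaI) auto
  also have "\<dots> = (\<Sum>b\<in>U - {c}. skip_fact m)" using S1 by (intro sum.cong) auto
  also have "\<dots> = skip_fact (Suc (Suc m))" using 3 c by simp
  finally have cardT: "card T = skip_fact (Suc (Suc m))" .
  have Tprop: "\<exists>b zs. xs = a # b # c # zs \<and> b \<in> U - {c} \<and> c # zs \<in> S b \<and> distinct (c # zs) \<and> set (c # zs) = insert c (U - {b, c})"
    if xs: "xs \<in> T" for xs
  proof -
    obtain b ys where b: "xs = a # b # ys" "b \<in> U - {c}" "ys \<in> S b" using xs unfolding T_def by auto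
    obtain zs where "ys = c # zs" using S2[OF b(2,3)] by blast
    then show ?thesis using b S2[OF b(2,3)] by (intro exI[of _ b] exI[of _ zs]) simp
  qed
  have "C4_apart xs ys" if xs: "xs \<in> T" and ys: "ys \<in> T" and ne: "xs \<noteq> ys" for xs ys
  proof -
    obtain b zs where b: "xs = a # b # c # zs" "b \<in> U - {c}" "c # zs \<in> S b" "set (c # zs) = insert c (U - {b, c})"
      using Tprop[OF xs] by blast
    obtain b' zs' where b': "ys = a # b' # c # zs'" "b' \<in> U - {c}" "c # zs' \<in> S b'" "set (c # zs') = insert c (U - {b', c})"
      using Tprop[OF ys] by blast
    show ?thesis
    unfolding b(1) b'(1)
    proof (cases "b = b'")
      case True
      then have "c # zs \<noteq> c # zs'" using ne b b' by auto
      then have "C4_apart (c # zs) (c # zs')" using S3[OF b(2) b(3)] b'(3) True by simp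
      moreover have "a \<notin> set (c # zs)" "b \<notin> set (c # zs)" using b(2,4) 3(3) c by auto
      ultimately show "C4_apart (a # b # c # zs) (a # b' # c # zs')" unfolding True[symmetric] by (rule C4_apart_Cons)
    next
      case False
      have "{a, b} \<noteq> {b', c}" using 3(3) b(2) b'(2) c by (auto simp: doubleton_eq_iff)
      moreover have "{a, b} \<noteq> {a, b'}" using False by (auto simp: doubleton_eq_iff)
      moreover have "{a, b} \<notin> path_edges (c # zs')"
      proof
        assume "{a, b} \<in> path_edges (c # zs')"
        then have "a \<in> set (c # zs')" using path_edges_subset by blast
        then show False using b'(4) 3(3) c by auto
      qed
      ultimately show "C4_apart (a # b # c # zs) (a # b' # c # zs')" unfolding C4_apart_def
        by (intro exI[of _ a] exI[of _ b] exI[of _ c] exI[of _ b']) (use b(2) b'(2) c 3(3) False in auto)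
    qed
  qed
  moreover have "distinct xs \<and> set xs = insert a U \<and> (\<exists>zs. xs = a # zs)" if xs: "xs \<in> T" for xs
  proof -
    obtain b zs where b: "xs = a # b # c # zs" "b \<in> U - {c}" "distinct (c # zs)" "set (c # zs) = insert c (U - {b, c})"
      using Tprop[OF xs] by blast
    have "a \<notin> set (c # zs)" "b \<notin> set (c # zs)" "a \<noteq> b" using b(2,4) 3(3) c by auto
    moreover have "set xs = insert a U" unfolding b(1) using b(2,4) c by auto
    ultimately show ?thesis using b(1,3) by auto
  qed
  ultimately show ?case using finT cardT by (intro exI[of _ T]) blast
qed

lemma skip_fact_le_H_num:
  assumes "n \<ge> 1"
  shows "skip_fact (n - 1) \<le> H_num n (cycle_graph 4)"
proof -
  obtain S where S: "finite S" "card S = skip_fact (n - 1)"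
    "\<forall>xs\<in>S. distinct xs \<and> set xs = insert 0 {1..<n} \<and> (\<exists>zs. xs = 0 # zs)"
    "\<forall>xs\<in>S. \<forall>ys\<in>S. xs \<noteq> ys \<longrightarrow> C4_apart xs ys"
    using C4_apart_family[of "{1..<n}" 0 "n - 1"] by auto
  have V: "insert 0 {1..<n} = {..<n}" using assms by auto
  define F where "F = path_graph ` S"
  have "inj_on path_graph S" using S C4_apart_creating(2) by (metis inj_onI)
  then have "card F = skip_fact (n - 1)" unfolding F_def using S by (simp add: card_image)
  moreover have "F \<in> creating_families n (cycle_graph 4)"
    unfolding creating_families_def
  proof (intro CollectI conjI)
    show "F \<subseteq> hamiltonian_paths (complete_graph n)"
      unfolding hamiltonian_paths_complete F_def using S V by auto
    show "pairwise (creating (cycle_graph 4)) F"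
      unfolding F_def pairwise_def
    proof safe
      fix xs ys assume *: "xs \<in> S" "ys \<in> S" "path_graph xs \<noteq> path_graph ys"
      then have "C4_apart xs ys" using S(4) by metis
      moreover have "set xs = set ys" using S(3) * by simp
      ultimately show "creating (cycle_graph 4) (path_graph xs) (path_graph ys)" by (rule C4_apart_creating)
    qed
  qed
  ultimately show ?thesis
    unfolding H_num_def using finite_creating_families by (metis Max_ge finite_imageI imageI)
qed

text \<open>The recursion advances by two, and \<open>(1 + 2 / x)^(x / 2) \<le> e\<close> is what
  the factor \<open>exp (- n / 2)\<close> absorbs per step. Dividing by \<open>n\<close> compensates
  for the new factor being \<open>n - 2\<close>, and costs \<open>1\<close> in the exponent of
  \<open>n\<close>.\<close>

lemma skip_fact_ge:
  assumes "n \<ge> 1"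
  shows "real n powr (real n / 2) * exp (- real n / 2) / real n \<le> real (skip_fact (n - 1))"
  using assms
proof (induction n rule: less_induct)
  case (less n)
  show ?case
  proof (cases "n \<le> 2")
    case True
    then consider "n = 1" | "n = 2" using less.prems by linarith
    then show ?thesis by cases auto
  next
    case False
    define m where "m = n - 2"
    have m: "m \<ge> 1" "n = Suc (Suc m)" using False by (auto simp: m_def)
    have IH: "real m powr (real m / 2) * exp (- real m / 2) / real m \<le> real (skip_fact (m - 1))"
      by (rule less.IH) (use m in auto)
    define x where "x = real m"
    have x: "x > 0" using m by (simp add: x_def)
    have "(x + 2) powr (x / 2) \<le> x powr (x / 2) * exp 1"
    proof -
      have "(x + 2) powr (x / 2) = (x * (1 + 2 / x)) powr (x / 2)" using x by (simp add: distrib_left)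
      also have "\<dots> = x powr (x / 2) * (1 + 2 / x) powr (x / 2)" by (rule powr_mult)
      also have "(1 + 2 / x) powr (x / 2) \<le> exp (2 / x) powr (x / 2)"
        using x by (intro powr_mono2) (auto intro: exp_ge_add_one_self)
      also have "exp (2 / x) powr (x / 2) = exp 1" using x by (simp add: powr_def)
      finally show ?thesis by (simp add: mult_left_mono)
    qed
    then have "(x + 2) powr (x / 2) * exp (- (x + 2) / 2) \<le> x powr (x / 2) * exp 1 * exp (- (x + 2) / 2)"
      by (intro mult_right_mono) auto
    also have "\<dots> = x powr (x / 2) * exp (- x / 2)"
    proof -
      have "1 + - (x + 2) / 2 = - x / 2" by (simp add: field_simps)
      then show ?thesis by (simp only: mult.assoc exp_add[symmetric])
    qed
    also have "\<dots> \<le> x * real (skip_fact (m - 1))"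
      using IH x unfolding x_def[symmetric] by (simp add: pos_divide_le_eq mult.commute)
    also have "x * real (skip_fact (m - 1)) = real (skip_fact (n - 1))"
      using m by (cases m) (auto simp: x_def algebra_simps)
    finally have "(x + 2) powr (x / 2) * exp (- (x + 2) / 2) \<le> real (skip_fact (n - 1))" .
    moreover have "(x + 2) powr ((x + 2) / 2) = (x + 2) powr (x / 2) * (x + 2)"
      using x by (simp add: add_divide_distrib powr_add)
    moreover have "real n = x + 2" using m by (simp add: x_def)
    ultimately show ?thesis using x by simp
  qed
qed

text \<open>The second-order term of the exponent is \<open>exp (n / 2)\<close> written as a power
  of \<open>n\<close>, namely \<open>n powr (n / (2 ln n))\<close>.\<close>

lemma H_num_lower_bound:
  assumes "n \<ge> 2"
  shows "real n powr (1/2 * real n - 1/2 * (real n / ln (real n)) - 1) \<le> real (H_num n (cycle_graph 4))"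
proof -
  have n: "real n > 1" using assms by simp
  have "real n powr (1/2 * real n - 1/2 * (real n / ln (real n)) - 1)
     = real n powr (real n / 2) * exp (- real n / 2) / real n"
  proof -
    have "ln (real n) > 0" using n by simp
    then have e: "1/2 * (real n / ln (real n)) * ln (real n) = real n / 2" by simp
    have "real n powr (1/2 * (real n / ln (real n))) = exp (real n / 2)"
      unfolding powr_def e using n by simp
    moreover have "real n powr (1/2 * real n - 1/2 * (real n / ln (real n)) - 1)
       = real n powr (1/2 * real n) / real n powr (1/2 * (real n / ln (real n))) / real n powr 1"
      by (simp only: powr_diff)
    ultimately have "real n powr (1/2 * real n - 1/2 * (real n / ln (real n)) - 1)
       = real n powr (1/2 * real n) / exp (real n / 2) / real n powr 1" by (simp only:)
    also have "\<dots> = real n powr (real n / 2) / exp (real n / 2) / real n" using n by simp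
    also have "\<dots> = real n powr (real n / 2) * exp (- (real n / 2)) / real n"
      by (simp add: exp_minus field_simps)
    finally show ?thesis by (simp only: minus_divide_left)
  qed
  also have "\<dots> \<le> real (skip_fact (n - 1))" using assms by (intro skip_fact_ge) auto
  also have "\<dots> \<le> real (H_num n (cycle_graph 4))" using skip_fact_le_H_num[of n] assms by simp
  finally show ?thesis .
qed

section \<open>Long paths in dense graphs without four-cycles\<close>

locale c4_free_regular =
  fixes V :: "'a set" and adj :: "'a \<Rightarrow> 'a \<Rightarrow> bool" and p :: nat
  assumes finV: "finite V" and cardV: "card V = p\<^sup>2" and p_pos: "p > 0"
    and sym: "adj u v \<Longrightarrow> adj v u"
    and reg: "v \<in> V \<Longrightarrow> card {u\<in>V. adj v u} = p"
    and codeg: "u \<in> V \<Longrightarrow> v \<in> V \<Longrightarrow> u \<noteq> v \<Longrightarrow> card {w\<in>V. adj u w \<and> adj v w} \<le> 1"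
begin

definition deg :: "'a set \<Rightarrow> 'a \<Rightarrow> nat" where
  "deg W v = card {w\<in>W. adj v w}"

lemma deg_mono: "W \<subseteq> W' \<Longrightarrow> finite W' \<Longrightarrow> deg W v \<le> deg W' v"
  unfolding deg_def by (intro card_mono) auto

lemma adj_commute: "adj u v \<longleftrightarrow> adj v u"
  using sym by blast

lemma deg_sum:
  assumes "W \<subseteq> V"
  shows "(\<Sum>v\<in>V. real (deg W v)) = real p * real (card W)"
proof -
  have finW: "finite W" using assms finV by (rule finite_subset)
  have "(\<Sum>v\<in>V. deg W v) = (\<Sum>w\<in>W. card {v\<in>V. adj v w})"
    unfolding deg_def by (rule sum_multicount_gen[OF finV finW]) auto
  also have "\<dots> = (\<Sum>w\<in>W. p)"
    by (rule sum.cong) (use assms reg adj_commute in auto)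
  finally show ?thesis by (simp add: mult.commute flip: of_nat_sum)
qed

text \<open>Ordered pairs from \<open>W\<close> are counted by common neighbours: a diagonal pair
  has \<open>p\<close>, any other pair at most one.\<close>

lemma deg_sq_sum:
  assumes "W \<subseteq> V"
  shows "(\<Sum>v\<in>V. (real (deg W v))\<^sup>2) \<le> real p * real (card W) + (real (card W))\<^sup>2"
proof -
  have finW: "finite W" using assms finV by (rule finite_subset)
  have "(\<Sum>v\<in>V. (deg W v)\<^sup>2) = (\<Sum>v\<in>V. card {x\<in>W \<times> W. adj v (fst x) \<and> adj v (snd x)})"
  proof (rule sum.cong)
    fix v
    have "{x\<in>W \<times> W. adj v (fst x) \<and> adj v (snd x)} = {w\<in>W. adj v w} \<times> {w\<in>W. adj v w}" by auto
    then show "(deg W v)\<^sup>2 = card {x\<in>W \<times> W. adj v (fst x) \<and> adj v (snd x)}"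
      by (simp add: deg_def card_cartesian_product power2_eq_square)
  qed auto
  also have "\<dots> = (\<Sum>x\<in>W \<times> W. card {v\<in>V. adj v (fst x) \<and> adj v (snd x)})"
    by (rule sum_multicount_gen[OF finV]) (use finW in auto)
  also have "\<dots> \<le> (\<Sum>x\<in>W \<times> W. if fst x = snd x then p else 1)"
  proof (rule sum_mono)
    fix x assume x: "x \<in> W \<times> W"
    have "{v\<in>V. adj v (fst x) \<and> adj v (snd x)} = {v\<in>V. adj (fst x) v \<and> adj (snd x) v}"
      using adj_commute by auto
    moreover have "fst x \<in> V" "snd x \<in> V" using x assms by auto
    ultimately show "card {v\<in>V. adj v (fst x) \<and> adj v (snd x)} \<le> (if fst x = snd x then p else 1)"
      using reg[of "snd x"] codeg[of "fst x" "snd x"] by simp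
  qed
  also have "\<dots> = (\<Sum>u\<in>W. \<Sum>w\<in>W. if u = w then p else 1)"
    by (simp add: sum.cartesian_product case_prod_unfold)
  also have "\<dots> \<le> (\<Sum>u\<in>W. p + card W)"
  proof (rule sum_mono)
    fix u assume u: "u \<in> W"
    have "(\<Sum>w\<in>W. if u = w then p else 1) \<le> (\<Sum>w\<in>W. (if u = w then p else 0) + 1)"
      by (intro sum_mono) auto
    also have "\<dots> = p + card W" unfolding sum.distrib using u finW by simp
    finally show "(\<Sum>w\<in>W. if u = w then p else 1) \<le> p + card W" .
  qed
  also have "\<dots> = p * card W + (card W)\<^sup>2" by (simp add: power2_eq_square algebra_simps)
  finally have "real (\<Sum>v\<in>V. (deg W v)\<^sup>2) \<le> real (p * card W + (card W)\<^sup>2)" by (simp only: of_nat_le_iff)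
  then show ?thesis by simp
qed

text \<open>By regularity the mean of \<open>deg W\<close> over \<open>V\<close> is exactly
  \<open>card W / p\<close>, and the codegree bound makes the second moment nearly the square of the
  mean. This is the pseudorandomness on which the greedy count rests.\<close>

lemma deg_variance:
  assumes "W \<subseteq> V"
  shows "(\<Sum>v\<in>V. (real (deg W v) - real (card W) / real p)\<^sup>2) \<le> real p * real (card W)"
proof -
  define c where "c = real (card W)"
  have "(\<Sum>v\<in>V. (real (deg W v) - c / p)\<^sup>2)
     = (\<Sum>v\<in>V. (real (deg W v))\<^sup>2 - 2 * (c / p) * real (deg W v) + (c / p)\<^sup>2)"
    by (intro sum.cong refl) (simp add: power2_eq_square algebra_simps)
  also have "\<dots> = (\<Sum>v\<in>V. (real (deg W v))\<^sup>2) - 2 * (c / p) * (\<Sum>v\<in>V. real (deg W v)) + real (card V) * (c / p)\<^sup>2"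
    by (simp add: sum.distrib sum_subtractf sum_distrib_left)
  also have "\<dots> = (\<Sum>v\<in>V. (real (deg W v))\<^sup>2) - c\<^sup>2"
    unfolding deg_sum[OF assms] cardV c_def[symmetric] using p_pos by (simp add: power2_eq_square field_simps)
  also have "\<dots> \<le> p * c" using deg_sq_sum[OF assms] by (simp add: c_def)
  finally show ?thesis by (simp add: c_def)
qed

lemma deg_deviation:
  fixes s :: real
  assumes W: "W \<subseteq> V" and X: "X \<subseteq> V" and s: "s \<ge> 0" and d: "\<And>v. v \<in> X \<Longrightarrow> \<bar>real (deg W v) - card W / p\<bar> \<ge> s"
  shows "real (card X) * s\<^sup>2 \<le> real p * real (card W)"
proof -
  have "real (card X) * s\<^sup>2 \<le> (\<Sum>v\<in>X. (real (deg W v) - card W / p)\<^sup>2)"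
  proof (rule sum_bounded_below)
    fix v assume "v \<in> X"
    from d[OF this] show "s\<^sup>2 \<le> (real (deg W v) - card W / p)\<^sup>2"
      using s by (metis abs_of_nonneg abs_le_square_iff)
  qed
  also have "\<dots> \<le> (\<Sum>v\<in>V. (real (deg W v) - card W / p)\<^sup>2)"
    using X finV by (intro sum_mono2) auto
  also have "\<dots> \<le> real p * real (card W)" by (rule deg_variance[OF W])
  finally show ?thesis .
qed

text \<open>The factor \<open>1 - \<epsilon> / 2\<close> lies between the
  \<open>1 - \<epsilon>\<close> required of the end of a path and the
  \<open>1 - \<epsilon> / 4\<close> used for exceptional vertices below. The gaps absorb the single
  neighbour that may be lost when a vertex is removed from \<open>U\<close>.\<close>

definition low :: "real \<Rightarrow> 'a set \<Rightarrow> 'a set" where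
  "low \<epsilon> U = {b\<in>V. real (deg U b) < (1 - \<epsilon> / 2) * card U / p}"

text \<open>The second condition keeps the greedy path extendable: most neighbours of \<open>v\<close> have in turn
  about the expected number of unused neighbours.\<close>

definition good :: "real \<Rightarrow> 'a set \<Rightarrow> 'a \<Rightarrow> bool" where
  "good \<epsilon> U v \<longleftrightarrow> real (deg U v) \<ge> (1 - \<epsilon>) * card U / p \<and> real (deg (low \<epsilon> U) v) \<le> \<epsilon> * card U / p"

text \<open>One variance estimate is not enough: for \<open>k\<close> of order \<open>p^2\<close> it
  bounds the vertices of small degree only by a multiple of \<open>p\<close>, which could swallow a
  whole neighbourhood. A second estimate, applied to that exceptional set, shows that all but
  boundedly many vertices see few of its members. Of the \<open>(1 - \<epsilon>) k / p\<close>
  neighbours of \<open>v\<close>, at most \<open>\<epsilon> k / p\<close> are lost to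
  \<open>low\<close> and as many to \<open>D\<close>.\<close>

lemma good_extensions:
  assumes U: "U \<subseteq> V" and v: "v \<in> V" "good \<epsilon> U v" and \<epsilon>: "0 < \<epsilon>" "\<epsilon> < 1"
    and k1: "\<epsilon> * real (card U) \<ge> 4 * real p" and k2: "\<epsilon>^3 * (card U)^2 \<ge> 64 * real p^3"
    and k4: "\<epsilon>^5 * (card U)^4 \<ge> 256 * real p^7"
  shows "real (card {u\<in>U. adj v u \<and> good \<epsilon> (U - {u}) u}) \<ge> (1 - 3 * \<epsilon>) * card U / p"
proof -
  define k where "k = real (card U)"
  have finU: "finite U" using U finV by (rule finite_subset)
  have p: "real p \<ge> 1" using p_pos by simp
  have k: "\<epsilon> * k \<ge> 4 * p" "\<epsilon>^3 * k^2 \<ge> 64 * real p^3" "\<epsilon>^5 * k^4 \<ge> 256 * real p^7"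
    using k1 k2 k4 by (simp_all add: k_def)
  have kge: "k \<ge> 4"
  proof (rule ccontr)
    assume "\<not> k \<ge> 4"
    moreover have "\<epsilon> * k \<le> 1 * k" using \<epsilon> by (intro mult_right_mono) (auto simp: k_def)
    ultimately show False using k(1) p by linarith
  qed
  \<comment> \<open>\<open>P\<close> contains \<open>low \<epsilon> (U - {u})\<close> for every
    \<open>u\<close>, so one exceptional set serves all candidate extensions; \<open>D\<close>
    collects the vertices that see too much of it.\<close>
  define P where "P = {b\<in>V. real (deg U b) < (1 - \<epsilon> / 4) * k / p}"
  define D where "D = {u\<in>V. real (deg P u) > \<epsilon> * (k - 1) / p}"
  have PV: "P \<subseteq> V" and DV: "D \<subseteq> V" by (auto simp: P_def D_def)
  \<comment> \<open>A quarter of \<open>\<epsilon>\<close> times the mean degree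
    \<open>k / p\<close>. Hypothesis \<open>k1\<close> says exactly that \<open>s \<ge> 1\<close>,
    so a change of degree by one is covered.\<close>
  define s where "s = \<epsilon> * k / (4 * p)"
  have s1: "s \<ge> 1" using k(1) p by (simp add: s_def field_simps)
  have "real (card P) * s\<^sup>2 \<le> p * k"
    unfolding k_def
  proof (rule deg_deviation[OF U PV])
    fix b assume "b \<in> P"
    then have "real (deg U b) < (1 - \<epsilon> / 4) * k / p" by (simp add: P_def)
    also have "(1 - \<epsilon> / 4) * k / p = k / p - s" using p by (simp add: s_def field_simps)
    finally show "s \<le> \<bar>real (deg U b) - card U / p\<bar>" by (simp add: k_def)
  qed (use s1 in auto)
  then have "real (card P) * (\<epsilon>\<^sup>2 * k) * k \<le> 16 * real p ^ 3 * k"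
    using p by (simp add: s_def power_divide power_mult_distrib field_simps power2_eq_square power3_eq_cube)
  then have cP: "real (card P) * (\<epsilon>\<^sup>2 * k) \<le> 16 * real p ^ 3" using kge by simp
  have P4: "real (card P) \<le> \<epsilon> * k / 4"
  proof -
    have "real (card P) * (\<epsilon>\<^sup>2 * k) \<le> (\<epsilon> * k / 4) * (\<epsilon>\<^sup>2 * k)"
      using cP k(2) by (simp add: power2_eq_square power3_eq_cube mult_ac)
    then show ?thesis using \<epsilon> kge by (simp add: mult_le_cancel_right)
  qed
  have "real (card D) * s\<^sup>2 \<le> real p * real (card P)"
  proof (rule deg_deviation[OF PV DV])
    fix u assume "u \<in> D"
    then have "real (deg P u) > \<epsilon> * (k - 1) / p" by (simp add: D_def)
    moreover have "\<epsilon> * (k - 1) / p \<ge> s + card P / p"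
    proof -
      have "\<epsilon> * (k / 2) \<le> \<epsilon> * (k - 1)" using \<epsilon> kge by (intro mult_left_mono) auto
      then have "\<epsilon> * k / 4 + real (card P) \<le> \<epsilon> * (k - 1)" using P4 by simp
      then have "(\<epsilon> * k / 4 + real (card P)) / p \<le> \<epsilon> * (k - 1) / p" using p by (intro divide_right_mono) auto
      then show ?thesis by (simp add: s_def add_divide_distrib)
    qed
    ultimately show "s \<le> \<bar>real (deg P u) - card P / p\<bar>" by linarith
  qed (use s1 in auto)
  then have cD1: "real (card D) * (\<epsilon>\<^sup>2 * k\<^sup>2) \<le> 16 * real p ^ 3 * card P"
    using p by (simp add: s_def power_divide power_mult_distrib field_simps power2_eq_square power3_eq_cube)
  \<comment> \<open>The two estimates combine to
    \<open>card D \<le> 256 p^6 / (\<epsilon>^4 k^3)\<close>. Comparing this with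
    \<open>\<epsilon> k / p\<close> is the origin of hypothesis \<open>k4\<close>.\<close>
  have cD: "real (card D) \<le> \<epsilon> * k / p"
  proof -
    have "real (card D) * (\<epsilon>\<^sup>2 * k\<^sup>2) * (\<epsilon>\<^sup>2 * k) \<le> 16 * real p ^ 3 * card P * (\<epsilon>\<^sup>2 * k)"
      using cD1 kge by (intro mult_right_mono) auto
    also have "\<dots> = 16 * real p ^ 3 * (card P * (\<epsilon>\<^sup>2 * k))" by simp
    also have "\<dots> \<le> 16 * real p ^ 3 * (16 * real p ^ 3)" using cP by (intro mult_left_mono) auto
    finally have "real (card D) * (\<epsilon>^4 * k^3) * p \<le> 256 * real p ^ 6 * p"
      using p by (intro mult_right_mono) (simp_all add: power_numeral_reduce mult_ac)
    also have "\<dots> \<le> \<epsilon> * k * (\<epsilon>^4 * k^3)" using k(3) by (simp add: power_numeral_reduce mult_ac)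
    finally have "(real (card D) * p) * (\<epsilon>^4 * k^3) \<le> \<epsilon> * k * (\<epsilon>^4 * k^3)" by (simp add: mult_ac)
    then have "real (card D) * p \<le> \<epsilon> * k" using \<epsilon> kge by (simp add: mult_le_cancel_right)
    then show ?thesis using p by (simp add: pos_le_divide_eq)
  qed
  define N where "N = {u\<in>U. adj v u}"
  define E where "E = {u\<in>U. adj v u \<and> good \<epsilon> (U - {u}) u}"
  have fin: "finite (low \<epsilon> U)" "finite D" "finite E" using finV finU by (auto simp: low_def D_def E_def)
  have "N \<subseteq> E \<union> ({w\<in>low \<epsilon> U. adj v w} \<union> D)"
  proof
    fix u assume u: "u \<in> N"
    then have uU: "u \<in> U" "adj v u" "u \<in> V" using U by (auto simp: N_def)
    have k': "real (card (U - {u})) = k - 1" using uU finU kge by (simp add: k_def of_nat_diff card_gt_0_iff Suc_le_eq) 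
    have dd: "real (deg U b) - 1 \<le> real (deg (U - {u}) b)" for b
    proof -
      have "{w\<in>U. adj b w} \<subseteq> insert u {w\<in>U - {u}. adj b w}" by auto
      then have "card {w\<in>U. adj b w} \<le> card (insert u {w\<in>U - {u}. adj b w})" using finU by (intro card_mono) auto
      also have "\<dots> \<le> Suc (card {w\<in>U - {u}. adj b w})" by (rule card_insert_le_m1) auto
      finally show ?thesis by (simp add: deg_def)
    qed
    show "u \<in> E \<union> ({w\<in>low \<epsilon> U. adj v w} \<union> D)"
    proof (cases "u \<in> low \<epsilon> U \<or> u \<in> D")
      case False
      then have l: "real (deg U u) \<ge> (1 - \<epsilon> / 2) * k / p" and nD: "real (deg P u) \<le> \<epsilon> * (k - 1) / p"
        using uU by (auto simp: low_def D_def k_def)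
      have "(1 - \<epsilon>) * (k - 1) / p \<le> (1 - \<epsilon>) * k / p" using \<epsilon> p by (intro divide_right_mono mult_left_mono) auto
      also have "\<dots> \<le> (1 - \<epsilon> / 2) * k / p - 1" using k(1) p by (simp add: field_simps)
      also have "\<dots> \<le> real (deg (U - {u}) u)" using l dd[of u] by linarith
      finally have g1: "(1 - \<epsilon>) * (k - 1) / p \<le> real (deg (U - {u}) u)" .
      have "low \<epsilon> (U - {u}) \<subseteq> P"
      proof
        fix b assume b: "b \<in> low \<epsilon> (U - {u})"
        then have "real (deg U b) < (1 - \<epsilon> / 2) * (k - 1) / p + 1" using dd[of b] unfolding low_def k' by auto
        also have "(1 - \<epsilon> / 2) * (k - 1) / p \<le> (1 - \<epsilon> / 2) * k / p" using \<epsilon> p by (intro divide_right_mono mult_left_mono) auto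
        also have "(1 - \<epsilon> / 2) * k / p + 1 \<le> (1 - \<epsilon> / 4) * k / p" using k(1) p by (simp add: field_simps)
        finally show "b \<in> P" using b by (simp add: P_def low_def)
      qed
      then have "deg (low \<epsilon> (U - {u})) u \<le> deg P u" using finite_subset[OF PV finV] by (rule deg_mono)
      then have "real (deg (low \<epsilon> (U - {u})) u) \<le> \<epsilon> * (k - 1) / p" using nD by linarith
      with g1 have "good \<epsilon> (U - {u}) u" unfolding good_def k' by (rule conjI)
      then show ?thesis using uU by (simp add: E_def)
    qed (use uU in auto)
  qed
  then have "card N \<le> card (E \<union> ({w\<in>low \<epsilon> U. adj v w} \<union> D))" using fin by (intro card_mono) auto
  also have "\<dots> \<le> card E + card ({w\<in>low \<epsilon> U. adj v w} \<union> D)" by (rule card_Un_le)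
  also have "card ({w\<in>low \<epsilon> U. adj v w} \<union> D) \<le> card {w\<in>low \<epsilon> U. adj v w} + card D" by (rule card_Un_le)
  finally have "real (card N) \<le> real (card E) + real (deg (low \<epsilon> U) v) + real (card D)" by (simp add: deg_def)
  moreover have "real (card N) \<ge> (1 - \<epsilon>) * k / p" "real (deg (low \<epsilon> U) v) \<le> \<epsilon> * k / p"
    using v(2) by (simp_all add: good_def N_def deg_def k_def)
  ultimately have "real (card E) \<ge> (1 - \<epsilon>) * k / p - \<epsilon> * k / p - \<epsilon> * k / p" using cD by linarith
  also have "(1 - \<epsilon>) * k / p - \<epsilon> * k / p - \<epsilon> * k / p = (1 - 3 * \<epsilon>) * k / p"
    unfolding diff_divide_distrib[symmetric] by (simp add: algebra_simps)
  finally show ?thesis by (simp add: E_def k_def)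
qed

text \<open>Removing \<open>v\<close> leaves every degree at least \<open>p - 1\<close>, and
  \<open>\<epsilon> * p \<ge> 2\<close> places this above the threshold of \<open>low\<close>, which
  is therefore empty.\<close>

lemma good_start:
  fixes \<epsilon> :: real
  assumes v: "v \<in> V" and \<epsilon>: "0 < \<epsilon>" "\<epsilon> < 1" and p: "\<epsilon> * p \<ge> 2"
  shows "good \<epsilon> (V - {v}) v"
proof -
  have p1: "real p \<ge> 1" using p_pos by simp
  have c: "real (card (V - {v})) = (real p)\<^sup>2 - 1" using v finV cardV p_pos by (simp add: of_nat_diff)
  have d: "real (deg (V - {v}) b) \<ge> real p - 1" if "b \<in> V" for b
  proof -
    have "{w\<in>V. adj b w} \<subseteq> insert v {w\<in>V - {v}. adj b w}" by auto
    then have "card {w\<in>V. adj b w} \<le> card (insert v {w\<in>V - {v}. adj b w})" using finV by (intro card_mono) auto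
    also have "\<dots> \<le> Suc (card {w\<in>V - {v}. adj b w})" by (rule card_insert_le_m1) auto
    finally show ?thesis using reg[OF that] by (simp add: deg_def)
  qed
  have le: "(1 - \<epsilon> / 2) * ((real p)\<^sup>2 - 1) / p \<le> real p - 1"
  proof -
    have "(1 - \<epsilon> / 2) * ((real p)\<^sup>2 - 1) / p \<le> (1 - \<epsilon> / 2) * (real p)\<^sup>2 / p"
      using \<epsilon> by (intro divide_right_mono mult_left_mono) auto
    also have "\<dots> = real p - \<epsilon> * p / 2" using p1 by (simp add: power2_eq_square field_simps)
    finally show ?thesis using p by linarith
  qed
  have "low \<epsilon> (V - {v}) = {}" using d le unfolding low_def c by fastforce
  moreover have "(1 - \<epsilon>) * ((real p)\<^sup>2 - 1) / p \<le> (1 - \<epsilon> / 2) * ((real p)\<^sup>2 - 1) / p"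
    using \<epsilon> p1 by (intro divide_right_mono mult_right_mono) auto
  then have "(1 - \<epsilon>) * ((real p)\<^sup>2 - 1) / p \<le> real (deg (V - {v}) v)" using le d[OF v] by linarith
  ultimately show ?thesis using \<epsilon> p1 by (simp add: good_def c deg_def)
qed

definition good_paths :: "real \<Rightarrow> nat \<Rightarrow> 'a list set" where
  "good_paths \<epsilon> j = {xs. length xs = j \<and> distinct xs \<and> set xs \<subseteq> V \<and> successively adj xs \<and> good \<epsilon> (V - set xs) (hd xs)}"

lemma finite_good_paths: "finite (good_paths \<epsilon> j)"
  by (rule finite_subset[OF _ finite_lists_length_eq[OF finV, of j]]) (auto simp: good_paths_def)

lemma card_good_paths:
  fixes \<epsilon> :: real
  assumes \<epsilon>: "0 < \<epsilon>" "\<epsilon> < 1/3" and p: "\<epsilon> * p \<ge> 2"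
    and K: "\<And>k. k \<ge> K \<Longrightarrow> \<epsilon> * real k \<ge> 4 * real p" "\<And>k. k \<ge> K \<Longrightarrow> \<epsilon>^3 * (real k)^2 \<ge> 64 * real p^3"
      "\<And>k. k \<ge> K \<Longrightarrow> \<epsilon>^5 * (real k)^4 \<ge> 256 * real p^7"
    and m: "m + K + 1 \<le> p\<^sup>2"
  shows "real (card (good_paths \<epsilon> (Suc m))) * fact (p\<^sup>2 - Suc m) \<ge> ((1 - 3 * \<epsilon>) / p) ^ m * fact (p\<^sup>2 - 1)"
  using m
proof (induction m)
  \<comment> \<open>A single starting vertex is used. This forgoes a factor \<open>p^2\<close>,
    which reappears in the final upper bound.\<close>
  case 0
  have "p\<^sup>2 > 0" using p_pos by simp
  then obtain v where v: "v \<in> V" using cardV by (metis card_gt_0_iff ex_in_conv)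
  have "[v] \<in> good_paths \<epsilon> (Suc 0)"
    unfolding good_paths_def using v good_start[OF v, of \<epsilon>] \<epsilon> p by simp
  then have "card (good_paths \<epsilon> (Suc 0)) \<ge> 1"
    using finite_good_paths card_gt_0_iff by (metis Suc_leI One_nat_def empty_iff)
  then show ?case by simp
next
  case (Suc m)
  define G where "G = good_paths \<epsilon> (Suc m)"
  define ext where "ext = (\<lambda>xs. {u\<in>V - set xs. adj (hd xs) u \<and> good \<epsilon> (V - set xs - {u}) u})"
  define k where "k = p\<^sup>2 - Suc m"
  have kK: "k \<ge> K" "k \<ge> 1" using Suc.prems by (auto simp: k_def)
  have kS: "p\<^sup>2 - Suc (Suc m) = k - 1" by (simp add: k_def)
  have fin: "finite G" "finite (ext xs)" for xs using finite_good_paths finV by (auto simp: G_def ext_def)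
  have ext: "real (card (ext xs)) \<ge> (1 - 3 * \<epsilon>) * k / p" if xs: "xs \<in> G" for xs
  proof -
    have x: "length xs = Suc m" "distinct xs" "set xs \<subseteq> V" "good \<epsilon> (V - set xs) (hd xs)"
      using xs by (auto simp: G_def good_paths_def)
    have c: "card (V - set xs) = k"
      using x finV cardV by (simp add: card_Diff_subset distinct_card k_def)
    have "hd xs \<in> V" using x by (cases xs) auto
    from good_extensions[OF _ this x(4), unfolded c] show ?thesis
      unfolding ext_def using \<epsilon> K[OF kK(1)] by auto
  qed
  have inj: "inj_on (\<lambda>(xs, u). u # xs) (Sigma G ext)" by (auto simp: inj_on_def)
  have sub: "(\<lambda>(xs, u). u # xs) ` Sigma G ext \<subseteq> good_paths \<epsilon> (Suc (Suc m))"
  proof safe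
    fix xs u assume xs: "xs \<in> G" "u \<in> ext xs"
    then have "V - set xs - {u} = V - set (u # xs)" by auto
    moreover have "xs \<noteq> []" using xs by (auto simp: G_def good_paths_def)
    ultimately show "u # xs \<in> good_paths \<epsilon> (Suc (Suc m))"
      using xs adj_commute[of u "hd xs"] by (cases xs) (auto simp: G_def good_paths_def ext_def)
  qed
  have "real (card G) * ((1 - 3 * \<epsilon>) * k / p) \<le> (\<Sum>xs\<in>G. real (card (ext xs)))"
    using ext by (rule sum_bounded_below)
  also have "\<dots> = real (card (Sigma G ext))" using fin by (simp add: card_SigmaI)
  also have "\<dots> = real (card ((\<lambda>(xs, u). u # xs) ` Sigma G ext))" by (simp add: card_image[OF inj])
  also have "\<dots> \<le> real (card (good_paths \<epsilon> (Suc (Suc m))))"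
    using card_mono[OF finite_good_paths sub] by simp
  finally have step: "real (card G) * ((1 - 3 * \<epsilon>) * k / p) \<le> real (card (good_paths \<epsilon> (Suc (Suc m))))" .
  have "((1 - 3 * \<epsilon>) / p) ^ m * fact (p\<^sup>2 - 1) \<le> real (card G) * fact k"
    using Suc by (simp add: G_def k_def)
  then have "((1 - 3 * \<epsilon>) / p) * (((1 - 3 * \<epsilon>) / p) ^ m * fact (p\<^sup>2 - 1)) \<le> ((1 - 3 * \<epsilon>) / p) * (real (card G) * fact k)"
    using \<epsilon> by (intro mult_left_mono) auto
  also have "real (fact k) = real k * fact (k - 1)" using kK(2) by (metis fact_reduce of_nat_fact gr0I not_one_le_zero)
  then have "((1 - 3 * \<epsilon>) / p) * (real (card G) * fact k) = real (card G) * ((1 - 3 * \<epsilon>) * k / p) * fact (k - 1)"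
    by simp
  also have "\<dots> \<le> real (card (good_paths \<epsilon> (Suc (Suc m)))) * fact (k - 1)"
    using step by (intro mult_right_mono) auto
  finally show ?case unfolding kS by simp
qed

end

text \<open>The vertex \<open>u\<close> stands for the point \<open>(u mod p, u div p)\<close> of the affine plane over the field with \<open>p\<close>
  elements, and \<open>(x, y)\<close> is joined to \<open>(u, v)\<close> when \<open>y + v = x u\<close>.\<close>

definition plane_adj :: "nat \<Rightarrow> nat \<Rightarrow> nat \<Rightarrow> bool" where
  "plane_adj p u v \<longleftrightarrow> [u div p + v div p = (u mod p) * (v mod p)] (mod p)"

section \<open>Incidences in the affine plane\<close>

lemma plane_point:
  fixes x y p :: nat
  assumes "x < p" "y < p"
  shows "x + p * y < p\<^sup>2" "(x + p * y) mod p = x" "(x + p * y) div p = y"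
proof -
  have "x + p * y < p + p * y" using assms by simp
  also have "\<dots> = p * Suc y" by simp
  also have "\<dots> \<le> p * p" using assms by (intro mult_le_mono2) simp
  finally show "x + p * y < p\<^sup>2" by (simp add: power2_eq_square)
qed (use assms in auto)

lemma plane_coord_less:
  fixes p u :: nat
  assumes "u < p\<^sup>2"
  shows "u div p < p" "u mod p < p"
proof -
  have "p > 0" using assms by (cases p) auto
  then show "u div p < p" "u mod p < p"
    using assms by (auto simp: power2_eq_square less_mult_imp_div_less)
qed

text \<open>A neighbour is determined by its first coordinate \<open>x\<close>, which is arbitrary:
  \<open>y x\<close> solves the equation for the second, with \<open>p - v div p\<close> standing
  for \<open>- (v div p)\<close> among the naturals.\<close>

lemma plane_neighbours:
  fixes p v :: nat
  assumes p: "p > 0" and v: "v < p\<^sup>2"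
  shows "card {u\<in>{..<p\<^sup>2}. plane_adj p v u} = p"
proof -
  define y where "y = (\<lambda>x. ((v mod p) * x + (p - v div p)) mod p)"
  have vl: "v div p < p" using plane_coord_less[OF v] by simp
  have y: "y x < p" for x using p by (simp add: y_def)
  have yc: "[v div p + z = (v mod p) * x] (mod p) \<longleftrightarrow> [z = y x] (mod p)" for x z
  proof -
    have "[v div p + y x = v div p + ((v mod p) * x + (p - v div p))] (mod p)"
      by (simp add: y_def cong_def mod_add_right_eq)
    also have "v div p + ((v mod p) * x + (p - v div p)) = (v mod p) * x + p" using vl by simp
    also have "[(v mod p) * x + p = (v mod p) * x] (mod p)" by (simp add: cong_def)
    finally have "[v div p + y x = (v mod p) * x] (mod p)" .
    then have "[v div p + z = (v mod p) * x] (mod p) \<longleftrightarrow> [v div p + z = v div p + y x] (mod p)"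
      using cong_trans cong_sym by metis
    then show ?thesis by (simp add: cong_add_lcancel_nat)
  qed
  have "{u\<in>{..<p\<^sup>2}. plane_adj p v u} = (\<lambda>x. x + p * y x) ` {..<p}"
  proof (intro equalityI subsetI)
    fix u assume "u \<in> {u\<in>{..<p\<^sup>2}. plane_adj p v u}"
    then have u: "u < p\<^sup>2" "plane_adj p v u" by auto
    then have "[u div p = y (u mod p)] (mod p)" unfolding plane_adj_def yc by simp
    then have "u div p = y (u mod p)" using plane_coord_less[OF u(1)] y[of "u mod p"] by (simp add: cong_def)
    then have "u = u mod p + p * y (u mod p)" by (metis mod_mult_div_eq)
    then show "u \<in> (\<lambda>x. x + p * y x) ` {..<p}" using plane_coord_less[OF u(1)] by blast
  next
    fix u assume "u \<in> (\<lambda>x. x + p * y x) ` {..<p}"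
    then obtain x where x: "u = x + p * y x" "x < p" by auto
    show "u \<in> {u\<in>{..<p\<^sup>2}. plane_adj p v u}"
      using plane_point[OF x(2) y[of x]] unfolding x(1) plane_adj_def by (simp add: yc)
  qed
  moreover have "inj_on (\<lambda>x. x + p * y x) {..<p}"
    by (rule inj_onI) (metis lessThan_iff plane_point(2) y)
  ultimately show ?thesis by (simp add: card_image)
qed

text \<open>If \<open>w\<close> and \<open>w'\<close> are both common neighbours, the alternating
  sum of the four equations leaves \<open>(xv - xu) (xw - xw') = 0\<close> modulo \<open>p\<close>.
  One pair of first coordinates agrees, and then so do the second coordinates.\<close>

lemma plane_codegree:
  fixes p u v :: nat
  assumes p: "prime p" and uv: "u < p\<^sup>2" "v < p\<^sup>2" "u \<noteq> v"
  shows "card {w\<in>{..<p\<^sup>2}. plane_adj p u w \<and> plane_adj p v w} \<le> 1"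
proof -
  have "w = w'" if w: "w < p\<^sup>2" "plane_adj p u w" "plane_adj p v w" and w': "w' < p\<^sup>2" "plane_adj p u w'" "plane_adj p v w'" for w w'
  proof -
    define xu yu xv yv xw yw xw' yw' where defs: "xu = int (u mod p)" "yu = int (u div p)" "xv = int (v mod p)" "yv = int (v div p)"
      "xw = int (w mod p)" "yw = int (w div p)" "xw' = int (w' mod p)" "yw' = int (w' div p)"
    have c: "[yu + yw = xu * xw] (mod int p)" "[yv + yw = xv * xw] (mod int p)"
      "[yu + yw' = xu * xw'] (mod int p)" "[yv + yw' = xv * xw'] (mod int p)"
      using w w' unfolding plane_adj_def defs by (simp_all flip: cong_int_iff)
    have pd: "prime (int p)" using p by simp
    have lt: "0 \<le> a \<and> a < int p" if "a \<in> {xu, yu, xv, yv, xw, yw, xw', yw'}" for a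
      using that plane_coord_less[OF uv(1)] plane_coord_less[OF uv(2)] plane_coord_less[OF w(1)] plane_coord_less[OF w'(1)]
      by (auto simp: defs)
    have eqI: "a = b" if "int p dvd a - b" "0 \<le> a \<and> a < int p" "0 \<le> b \<and> b < int p" for a b :: int
      using that cong_less_imp_eq_int[of a "int p" b] by (simp add: cong_iff_dvd_diff)
    have d: "int p dvd (yu + yw) - xu * xw" "int p dvd (yv + yw) - xv * xw" "int p dvd (yu + yw') - xu * xw'" "int p dvd (yv + yw') - xv * xw'"
      using c by (simp_all add: cong_iff_dvd_diff)
    have "int p dvd (((yu + yw) - xu * xw) - ((yv + yw) - xv * xw)) - (((yu + yw') - xu * xw') - ((yv + yw') - xv * xw'))"
      by (rule dvd_diff[OF dvd_diff[OF d(1,2)] dvd_diff[OF d(3,4)]])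
    also have "\<dots> = (xv - xu) * (xw - xw')" by (simp add: algebra_simps)
    finally consider "int p dvd xv - xu" | "int p dvd xw - xw'" using pd by (auto simp: prime_dvd_mult_iff)
    then show "w = w'"
    proof cases
      case 1
      then have x: "xv = xu" by (intro eqI lt) auto
      have "int p dvd ((yv + yw) - xv * xw) - ((yu + yw) - xu * xw)" by (rule dvd_diff[OF d(2,1)])
      then have "int p dvd yv - yu" by (simp add: x)
      then have "yv = yu" by (intro eqI lt) auto
      with x have "v = u" unfolding defs by (metis div_mod_decomp of_nat_eq_iff)
      then show ?thesis using uv by simp
    next
      case 2
      then have x: "xw = xw'" by (intro eqI lt) auto
      have "int p dvd ((yu + yw) - xu * xw) - ((yu + yw') - xu * xw')" by (rule dvd_diff[OF d(1,3)])
      then have "int p dvd yw - yw'" by (simp add: x)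
      then have "yw = yw'" by (intro eqI lt) auto
      with x show ?thesis unfolding defs by (metis div_mod_decomp of_nat_eq_iff)
    qed
  qed
  then have "\<exists>w. {w\<in>{..<p\<^sup>2}. plane_adj p u w \<and> plane_adj p v w} \<subseteq> {w}" by blast
  then show ?thesis using card_mono[of "{_}"] by fastforce
qed

lemma c4_free_regular_plane:
  assumes "prime p"
  shows "c4_free_regular {..<p\<^sup>2} (plane_adj p) p"
proof
  show "p > 0" using assms prime_gt_0_nat by blast
  show "plane_adj p v u" if "plane_adj p u v" for u v
    using that by (simp add: plane_adj_def add.commute mult.commute)
  show "card {u\<in>{..<p\<^sup>2}. plane_adj p v u} = p" if "v \<in> {..<p\<^sup>2}" for v
    using plane_neighbours that assms prime_gt_0_nat by simp
  show "card {w\<in>{..<p\<^sup>2}. plane_adj p u w \<and> plane_adj p v w} \<le> 1"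
    if "u \<in> {..<p\<^sup>2}" "v \<in> {..<p\<^sup>2}" "u \<noteq> v" for u v
    using plane_codegree[OF assms] that by simp
qed auto

section \<open>The upper bound\<close>

lemma card_permutes_map_eq:
  assumes S: "finite S" and xs: "distinct xs" "set xs \<subseteq> S" and ys: "distinct ys" "set ys \<subseteq> S"
    and len: "length ys = length xs"
  shows "fact (card S - length xs) \<le> card {\<pi>. \<pi> permutes S \<and> map \<pi> xs = ys}"
proof -
  have "finite (S - set xs)" "finite (S - set ys)" using S by auto
  moreover have "card (S - set xs) = card (S - set ys)"
    using S xs ys len by (simp add: card_Diff_subset distinct_card)
  ultimately obtain g where g: "bij_betw g (S - set xs) (S - set ys)"
    using finite_same_card_bij by blast
  have bx: "bij_betw ((!) xs) {..<length xs} (set xs)" using xs by (intro bij_betw_nth) auto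
  have by': "bij_betw ((!) ys) {..<length xs} (set ys)" using ys len by (intro bij_betw_nth) auto
  define f where "f = (!) ys \<circ> the_inv_into {..<length xs} ((!) xs)"
  have f: "bij_betw f (set xs) (set ys)"
    unfolding f_def by (rule bij_betw_trans[OF bij_betw_the_inv_into[OF bx] by'])
  have fi: "f (xs ! i) = ys ! i" if "i < length xs" for i
    unfolding f_def o_def using the_inv_into_f_f[OF bij_betw_imp_inj_on[OF bx], of i] that by simp
  \<comment> \<open>One permutation carrying \<open>xs\<close> to \<open>ys\<close>, completed by
    any bijection of the complements. Composing it with the permutations that fix
    \<open>set xs\<close> pointwise supplies the required number.\<close>
  define \<sigma> where "\<sigma> = (\<lambda>x. if x \<in> set xs then f x else if x \<in> S then g x else x)"
  have "bij_betw \<sigma> (set xs \<union> (S - set xs)) (set ys \<union> (S - set ys))"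
  proof (rule bij_betw_combine)
    have "bij_betw \<sigma> (set xs) (set ys) \<longleftrightarrow> bij_betw f (set xs) (set ys)"
      by (rule bij_betw_cong) (simp add: \<sigma>_def)
    then show "bij_betw \<sigma> (set xs) (set ys)" using f by simp
    have "bij_betw \<sigma> (S - set xs) (S - set ys) \<longleftrightarrow> bij_betw g (S - set xs) (S - set ys)"
      by (rule bij_betw_cong) (simp add: \<sigma>_def)
    then show "bij_betw \<sigma> (S - set xs) (S - set ys)" using g by simp
    show "set ys \<inter> (S - set ys) = {}" by blast
  qed
  moreover have "set xs \<union> (S - set xs) = S" "set ys \<union> (S - set ys) = S" using xs ys by blast+
  ultimately have "bij_betw \<sigma> S S" by simp
  then have \<sigma>: "\<sigma> permutes S" by (rule bij_imp_permutes) (use xs in \<open>auto simp: \<sigma>_def\<close>)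
  have \<sigma>x: "map \<sigma> xs = ys"
    by (rule nth_equalityI) (use len fi in \<open>auto simp: \<sigma>_def\<close>)
  define T where "T = {\<tau>. \<tau> permutes (S - set xs)}"
  have cT: "card T = fact (card S - length xs)"
    unfolding T_def using S xs by (subst card_permutations[OF refl]) (auto simp: card_Diff_subset distinct_card)
  have "inj_on (\<lambda>\<tau>. \<sigma> \<circ> \<tau>) T"
  proof (rule inj_onI, rule ext)
    fix \<tau> \<tau>' x assume "\<sigma> \<circ> \<tau> = \<sigma> \<circ> \<tau>'"
    then have "\<sigma> (\<tau> x) = \<sigma> (\<tau>' x)" by (metis comp_apply)
    then show "\<tau> x = \<tau>' x" by (rule injD[OF permutes_inj[OF \<sigma>]])
  qed
  moreover have "(\<lambda>\<tau>. \<sigma> \<circ> \<tau>) ` T \<subseteq> {\<pi>. \<pi> permutes S \<and> map \<pi> xs = ys}"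
  proof safe
    fix \<tau> assume "\<tau> \<in> T"
    then have \<tau>: "\<tau> permutes (S - set xs)" by (simp add: T_def)
    then have "\<tau> permutes S" by (rule permutes_subset) auto
    then show "\<sigma> \<circ> \<tau> permutes S" using \<sigma> by (rule permutes_compose)
    have "map (\<sigma> \<circ> \<tau>) xs = map \<sigma> xs" using permutes_not_in[OF \<tau>] by auto
    then show "map (\<sigma> \<circ> \<tau>) xs = ys" using \<sigma>x by simp
  qed
  moreover have "finite {\<pi>. \<pi> permutes S \<and> map \<pi> xs = ys}"
    by (rule finite_subset[OF _ finite_permutations[OF S]]) auto
  ultimately have "card T \<le> card {\<pi>. \<pi> permutes S \<and> map \<pi> xs = ys}" by (rule card_inj_on_le)
  then show ?thesis by (simp add: cT)
qed

text \<open>\<open>take l xs\<close> and \<open>drop (l - 1) xs\<close> share the vertex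
  \<open>xs ! (l - 1)\<close>; with this overlap no edge is lost at the cut.\<close>

lemma path_edges_cases:
  assumes "e \<in> path_edges xs" "1 \<le> l" "l \<le> length xs"
  obtains (head) u v where "e = {u, v}" "u \<in> set (take l xs)" "v \<in> set (take l xs)" "{u, v} \<in> path_edges (take l xs)"
  | (tail) j where "Suc j < length (drop (l - 1) xs)" "e = {drop (l - 1) xs ! j, drop (l - 1) xs ! Suc j}"
proof -
  obtain i where i: "e = {xs ! i, xs ! Suc i}" "Suc i < length xs" using assms(1) by (auto simp: path_edges_def)
  show thesis
  proof (cases "Suc i < l")
    case True
    then have n: "take l xs ! i = xs ! i" "take l xs ! Suc i = xs ! Suc i" by auto
    have "Suc i < length (take l xs)" using True assms(3) by simp
    then have "{take l xs ! i, take l xs ! Suc i} \<in> path_edges (take l xs)" 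
      "take l xs ! i \<in> set (take l xs)" "take l xs ! Suc i \<in> set (take l xs)"
      by (auto simp only: path_edges_def intro: nth_mem Suc_lessD)
    then show thesis using i(1) unfolding n by (intro head[of "xs ! i" "xs ! Suc i"]) simp_all
  next
    case False
    define j where "j = i - (l - 1)"
    have "i = l - 1 + j" using False assms(2) by (simp add: j_def)
    then show thesis using i assms by (intro tail[of j]) auto
  qed
qed

lemma successively_path_edges:
  assumes "successively R xs" "{u, v} \<in> path_edges xs" "\<And>a b. R a b \<Longrightarrow> R b a"
  shows "R u v"
proof -
  obtain i where i: "{u, v} = {xs ! i, xs ! Suc i}" "Suc i < length xs" using assms(2) by (auto simp: path_edges_def)
  have "R (xs ! i) (xs ! Suc i)" using assms(1) i(2) by (simp add: successively_conv_nth)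
  then show ?thesis using i(1) assms(3) by (auto simp: doubleton_eq_iff)
qed

text \<open>The vertices of the common tail after its first one cannot lie on a cycle of the union.\<close>

lemma no_C4_in_union:
  assumes xs: "distinct xs" and ys: "distinct ys" "length ys = length xs"
    and l: "1 \<le> l" "l \<le> length xs" and tl: "drop (l - 1) xs = drop (l - 1) ys"
    and R: "successively R (take l xs)" "successively R (take l ys)" "\<And>a b. R a b \<Longrightarrow> R b a"
    and C4: "\<And>a b c d. distinct [a, b, c, d] \<Longrightarrow> {a, b, c, d} \<subseteq> set xs \<Longrightarrow> R a b \<Longrightarrow> R b c \<Longrightarrow> R c d \<Longrightarrow> R d a \<Longrightarrow> False"
  shows "\<not> creating (cycle_graph 4) (path_graph xs) (path_graph ys)"
proof
  assume "creating (cycle_graph 4) (path_graph xs) (path_graph ys)"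
  then obtain a b c d where abcd: "distinct [a, b, c, d]" "{a, b, c, d} \<subseteq> set xs"
    and e: "{a, b} \<in> path_edges xs \<union> path_edges ys" "{b, c} \<in> path_edges xs \<union> path_edges ys"
      "{c, d} \<in> path_edges xs \<union> path_edges ys" "{d, a} \<in> path_edges xs \<union> path_edges ys"
    unfolding creating_def contains_cycle_4_iff path_graph_def ugraph.simps by blast
  define E where "E = path_edges xs \<union> path_edges ys"
  define t where "t = drop (l - 1) xs"
  define C where "C = {a, b, c, d}"
  have dt: "distinct t" using xs by (simp add: t_def)
  \<comment> \<open>An edge of the initial part avoids all tail vertices of index at least
    \<open>1\<close>, since only the vertex of index \<open>0\<close> is shared; every other edge
    joins consecutive vertices of the common tail \<open>t\<close>.\<close>
  have edge: "(R u v \<and> (\<forall>j. 1 \<le> j \<and> j < length t \<longrightarrow> t ! j \<noteq> u \<and> t ! j \<noteq> v)) \<or> (\<exists>j. Suc j < length t \<and> {u, v} = {t ! j, t ! Suc j})"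
    if uv: "{u, v} \<in> E" for u v
  proof -
    have *: ?thesis if zs: "distinct zs" "length zs = length xs" "drop (l - 1) zs = t" "successively R (take l zs)" "{u, v} \<in> path_edges zs" for zs
    proof -
      have l': "l \<le> length zs" using l zs by simp
      from zs(5) l(1) l' show ?thesis
      proof (cases rule: path_edges_cases)
        case (head u' v')
        have "R u v" using successively_path_edges[OF zs(4) _ R(3)] head by metis
        moreover have "t ! j \<notin> set (take l zs)" if j: "1 \<le> j" "j < length t" for j
        proof
          assume "t ! j \<in> set (take l zs)"
          then obtain i where i: "i < l" "zs ! i = t ! j" using l' by (auto simp: in_set_conv_nth)
          have "t ! j = zs ! (l - 1 + j)" "l - 1 + j < length zs" using j l' zs(2) unfolding zs(3)[symmetric] by auto
          then have "i = l - 1 + j" using i zs(1) l' by (metis nth_eq_iff_index_eq order_less_le_trans)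
          then show False using i j by simp
        qed
        moreover have "u \<in> set (take l zs)" "v \<in> set (take l zs)" using head by (auto simp: doubleton_eq_iff)
        ultimately show ?thesis by metis
      next
        case (tail j)
        then show ?thesis unfolding zs(3) by blast
      qed
    qed
    show ?thesis
    proof (cases "{u, v} \<in> path_edges xs")
      case True
      then show ?thesis by (intro *[of xs]) (use xs R t_def in auto)
    next
      case False
      then show ?thesis using uv by (intro *[of ys]) (use ys R t_def tl E_def in auto)
    qed
  qed
  have nb: "\<exists>u v. u \<in> C \<and> v \<in> C \<and> u \<noteq> v \<and> {x, u} \<in> E \<and> {x, v} \<in> E" if "x \<in> C" for x
  proof -
    have e': "{b, a} \<in> E" "{c, b} \<in> E" "{d, c} \<in> E" "{a, d} \<in> E" "{a, b} \<in> E" "{b, c} \<in> E" "{c, d} \<in> E" "{d, a} \<in> E"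
      using e unfolding E_def by (simp_all only: insert_commute[of b a "{}"] insert_commute[of c b "{}"] insert_commute[of d c "{}"] insert_commute[of a d "{}"])
    from that consider "x = a" | "x = b" | "x = c" | "x = d" by (auto simp: C_def)
    then show ?thesis
    proof cases
      case 1 then show ?thesis using e' abcd(1) by (intro exI[of _ b] exI[of _ d]) (simp add: C_def)
    next
      case 2 then show ?thesis using e' abcd(1) by (intro exI[of _ a] exI[of _ c]) (simp add: C_def)
    next
      case 3 then show ?thesis using e' abcd(1) by (intro exI[of _ b] exI[of _ d]) (simp add: C_def)
    next
      case 4 then show ?thesis using e' abcd(1) by (intro exI[of _ c] exI[of _ a]) (simp add: C_def)
    qed
  qed
  \<comment> \<open>The last tail vertex on the cycle can have only its predecessor in the tail as a
    neighbour on the cycle, but a cycle needs two. So \<open>J\<close> is empty and all four edges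
    are \<open>R\<close>-edges.\<close>
  define J where "J = {j. 1 \<le> j \<and> j < length t \<and> t ! j \<in> C}"
  have "J = {}"
  proof (rule ccontr)
    assume "J \<noteq> {}"
    moreover have finJ: "finite J" by (rule finite_subset[of _ "{..<length t}"]) (auto simp: J_def)
    ultimately have mJ: "Max J \<in> J" by simp
    define j where "j = Max J"
    have j: "1 \<le> j" "j < length t" "t ! j \<in> C" using mJ by (auto simp: J_def j_def)
    have only: "w = t ! (j - 1)" if w: "w \<in> C" "{t ! j, w} \<in> E" for w
    proof -
      obtain i where i: "Suc i < length t" "{t ! j, w} = {t ! i, t ! Suc i}"
        using edge[OF w(2)] j by blast
      have "t ! j = t ! i \<and> w = t ! Suc i \<or> t ! j = t ! Suc i \<and> w = t ! i" using i(2) by (auto simp: doubleton_eq_iff)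
      then show ?thesis
      proof
        assume *: "t ! j = t ! i \<and> w = t ! Suc i"
        then have "j = i" using dt i j by (simp add: nth_eq_iff_index_eq)
        then have "Suc j \<in> J" using * i w by (simp add: J_def)
        then have "Suc j \<le> j" unfolding j_def using finJ by (intro Max_ge)
        then show ?thesis by simp
      next
        assume *: "t ! j = t ! Suc i \<and> w = t ! i"
        then have "j = Suc i" using dt i j by (simp add: nth_eq_iff_index_eq)
        then show ?thesis using * by simp
      qed
    qed
    then show False using nb[OF j(3)] by metis
  qed
  then have Rall: "R u v" if "{u, v} \<in> E" "v \<in> C" "u \<in> C" for u v
  proof -
    from edge[OF that(1)] show ?thesis
    proof
      assume "\<exists>j. Suc j < length t \<and> {u, v} = {t ! j, t ! Suc j}"
      then obtain i where "Suc i < length t" "t ! Suc i \<in> {u, v}" by blast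
      then have "Suc i \<in> J" using that by (auto simp: J_def)
      then show ?thesis using \<open>J = {}\<close> by simp
    qed simp
  qed
  show False
    by (rule C4[OF abcd]) (use e Rall in \<open>auto simp: E_def C_def\<close>)
qed

text \<open>Pairs of a path in \<open>F\<close> and a permutation carrying its head into
  \<open>L\<close> are counted in two ways. For a fixed permutation these paths have distinct tails:
  with a common tail, two of them would have a union free of four-cycles. Tails overlap the heads in
  one vertex, hence the exponent \<open>n - l + 1\<close>.\<close>

lemma creating_family_card_bound:
  fixes adj :: "nat \<Rightarrow> nat \<Rightarrow> bool"
  assumes F: "F \<in> creating_families n (cycle_graph 4)"
    and nN: "n \<le> N" and l: "1 \<le> l" "l \<le> n"
    and L: "\<And>g. g \<in> L \<Longrightarrow> length g = l \<and> distinct g \<and> set g \<subseteq> {..<N} \<and> successively adj g"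
    and sym: "\<And>a b. adj a b \<Longrightarrow> adj b a"
    and C4: "\<And>a b c d. distinct [a, b, c, d] \<Longrightarrow> {a, b, c, d} \<subseteq> {..<N} \<Longrightarrow> adj a b \<Longrightarrow> adj b c \<Longrightarrow> adj c d \<Longrightarrow> adj d a \<Longrightarrow> False"
  shows "card F * (card L * fact (N - l)) \<le> fact N * n ^ (n - l + 1)"
proof -
  have Fsub: "F \<subseteq> path_graph ` {xs. distinct xs \<and> set xs = {..<n}}" and Fpw: "pairwise (creating (cycle_graph 4)) F"
    using F unfolding creating_families_def hamiltonian_paths_complete by auto
  \<comment> \<open>A path graph does not determine an orientation, so a vertex sequence is chosen
    for each member of \<open>F\<close>.\<close>
  define h where "h = (\<lambda>P. SOME xs. distinct xs \<and> set xs = {..<n} \<and> P = path_graph xs)"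
  have h: "distinct (h P)" "set (h P) = {..<n}" "P = path_graph (h P)" "length (h P) = n" if "P \<in> F" for P
  proof -
    have "\<exists>xs. distinct xs \<and> set xs = {..<n} \<and> P = path_graph xs" using Fsub that by auto
    from someI_ex[OF this] have *: "distinct (h P) \<and> set (h P) = {..<n} \<and> P = path_graph (h P)" by (simp add: h_def)
    then show "distinct (h P)" "set (h P) = {..<n}" "P = path_graph (h P)" by blast+
    show "length (h P) = n" using * distinct_card[of "h P"] by simp
  qed
  have finF: "finite F"
    by (rule finite_subset[OF _ finite_hamiltonian_paths[of n]]) (use F in \<open>simp add: creating_families_def\<close>)
  have finL: "finite L"
    by (rule finite_subset[OF _ finite_lists_length_eq[of "{..<N}" l]]) (use L in auto)
  define \<Phi> where "\<Phi> = {\<pi>. \<pi> permutes {..<N}}"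
  have fin\<Phi>: "finite \<Phi>" "card \<Phi> = fact N" by (simp_all add: \<Phi>_def finite_permutations card_permutations)
  have lower: "card L * fact (N - l) \<le> card {\<pi>\<in>\<Phi>. map \<pi> (take l (h P)) \<in> L}" if P: "P \<in> F" for P
  proof -
    let ?A = "\<lambda>g. {\<pi>. \<pi> permutes {..<N} \<and> map \<pi> (take l (h P)) = g}"
    have "card L * fact (N - l) = (\<Sum>g\<in>L. fact (N - l))" by simp
    also have "\<dots> \<le> (\<Sum>g\<in>L. card (?A g))"
    proof (rule sum_mono)
      fix g assume g: "g \<in> L"
      have "set (take l (h P)) \<subseteq> {..<N}" using h(2)[OF P] nN set_take_subset[of l "h P"] by auto
      then show "fact (N - l) \<le> card (?A g)"
        using card_permutes_map_eq[of "{..<N}" "take l (h P)" g] L[OF g] h[OF P] l by simp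
    qed
    also have "\<dots> = card (\<Union>g\<in>L. ?A g)"
    proof (rule card_UN_disjoint[symmetric, OF finL])
      show "\<forall>g\<in>L. finite (?A g)"
        by (intro ballI finite_subset[OF _ finite_permutations[of "{..<N}"]]) auto
    qed blast
    also have "(\<Union>g\<in>L. ?A g) = {\<pi>\<in>\<Phi>. map \<pi> (take l (h P)) \<in> L}" by (auto simp: \<Phi>_def)
    finally show ?thesis .
  qed
  have upper: "card {P\<in>F. map \<pi> (take l (h P)) \<in> L} \<le> n ^ (n - l + 1)" if \<pi>: "\<pi> \<in> \<Phi>" for \<pi>
  proof -
    let ?X = "{P\<in>F. map \<pi> (take l (h P)) \<in> L}"
    have inj\<pi>: "inj \<pi>" using \<pi> by (auto simp: \<Phi>_def permutes_inj)
    have "inj_on (\<lambda>P. drop (l - 1) (h P)) ?X"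
    proof (rule inj_onI)
      fix P Q assume P: "P \<in> ?X" and Q: "Q \<in> ?X" and eq: "drop (l - 1) (h P) = drop (l - 1) (h Q)"
      have PF: "P \<in> F" "Q \<in> F" using P Q by auto
      show "P = Q"
      proof (rule ccontr)
        assume "P \<noteq> Q"
        then have cr: "creating (cycle_graph 4) (path_graph (h P)) (path_graph (h Q))"
          using pairwiseD[OF Fpw PF \<open>P \<noteq> Q\<close>] by (simp only: h(3)[OF PF(1), symmetric] h(3)[OF PF(2), symmetric])
        define R where "R = (\<lambda>a b. adj (\<pi> a) (\<pi> b))"
        have succ: "successively R (take l (h P'))" if "P' \<in> ?X" for P'
        proof -
          have "map \<pi> (take l (h P')) \<in> L" using that by simp
          then have "successively adj (map \<pi> (take l (h P')))" using L by blast
          then show ?thesis unfolding R_def by (simp only: successively_map)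
        qed
        have "\<not> creating (cycle_graph 4) (path_graph (h P)) (path_graph (h Q))"
        proof (rule no_C4_in_union[of _ _ l R])
          fix a b c d assume *: "distinct [a, b, c, d]" "{a, b, c, d} \<subseteq> set (h P)" "R a b" "R b c" "R c d" "R d a"
          have dist: "distinct [\<pi> a, \<pi> b, \<pi> c, \<pi> d]"
          proof -
            have "distinct (map \<pi> [a, b, c, d])"
              unfolding distinct_map using *(1) inj_on_subset[OF inj\<pi> subset_UNIV] by blast
            then show ?thesis by (simp only: list.map)
          qed
          have sub:  "{\<pi> a, \<pi> b, \<pi> c, \<pi> d} \<subseteq> {..<N}"
          proof -
            have "\<pi> x \<in> {..<N}" if "x \<in> {a, b, c, d}" for x
            proof -
              have "x \<in> set (h P)" by (rule subsetD[OF *(2) that])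
              then have "x \<in> {..<N}" unfolding h(2)[OF PF(1)] using nN by simp
              then show ?thesis using \<pi> permutes_in_image[of \<pi> "{..<N}" x] by (simp add: \<Phi>_def)
            qed
            then show ?thesis by blast
          qed
          show False by (rule C4[OF dist sub *(3-6)[unfolded R_def]])
        next
          show "R b a" if "R a b" for a b using that unfolding R_def by (rule sym)
          show "successively R (take l (h P))" "successively R (take l (h Q))"
            by (rule succ[OF P], rule succ[OF Q])
          show "length (h Q) = length (h P)" "l \<le> length (h P)"
            unfolding h(4)[OF PF(1)] h(4)[OF PF(2)] by (rule refl, rule l)
          show "distinct (h P)" by (rule h(1)[OF PF(1)])
          show "distinct (h Q)" by (rule h(1)[OF PF(2)])
          show "1 \<le> l" by (rule l)
          show "drop (l - 1) (h P) = drop (l - 1) (h Q)" by (rule eq)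
        qed
        then show False using cr by contradiction
      qed
    qed
    moreover have "(\<lambda>P. drop (l - 1) (h P)) ` ?X \<subseteq> {xs. set xs \<subseteq> {..<n} \<and> length xs = n - l + 1}"
    proof (rule image_subsetI)
      fix P assume "P \<in> ?X"
      then have PF: "P \<in> F" by simp
      have "set (drop (l - 1) (h P)) \<subseteq> {..<n}"
        using set_drop_subset[of "l - 1" "h P"] unfolding h(2)[OF PF] .
      moreover have "length (drop (l - 1) (h P)) = n - l + 1" using h(4)[OF PF] l by simp
      ultimately show "drop (l - 1) (h P) \<in> {xs. set xs \<subseteq> {..<n} \<and> length xs = n - l + 1}" by blast
    qed
    moreover have "finite {xs. set xs \<subseteq> {..<n} \<and> length xs = n - l + 1}" by (intro finite_lists_length_eq) simp
    ultimately have "card ?X \<le> card {xs. set xs \<subseteq> {..<n} \<and> length xs = n - l + 1}" by (rule card_inj_on_le)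
    then show ?thesis by (simp add: card_lists_length_eq)
  qed
  have "card F * (card L * fact (N - l)) = (\<Sum>P\<in>F. card L * fact (N - l))" by simp
  also have "\<dots> \<le> (\<Sum>P\<in>F. card {\<pi>\<in>\<Phi>. map \<pi> (take l (h P)) \<in> L})" by (rule sum_mono) (rule lower)
  also have "\<dots> = (\<Sum>\<pi>\<in>\<Phi>. card {P\<in>F. map \<pi> (take l (h P)) \<in> L})"
    by (rule sum_multicount_gen[OF finF fin\<Phi>(1)]) auto
  also have "\<dots> \<le> (\<Sum>\<pi>\<in>\<Phi>. n ^ (n - l + 1))" by (rule sum_mono) (rule upper)
  also have "\<dots> = fact N * n ^ (n - l + 1)" using fin\<Phi> by simp
  finally show ?thesis .
qed

section \<open>Choice of the prime and of the parameters\<close>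

lemma prime_sqrt_window:
  assumes "e > 0"
  shows "\<forall>\<^sub>F n in sequentially. \<exists>p::nat. prime p \<and> sqrt (real n) \<le> real p \<and> real p \<le> exp (2 * e) * sqrt (real n)"
proof -
  have "filterlim (\<lambda>n::nat. ln (real n) / 2) at_top sequentially" by real_asymp
  \<comment> \<open>The centre is shifted by \<open>e\<close> so that the window lies entirely above
    \<open>ln n / 2\<close>; this secures \<open>n \<le> p^2\<close>.\<close>
  then have "filterlim (\<lambda>n::nat. e + ln (real n) / 2) at_top sequentially"
    by (rule filterlim_tendsto_add_at_top[OF tendsto_const])
  from eventually_compose_filterlim[OF prime_near_exp[OF assms] this] eventually_gt_at_top[of 0]
  show ?thesis
  proof eventually_elim
    case (elim n)
    then obtain p :: nat where p: "prime p" "\<bar>ln p - (e + ln (real n) / 2)\<bar> < e" by blast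
    have p0: "real p > 0" using p(1) prime_gt_0_nat by simp
    have s: "sqrt (real n) = exp (ln (real n) / 2)"
      using elim by (simp add: ln_sqrt[symmetric])
    have "ln (real n) / 2 \<le> ln p" "ln p \<le> 2 * e + ln (real n) / 2" using p(2) by (simp_all add: abs_less_iff)
    then have "exp (ln (real n) / 2) \<le> exp (ln p)" "exp (ln p) \<le> exp (2 * e + ln (real n) / 2)" by (simp_all only: exp_le_cancel_iff)
    then have "sqrt (real n) \<le> real p" "real p \<le> exp (2 * e) * sqrt (real n)"
      unfolding s exp_add[symmetric] using p0 by (simp_all only: exp_ln)
    then show ?case using p(1) by blast
  qed
qed

lemma plane_C4_free:
  assumes "prime p" "distinct [a, b, c, d]" "{a, b, c, d} \<subseteq> {..<p\<^sup>2}"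
    "plane_adj p a b" "plane_adj p b c" "plane_adj p c d" "plane_adj p d a"
  shows False
proof -
  interpret c4_free_regular "{..<p\<^sup>2}" "plane_adj p" p by (rule c4_free_regular_plane) fact
  have "{b, d} \<subseteq> {w\<in>{..<p\<^sup>2}. plane_adj p a w \<and> plane_adj p c w}"
    using assms sym by auto
  then have "card {b, d} \<le> card {w\<in>{..<p\<^sup>2}. plane_adj p a w \<and> plane_adj p c w}" by (intro card_mono) auto
  also have "\<dots> \<le> 1" using assms by (intro codeg) auto
  finally show False using assms(2) by simp
qed

text \<open>Each edge of the head contributes the inverse density \<open>p / (1 - 3 * e)\<close>.
  The factor \<open>p^2\<close> comes from the single starting vertex of the greedy paths, and
  \<open>n ^ (K + 1)\<close> counts the possible tails.\<close>

lemma H_num_upper_bound_prime: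
  fixes e :: real
  assumes p: "prime p" "n \<le> p\<^sup>2" and e: "0 < e" "e < 1/3" "e * p \<ge> 2" and K: "K < n"
    "\<And>k. k \<ge> K \<Longrightarrow> e * real k \<ge> 4 * p" "\<And>k. k \<ge> K \<Longrightarrow> e^3 * (real k)^2 \<ge> 64 * real p^3"
    "\<And>k. k \<ge> K \<Longrightarrow> e^5 * (real k)^4 \<ge> 256 * real p^7"
  shows "real (H_num n (cycle_graph 4)) \<le> (real p)\<^sup>2 * real n ^ (K + 1) * (real p / (1 - 3 * e)) ^ n"
proof -
  interpret c4_free_regular "{..<p\<^sup>2}" "plane_adj p" p by (rule c4_free_regular_plane) fact
  \<comment> \<open>The head has \<open>Suc m = n - K\<close> vertices and \<open>m\<close> edges;
    with the overlap the tail has \<open>K + 1\<close> vertices.\<close>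
  define m where "m = n - 1 - K"
  have m: "Suc m = n - K" "m + K + 1 \<le> p\<^sup>2" "m \<le> n" using K(1) p(2) by (auto simp: m_def)
  define L where "L = good_paths e (Suc m)"
  have "H_num n (cycle_graph 4) \<in> card ` creating_families n (cycle_graph 4)"
    unfolding H_num_def using finite_creating_families creating_families_nonempty by (intro Max_in) auto
  then obtain F where F: "F \<in> creating_families n (cycle_graph 4)" "H_num n (cycle_graph 4) = card F" by auto
  have "card F * (card L * fact (p\<^sup>2 - Suc m)) \<le> fact (p\<^sup>2) * n ^ (n - Suc m + 1)"
  proof (rule creating_family_card_bound[OF F(1) p(2)])
    show "length g = Suc m \<and> distinct g \<and> set g \<subseteq> {..<p\<^sup>2} \<and> successively (plane_adj p) g" if "g \<in> L" for g
      using that by (auto simp: L_def good_paths_def)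
    show False if "distinct [a, b, c, d]" "{a, b, c, d} \<subseteq> {..<p\<^sup>2}"
      "plane_adj p a b" "plane_adj p b c" "plane_adj p c d" "plane_adj p d a" for a b c d
      using plane_C4_free[OF p(1) that] .
  qed (use m K(1) sym in auto)
  moreover have "n - Suc m + 1 = K + 1" using m K(1) by simp
  ultimately have "real (card F * (card L * fact (p\<^sup>2 - Suc m))) \<le> real (fact (p\<^sup>2) * n ^ (K + 1))"
    by (simp only: of_nat_le_iff)
  then have 1: "real (card F) * (real (card L) * fact (p\<^sup>2 - Suc m)) \<le> fact (p\<^sup>2) * real n ^ (K + 1)"
    by simp
  have 2: "((1 - 3 * e) / p) ^ m * fact (p\<^sup>2 - 1) \<le> real (card L) * fact (p\<^sup>2 - Suc m)"
    unfolding L_def by (rule card_good_paths[OF e(1,2,3) K(2-4) m(2)])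
  have p0: "real p \<ge> 1" using p(1) prime_gt_0_nat[of p] by simp
  define q where "q = real p / (1 - 3 * e)"
  have q: "q \<ge> 1" using p0 e by (simp add: q_def)
  have iq: "(1 - 3 * e) / p = 1 / q" by (simp add: q_def)
  have "p\<^sup>2 > 0" using p0 by simp
  then have f: "(fact (p\<^sup>2) :: real) = (real p)\<^sup>2 * fact (p\<^sup>2 - 1)" using fact_reduce[of "p\<^sup>2", where ?'a = real] by simp
  have "real (card F) * ((1 / q) ^ m * fact (p\<^sup>2 - 1)) \<le> real (card F) * (real (card L) * fact (p\<^sup>2 - Suc m))"
    using 2 unfolding iq by (intro mult_left_mono) auto
  also have "\<dots> \<le> (real p)\<^sup>2 * fact (p\<^sup>2 - 1) * real n ^ (K + 1)" using 1 unfolding f .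
  finally have "(real (card F) * (1 / q) ^ m) * fact (p\<^sup>2 - 1) \<le> ((real p)\<^sup>2 * real n ^ (K + 1)) * fact (p\<^sup>2 - 1)"
    by (simp only: mult_ac)
  then have "real (card F) * (1 / q) ^ m \<le> (real p)\<^sup>2 * real n ^ (K + 1)"
    by (rule mult_right_le_imp_le) simp
  then have "real (card F) \<le> (real p)\<^sup>2 * real n ^ (K + 1) * q ^ m"
    using q by (simp add: power_one_over pos_divide_le_eq)
  also have "\<dots> \<le> (real p)\<^sup>2 * real n ^ (K + 1) * q ^ n"
    using q m(3) by (intro mult_left_mono power_increasing) auto
  finally show ?thesis by (simp add: F(2) q_def)
qed

lemma eventually_le_powr:
  fixes c a b :: real
  assumes "a < b"
  shows "\<forall>\<^sub>F n in sequentially. c * real n powr a \<le> real n powr b"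
proof -
  have "filterlim (\<lambda>n. real n powr (b - a)) at_top sequentially"
    using assms by real_asymp
  then have "\<forall>\<^sub>F n in sequentially. c \<le> real n powr (b - a)"
    by (simp add: filterlim_at_top)
  then show ?thesis using eventually_gt_at_top[of 0]
  proof eventually_elim
    case (elim n)
    then have "c * real n powr a \<le> real n powr (b - a) * real n powr a" by (intro mult_right_mono) auto
    then show ?case by (simp flip: powr_add)
  qed
qed

lemma ln_H_num_upper_bound:
  assumes c: "c > 0"
  shows "\<forall>\<^sub>F n in sequentially. ln (real (H_num n (cycle_graph 4))) \<le> real n / 2 * ln (real n) + c * real n"
proof -
  \<comment> \<open>Per vertex the logarithm loses \<open>2 * e\<close> from the size of the prime,
    \<open>6 * e\<close> from \<open>- ln (1 - 3 * e)\<close>, and \<open>e\<close> from all lower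
    order terms: \<open>9 * e\<close> in total.\<close>
  define e where "e = min (1/6) (c / 9)"
  have e: "0 < e" "e \<le> 1/6" "9 * e \<le> c" using c by (auto simp: e_def)
  have e2: "exp (2 * e) \<le> 2"
  proof -
    have "exp (2 * e) \<le> exp (1/3)" using e by simp
    also have "exp (1/3) \<le> 1 + 1/3 + (1/3::real)\<^sup>2" by (rule exp_bound) auto
    finally show ?thesis by (simp add: power2_eq_square)
  qed
  have l3: "- ln (1 - 3 * e) \<le> 6 * e"
  proof -
    have "- (3 * e) - 2 * (3 * e)\<^sup>2 \<le> ln (1 - 3 * e)" using e by (intro ln_one_minus_pos_lower_bound) auto
    moreover have "(3 * e)\<^sup>2 \<le> 1/2 * (3 * e)" unfolding power2_eq_square using e by (intro mult_right_mono) auto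
    ultimately show ?thesis by linarith
  qed
  \<comment> \<open>The strongest requirement is \<open>e^5 * k^4 \<ge> 256 * p^7\<close> with
    \<open>p\<close> of order \<open>sqrt n\<close>, that is, \<open>k\<close> beyond a multiple of
    \<open>n powr (7/8)\<close>. The exponent \<open>9/10\<close> exceeds \<open>7/8\<close> and
    still keeps \<open>K n * ln n\<close> in \<open>o(n)\<close>.\<close>
  define K where "K = (\<lambda>n::nat. nat \<lceil>real n powr (9/10)\<rceil>)"
  have "\<forall>\<^sub>F n in sequentially. ln (real n) + 1 + (real n powr (9/10) + 2) * ln (real n) \<le> e * real n"
  proof -
    have "(\<lambda>n. ln (real n) + 1 + (real n powr (9/10) + 2) * ln (real n)) \<in> o(\<lambda>n. real n)" by real_asymp
    from landau_o.smallD[OF this e(1)] show ?thesis by eventually_elim simp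
  qed
  \<comment> \<open>These four conditions are the requirements of the bound for a given prime: the
    first uses \<open>p \<ge> sqrt n\<close>, the others \<open>p \<le> 2 sqrt n\<close>, with
    \<open>8 = 4 * 2\<close>, \<open>512 = 64 * 2^3\<close> and
    \<open>32768 = 256 * 2^7\<close>.\<close>
  moreover have "\<forall>\<^sub>F n in sequentially. 2 / e * real n powr 0 \<le> real n powr (1/2)" by (rule eventually_le_powr) simp
  moreover have "\<forall>\<^sub>F n in sequentially. 8 / e * real n powr (1/2) \<le> real n powr (9/10)" by (rule eventually_le_powr) simp
  moreover have "\<forall>\<^sub>F n in sequentially. 512 / e^3 * real n powr (3/2) \<le> real n powr (18/10)" by (rule eventually_le_powr) simp
  moreover have "\<forall>\<^sub>F n in sequentially. 32768 / e^5 * real n powr (7/2) \<le> real n powr (36/10)" by (rule eventually_le_powr) simp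
  moreover have "\<forall>\<^sub>F n in sequentially. real n powr (9/10) + 1 < real n" by real_asymp
  ultimately show ?thesis using prime_sqrt_window[OF e(1)] eventually_ge_at_top[of 2]
  proof eventually_elim
    case (elim n)
    obtain p :: nat where p: "prime p" "sqrt (real n) \<le> real p" "real p \<le> exp (2 * e) * sqrt (real n)" using elim(7) by blast
    have n: "real n \<ge> 2" using elim(8) by simp
    have s: "sqrt (real n) = real n powr (1/2)" using n by (simp add: powr_half_sqrt)
    have p2: "real p \<le> 2 * real n powr (1/2)"
      using order_trans[OF p(3) mult_right_mono[OF e2]] n by (simp add: s)
    have pk: "real p ^ k \<le> 2 ^ k * real n powr (real k / 2)" for k
    proof -
      have "real p ^ k \<le> (2 * real n powr (1/2)) ^ k" using p2 by (intro power_mono) auto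
      also have "\<dots> = 2 ^ k * real n powr (real k / 2)" using n by (simp add: power_mult_distrib powr_power)
      finally show ?thesis .
    qed
    have np2: "n \<le> p\<^sup>2"
    proof -
      have "(sqrt (real n))\<^sup>2 \<le> (real p)\<^sup>2" using p(2) by (intro power_mono) auto
      then have "real n \<le> real (p\<^sup>2)" by simp
      then show ?thesis by (simp only: of_nat_le_iff)
    qed
    have Kge: "real n powr (9/10) \<le> real (K n)" "real (K n) \<le> real n powr (9/10) + 1"
    proof -
      show "real n powr (9/10) \<le> real (K n)" unfolding K_def by (rule of_nat_ceiling)
      have "real (K n) = of_int \<lceil>real n powr (9/10)\<rceil>" by (simp add: K_def)
      then show "real (K n) \<le> real n powr (9/10) + 1" by linarith
    qed
    have kk: "real k ^ j \<ge> real n powr (real j * 9 / 10)" if "k \<ge> K n" for k j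
    proof -
      have "real n powr (real j * 9 / 10) = (real n powr (9/10)) ^ j" using n by (simp add: powr_power mult.commute)
      also have "\<dots> \<le> real k ^ j" using that Kge by (intro power_mono) auto
      finally show ?thesis .
    qed
    have "real (H_num n (cycle_graph 4)) \<le> (real p)\<^sup>2 * real n ^ (K n + 1) * (real p / (1 - 3 * e)) ^ n"
    proof (rule H_num_upper_bound_prime[OF p(1) np2 e(1)])
      have "2 \<le> e * real n powr (1/2)" using elim(2) e n by (simp add: field_simps)
      also have "\<dots> \<le> e * real p" using p(2) e unfolding s by (intro mult_left_mono) auto
      finally show "2 \<le> e * real p" .
      show "K n < n" using Kge elim(6) by linarith
      fix k assume k: "K n \<le> k"
      have "4 * real p \<le> 8 * real n powr (1/2)" using p2 by simp
      also have "\<dots> \<le> e * real n powr (9/10)" using elim(3) e by (simp add: field_simps)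
      also have "\<dots> \<le> e * real k" using kk[OF k, of 1] e by (intro mult_left_mono) auto
      finally show "4 * real p \<le> e * real k" .
      have "64 * real p ^ 3 \<le> 64 * (2 ^ 3 * real n powr (real 3 / 2))" by (intro mult_left_mono pk) auto
      also have "\<dots> \<le> e^3 * real n powr (18/10)" using elim(4) e by (simp add: field_simps)
      also have "\<dots> \<le> e^3 * (real k)^2" using kk[OF k, of 2] e by (intro mult_left_mono) auto
      finally show "64 * real p ^ 3 \<le> e^3 * (real k)^2" .
      have "256 * real p ^ 7 \<le> 256 * (2 ^ 7 * real n powr (real 7 / 2))" by (intro mult_left_mono pk) auto
      also have "\<dots> \<le> e^5 * real n powr (36/10)" using elim(5) e by (simp add: field_simps)
      also have "\<dots> \<le> e^5 * (real k)^4" using kk[OF k, of 4] e by (intro mult_left_mono) auto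
      finally show "256 * real p ^ 7 \<le> e^5 * (real k)^4" .
    qed (use e in auto)
    moreover have "real (H_num n (cycle_graph 4)) > 0"
      by (rule less_le_trans[OF _ H_num_lower_bound[OF elim(8)]]) (use n in simp)
    ultimately have "ln (real (H_num n (cycle_graph 4))) \<le> ln ((real p)\<^sup>2 * real n ^ (K n + 1) * (real p / (1 - 3 * e)) ^ n)"
      by (subst ln_le_cancel_iff) auto
    also have "\<dots> = 2 * ln p + real (K n + 1) * ln n + n * (ln p - ln (1 - 3 * e))"
      using n e prime_gt_0_nat[OF p(1)] by (simp add: ln_mult ln_realpow ln_div algebra_simps)
    also have "\<dots> \<le> 2 * (2 * e + ln n / 2) + (real n powr (9/10) + 2) * ln n + n * (2 * e + ln n / 2 + 6 * e)"
    proof -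
      have "ln (real p) \<le> ln (exp (2 * e) * sqrt (real n))"
        using p(3) prime_gt_0_nat[OF p(1)] n by (subst ln_le_cancel_iff) auto
      also have "\<dots> = 2 * e + ln n / 2" using n by (simp add: ln_mult ln_sqrt)
      finally have lp: "ln (real p) \<le> 2 * e + ln n / 2" .
      have "real (K n + 1) * ln n \<le> (real n powr (9/10) + 2) * ln n"
        using Kge n by (intro mult_right_mono) auto
      moreover have "n * (ln p - ln (1 - 3 * e)) \<le> n * (2 * e + ln n / 2 + 6 * e)"
        using lp l3 by (intro mult_left_mono) auto
      moreover have "2 * ln (real p) \<le> 2 * (2 * e + ln n / 2)" using lp by simp
      ultimately show ?thesis by (intro add_mono)
    qed
    also have "\<dots> = (ln n + 4 * e + (real n powr (9/10) + 2) * ln n) + real n / 2 * ln n + 8 * e * n"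
      by (simp add: field_simps)
    also have "ln n + 4 * e + (real n powr (9/10) + 2) * ln n \<le> e * n"
      using elim(1) e by linarith
    also have "e * n + real n / 2 * ln n + 8 * e * n = real n / 2 * ln n + 9 * e * n" by simp
    also have "\<dots> \<le> real n / 2 * ln n + c * n" using e by (intro add_left_mono mult_right_mono) auto
    finally show ?case by simp
  qed
qed

theorem theorem1p5:
  shows "\<exists>g h :: nat \<Rightarrow> real.
           g \<in> O(\<lambda>_. 1) \<and>
           h \<in> o(\<lambda>n. real n / ln (real n)) \<and>
           (\<forall>\<^sub>F n in sequentially.
              real n powr (1/2 * real n - 1/2 * (real n / ln (real n)) - g n)
                \<le> real (H_num n (cycle_graph 4)) \<and>
              real (H_num n (cycle_graph 4)) \<le> real n powr (1/2 * real n + h n))"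
proof -
  define H where "H = (\<lambda>n. real (H_num n (cycle_graph 4)))"
  \<comment> \<open>The exact excess of the exponent of \<open>H n\<close> over
    \<open>n / 2\<close>, truncated at \<open>0\<close>. The upper bound then holds by construction,
    and the content lies in \<open>h\<close> being \<open>o(n / ln n)\<close>.\<close>
  define h where "h = (\<lambda>n. max 0 (ln (H n) / ln (real n) - real n / 2))"
  have "h \<in> o(\<lambda>n. real n / ln (real n))"
  proof (rule landau_o.smallI)
    fix c :: real assume c: "c > 0"
    show "\<forall>\<^sub>F n in sequentially. norm (h n) \<le> c * norm (real n / ln (real n))"
      using ln_H_num_upper_bound[OF c] eventually_ge_at_top[of 2]
    proof eventually_elim
      case (elim n)
      have l: "ln (real n) > 0" using elim by simp
      have "ln (H n) / ln (real n) \<le> (real n / 2 * ln (real n) + c * real n) / ln (real n)"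
        using elim l by (intro divide_right_mono) (auto simp: H_def)
      also have "\<dots> = real n / 2 + c * (real n / ln (real n))" using l by (simp add: add_divide_distrib)
      finally have "h n \<le> c * (real n / ln (real n))" using c l by (simp add: h_def)
      then show ?case using l by (simp add: h_def)
    qed
  qed
  moreover have "\<forall>\<^sub>F n in sequentially.
      real n powr (1/2 * real n - 1/2 * (real n / ln (real n)) - 1) \<le> H n \<and> H n \<le> real n powr (1/2 * real n + h n)"
    using eventually_ge_at_top[of 2]
  proof eventually_elim
    case (elim n)
    have n: "real n > 1" using elim by simp
    have lower: "real n powr (1/2 * real n - 1/2 * (real n / ln (real n)) - 1) \<le> H n"
      unfolding H_def by (rule H_num_lower_bound) fact
    moreover have "real n powr (1/2 * real n - 1/2 * (real n / ln (real n)) - 1) > 0" using n by simp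
    ultimately have H0: "H n > 0" by linarith
    have "H n = real n powr (ln (H n) / ln (real n))" using n H0 by (simp add: powr_def)
    also have "\<dots> \<le> real n powr (1/2 * real n + h n)"
      using n by (intro powr_mono) (auto simp: h_def)
    finally show ?case using lower by blast
  qed
  ultimately show ?thesis
    unfolding H_def by (intro exI[of _ "\<lambda>_. 1"] exI[of _ h]) simp
qed

end
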